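(* Let $0<\alpha\le\tfrac12$, $\rho>0$, $\lambda>0$. Let $N$ be a homogeneous Poisson process with rate $\lambda$, independent of the inverse process $\mathcal{L}^{\alpha,\rho}$ of the sum $H_1^{2\alpha,\rho}(t)+H_2^{\alpha,\rho}(t)$ of independent tempered stable subordinators. Then the probabilities $p_n^{\alpha,\rho}(t)=\mathsf{P}\{N(\mathcal{L}^{\alpha,\rho}(t))=n\}$ satisfy $$\left(\mathcal{D}_t^{2\alpha,\rho}+\mathcal{D}_t^{\alpha,\rho}\right)p_n^{\alpha,\rho}(t)=-\lambda\left(p_n^{\alpha,\rho}(t)-p_{n-1}^{\alpha,\rho}(t)\right),\quad n\ge0,$$ with $p_{-1}^{\alpha,\rho}\equiv0$, $p_0^{\alpha,\rho}(0)=1$, $p_n^{\alpha,\rho}(0)=0$ for $n\ge1$; and the probability generating function $G_{\alpha,\rho}(u,t)=\sum_{n=0}^\infty u^np_n^{\alpha,\rho}(t)$, $|u|\le1$, solves $$\left(\mathcal{D}_t^{2\alpha,\rho}+\mathcal{D}_t^{\alpha,\rho}\right)G_{\alpha,\rho}(u,t)=\lambda(u-1)G_{\alpha,\rho}(u,t),\qquad G_{\alpha,\rho}(u,0)=1,$$ where $\mathcal{D}_t^{2\alpha,\rho}$, $\mathcal{D}_t^{\alpha,\rho}$ are the generalized Caputo–Djrbashian derivatives associated with tempered stable subordinators.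
   Context: For $\beta\in(0,1)$, $\rho>0$, the tempered stable subordinator $H^{\beta,\rho}$ is the nondecreasing Lévy process with $\mathsf{E}e^{-sH^{\beta,\rho}(t)}=e^{-t((s+\rho)^\beta-\rho^\beta)}$, $s>0$; for $\beta=1$ this means $H^{1,\rho}(t)=t$. $H_1^{2\alpha,\rho}$ and $H_2^{\alpha,\rho}$ are independent with parameters $(2\alpha,\rho)$ and $(\alpha,\rho)$, and $$\mathcal{L}^{\alpha,\rho}(t)=\inf\{s>0:H_1^{2\alpha,\rho}(s)+H_2^{\alpha,\rho}(s)\ge t\},\quad t>0,\qquad\mathcal{L}^{\alpha,\rho}(0)=0.$$ The generalized Caputo–Djrbashian derivative is, for $\beta\in(0,1)$, $$\mathcal{D}_t^{\beta,\rho}u(t)=\frac{\beta\rho^\beta}{\Gamma(1-\beta)}\int_0^t\frac{\partial}{\partial t}u(t-s)\,\Gamma(-\beta,\rho s)\,ds,\qquad\Gamma(-\beta,s)=\int_s^\infty e^{-z}z^{-\beta-1}dz,$$ and $\mathcal{D}_t^{1,\rho}=\frac{d}{dt}$. *)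

theory Defs
  imports "HOL-Probability.Probability"
begin

definition independent_increments :: "'a measure \<Rightarrow> (real \<Rightarrow> 'a \<Rightarrow> real) \<Rightarrow> bool" where
  "independent_increments M X \<longleftrightarrow>
     (\<forall>(\<tau>::nat \<Rightarrow> real) n. incseq \<tau> \<and> 0 \<le> \<tau> 0 \<longrightarrow>
        prob_space.indep_vars M (\<lambda>_. borel) (\<lambda>i \<omega>. X (\<tau> (Suc i)) \<omega> - X (\<tau> i) \<omega>) {..<n})"

definition stationary_increments :: "'a measure \<Rightarrow> (real \<Rightarrow> 'a \<Rightarrow> real) \<Rightarrow> bool" where
  "stationary_increments M X \<longleftrightarrow>
     (\<forall>s\<ge>0. \<forall>t\<ge>0. distr M borel (\<lambda>\<omega>. X (s + t) \<omega> - X s \<omega>) = distr M borel (X t))"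

definition stochastically_continuous :: "'a measure \<Rightarrow> (real \<Rightarrow> 'a \<Rightarrow> real) \<Rightarrow> bool" where
  "stochastically_continuous M X \<longleftrightarrow>
     (\<forall>s\<ge>0. \<forall>\<epsilon>>0. ((\<lambda>t. measure M {\<omega> \<in> space M. \<epsilon> \<le> \<bar>X t \<omega> - X s \<omega>\<bar>}) \<longlongrightarrow> 0)
        (at s within {0..}))"

definition cadlag :: "(real \<Rightarrow> real) \<Rightarrow> bool" where
  "cadlag x \<longleftrightarrow>
     (\<forall>t\<ge>0. continuous (at_right t) x) \<and> (\<forall>t>0. \<exists>l. (x \<longlongrightarrow> l) (at_left t))"

(* Time is [0, oo): values of X at negative times are irrelevant everywhere below. *)
definition levy_process :: "'a measure \<Rightarrow> (real \<Rightarrow> 'a \<Rightarrow> real) \<Rightarrow> bool" where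
  "levy_process M X \<longleftrightarrow>
     (\<forall>t\<ge>0. X t \<in> borel_measurable M) \<and>
     (AE \<omega> in M. X 0 \<omega> = 0) \<and>
     independent_increments M X \<and>
     stationary_increments M X \<and>
     stochastically_continuous M X \<and>
     (AE \<omega> in M. cadlag (\<lambda>t. X t \<omega>))"

definition poisson_process :: "'a measure \<Rightarrow> real \<Rightarrow> (real \<Rightarrow> 'a \<Rightarrow> nat) \<Rightarrow> bool" where
  "poisson_process M lam N \<longleftrightarrow>
     (\<forall>t\<ge>0. N t \<in> measurable M (count_space UNIV)) \<and>
     levy_process M (\<lambda>t \<omega>. real (N t \<omega>)) \<and>
     (\<forall>t>0. distr M (count_space UNIV) (N t) = measure_pmf (poisson_pmf (lam * t)))"

definition tempered_stable_subordinator ::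
    "'a measure \<Rightarrow> real \<Rightarrow> real \<Rightarrow> (real \<Rightarrow> 'a \<Rightarrow> real) \<Rightarrow> bool" where
  "tempered_stable_subordinator M \<beta> \<rho> H \<longleftrightarrow>
     levy_process M H \<and>
     (AE \<omega> in M. mono_on {0..} (\<lambda>t. H t \<omega>)) \<and>
     (if \<beta> = 1 then (AE \<omega> in M. \<forall>t\<ge>0. H t \<omega> = t)
      else (\<forall>t\<ge>0. \<forall>s>0. prob_space.expectation M (\<lambda>\<omega>. exp (- s * H t \<omega>)) =
              exp (- t * ((s + \<rho>) powr \<beta> - \<rho> powr \<beta>))))"

definition indep_processes ::
    "'a measure \<Rightarrow> (real \<Rightarrow> 'a \<Rightarrow> real) \<Rightarrow> (real \<Rightarrow> 'a \<Rightarrow> real) \<Rightarrow> bool" where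
  "indep_processes M X Y \<longleftrightarrow>
     prob_space.indep_var M
       (Pi\<^sub>M {0..} (\<lambda>_. borel)) (\<lambda>\<omega>. restrict (\<lambda>t. X t \<omega>) {0..})
       (Pi\<^sub>M {0..} (\<lambda>_. borel)) (\<lambda>\<omega>. restrict (\<lambda>t. Y t \<omega>) {0..})"

definition inverse_sum ::
    "(real \<Rightarrow> 'a \<Rightarrow> real) \<Rightarrow> (real \<Rightarrow> 'a \<Rightarrow> real) \<Rightarrow> real \<Rightarrow> 'a \<Rightarrow> real" where
  "inverse_sum H1 H2 t \<omega> = (if t > 0 then Inf {s. s > 0 \<and> H1 s \<omega> + H2 s \<omega> \<ge> t} else 0)"

(* Path properties hold almost surely only, so the event below, in which N is evaluated at a
   random time, is measurable up to a null set. Hence the completion, which agrees with M on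
   all events of M. *)
definition count_prob ::
    "'a measure \<Rightarrow> (real \<Rightarrow> 'a \<Rightarrow> nat) \<Rightarrow> (real \<Rightarrow> 'a \<Rightarrow> real) \<Rightarrow> nat \<Rightarrow> real \<Rightarrow> real" where
  "count_prob M N L n t = measure (completion M) {\<omega> \<in> space M. N (L t \<omega>) \<omega> = n}"

definition count_pgf ::
    "'a measure \<Rightarrow> (real \<Rightarrow> 'a \<Rightarrow> nat) \<Rightarrow> (real \<Rightarrow> 'a \<Rightarrow> real) \<Rightarrow> complex \<Rightarrow> real \<Rightarrow> complex" where
  "count_pgf M N L u t = (\<Sum>n. u ^ n * of_real (count_prob M N L n t))"

definition upper_Gamma :: "real \<Rightarrow> real \<Rightarrow> real" where
  "upper_Gamma a x = (LBINT z:{x<..}. exp (- z) * z powr (a - 1))"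

definition caputo_integrand ::
    "real \<Rightarrow> real \<Rightarrow> (real \<Rightarrow> 'b::{banach, second_countable_topology}) \<Rightarrow> real \<Rightarrow> real \<Rightarrow> 'b" where
  "caputo_integrand \<beta> \<rho> u t s =
     upper_Gamma (- \<beta>) (\<rho> * s) *\<^sub>R vector_derivative (\<lambda>\<tau>. u (\<tau> - s)) (at t)"

(* Both the derivative and the Bochner integral are total in HOL, so existence of the
   Caputo-Djrbashian derivative at t is a separate predicate, as differentiability is for
   vector_derivative. *)
definition caputo_differentiable ::
    "real \<Rightarrow> real \<Rightarrow> (real \<Rightarrow> 'b::{banach, second_countable_topology}) \<Rightarrow> real \<Rightarrow> bool" where
  "caputo_differentiable \<beta> \<rho> u t \<longleftrightarrow>
     (if \<beta> = 1 then u differentiable (at t)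
      else (\<forall>s\<in>{0<..<t}. (\<lambda>\<tau>. u (\<tau> - s)) differentiable (at t)) \<and>
           set_integrable lborel {0<..<t} (caputo_integrand \<beta> \<rho> u t))"

definition caputo_derivative ::
    "real \<Rightarrow> real \<Rightarrow> (real \<Rightarrow> 'b::{banach, second_countable_topology}) \<Rightarrow> real \<Rightarrow> 'b" where
  "caputo_derivative \<beta> \<rho> u t =
     (if \<beta> = 1 then vector_derivative u (at t)
      else (\<beta> * \<rho> powr \<beta> / Gamma (1 - \<beta>)) *\<^sub>R
             (LBINT s:{0<..<t}. caputo_integrand \<beta> \<rho> u t s))"

end

theory Submission
  imports Defs
begin

text \<open>
  Let S = H1 + H2 be the sum of the two subordinators. Its Laplace exponent is
  psi(s) = z^2 + z - c with z = (s + \<rho>)^\<alpha> and c = \<rho>^(2 \<alpha>) + \<rho>^\<alpha>; let L be the first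
  passage process of S. Conditioning on L gives
  p_n(t) = E[exp(-\<lambda> L(t)) (\<lambda> L(t))^n / n!], where \<lambda> is the rate of N, and therefore
  G(u, t) = E[exp(-\<lambda> (1 - u) L(t))], whose Laplace transform in t is
  psi(s) / (s (psi(s) + \<lambda> (1 - u))).

  Apart from the factor 1/s this is a rational function of z, so for large s it is a power series
  in 1/z, and (s + \<rho>)^(- \<alpha> k) / s is the transform of W_k(t), the distribution
  function of a gamma law of shape \<alpha> k and rate \<rho>, up to normalisation. Thus G(u, .)
  equals a series sum_k W_k(t) a_k whose coefficients satisfy a three-term linear recursion in k,
  and p_n is the series of the same kind with the coefficients of u^n. These explicit series
  provide what the probabilistic definition does not show: that p_n and G(u, .) are
  differentiable at every t > 0, with a derivative that is integrable against the singular kernel.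

  On such series the fractional derivatives act as shifts. The kernel of D^(\<beta>,\<rho>) is
  the tail of the Levy measure, with transform ((s + \<rho>)^\<beta> - \<rho>^\<beta>) / s, and convolving it
  with a gamma density of shape \<mu> gives the distribution function of shape \<mu> - \<beta> minus
  \<rho>^\<beta> times that of shape \<mu>. Consequently D^(j \<alpha>,\<rho>) replaces a_k by
  a_(k+j) - \<rho>^(j \<alpha>) a_k for k > 0, and by a_j for k = 0 (\<open>caputo_gamma_series\<close>);
  the value j \<alpha> = 1, an ordinary derivative, follows the same rule. So both
  evolution equations are nothing but the recursion for the coefficients.

  It remains to identify the probabilities with the series. The transform of
  E[exp(-\<theta> L(t))] is computed by discretising the time of S (\<open>laplace_first_passage\<close>), and
  coincides with that of the series for \<theta> = \<lambda> (1 - u) and real u in (-1, 1). A function that is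
  monotone in t and one that is continuous agree everywhere once their transforms do
  (\<open>laplace_unique_antimono_continuous\<close>). Comparing coefficients of powers of u yields p_n
  (\<open>count_prob_eq_gamma_series\<close>), and absolute convergence of the double series gives G(u, .) for
  all complex u with norm at most 1 (\<open>sums_gamma_series_prob_coeff\<close>).
\<close>

section \<open>Gamma densities and their distribution functions\<close>

text \<open>The density of the gamma law of shape \<mu> and rate \<rho>, divided by \<rho>^\<mu>. Without the
normalising factor the Laplace transform is the pure power (s + \<rho>)^(- \<mu>), and convolution adds
shapes without constants.\<close>

definition gamma_kernel :: "real \<Rightarrow> real \<Rightarrow> real \<Rightarrow> real" where
  "gamma_kernel \<rho> \<mu> r = (if r > 0 then exp (- \<rho> * r) * r powr (\<mu> - 1) / Gamma \<mu> else 0)"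

text \<open>Shape 0 stands for the unit mass at 0, with distribution function 1 at positive times. With this
convention the rules that lower the shape remain valid down to shape 0.\<close>

definition gamma_cdf :: "real \<Rightarrow> real \<Rightarrow> real \<Rightarrow> real" where
  "gamma_cdf \<rho> \<mu> t = (if \<mu> = 0 then 1 else LBINT r:{..<t}. gamma_kernel \<rho> \<mu> r)"

lemma gamma_kernel_nonneg: "\<mu> > 0 \<Longrightarrow> 0 \<le> gamma_kernel \<rho> \<mu> r"
  by (auto simp: gamma_kernel_def intro!: divide_nonneg_pos Gamma_real_pos)

lemma measurable_gamma_kernel [measurable]: "gamma_kernel \<rho> \<mu> \<in> borel_measurable borel"
  unfolding gamma_kernel_def[abs_def] by measurable

text \<open>Substituting r for t / (s + \<rho>) in Euler's integral for Gamma.\<close>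

lemma nn_integral_gamma_kernel_laplace:
  assumes "s + \<rho> > 0" "\<mu> > 0"
  shows "(\<integral>\<^sup>+r. ennreal (exp (- s * r) * gamma_kernel \<rho> \<mu> r) \<partial>lborel) = ennreal ((s + \<rho>) powr (- \<mu>))"
proof -
  define \<sigma> where "\<sigma> = s + \<rho>"
  have \<sigma>: "\<sigma> > 0" using assms by (simp add: \<sigma>_def)
  have "ennreal (Gamma \<mu>) = (\<integral>\<^sup>+t. ennreal (indicator {0..} t * t powr (\<mu> - 1) / exp t) \<partial>lborel)"
    using Gamma_conv_nn_integral_real[OF assms(2)] .
  also have "\<dots> = \<bar>\<sigma>\<bar> * (\<integral>\<^sup>+r. ennreal (indicator {0..} (0 + \<sigma> * r) * (0 + \<sigma> * r) powr (\<mu> - 1) / exp (0 + \<sigma> * r)) \<partial>lborel)"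
    using \<sigma> by (intro nn_integral_real_affine) auto
  also have "\<dots> = (\<integral>\<^sup>+r. ennreal (\<sigma> powr \<mu> * Gamma \<mu>) * ennreal (exp (- s * r) * gamma_kernel \<rho> \<mu> r) \<partial>lborel)"
  proof (subst nn_integral_cmult[symmetric], simp, intro nn_integral_cong)
    fix r :: real
    have G: "Gamma \<mu> > 0" using assms by (simp add: Gamma_real_pos)
    show "ennreal \<bar>\<sigma>\<bar> * ennreal (indicator {0..} (0 + \<sigma> * r) * (0 + \<sigma> * r) powr (\<mu> - 1) / exp (0 + \<sigma> * r)) =
         ennreal (\<sigma> powr \<mu> * Gamma \<mu>) * ennreal (exp (- s * r) * gamma_kernel \<rho> \<mu> r)"
    proof (cases "r > 0")
      case True
      have "\<sigma> * ((\<sigma> * r) powr (\<mu> - 1) / exp (\<sigma> * r)) = \<sigma> powr \<mu> * Gamma \<mu> * (exp (- s * r) * (exp (- \<rho> * r) * r powr (\<mu> - 1) / Gamma \<mu>))"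
      proof -
        have "(\<sigma> * r) powr (\<mu> - 1) = \<sigma> powr \<mu> / \<sigma> * r powr (\<mu> - 1)"
          using \<sigma> True by (simp add: powr_mult powr_diff)
        moreover have "exp (- s * r) * exp (- \<rho> * r) = 1 / exp (\<sigma> * r)"
          by (simp add: exp_add[symmetric] \<sigma>_def algebra_simps exp_minus[symmetric] inverse_eq_divide[symmetric])
        ultimately show ?thesis using \<sigma> G by (simp add: field_simps)
      qed
      thus ?thesis using True \<sigma> G
        by (simp add: ennreal_mult[symmetric] gamma_kernel_def zero_le_mult_iff)
    next
      case False
      then have "indicator {0..} (0 + \<sigma> * r) * (0 + \<sigma> * r) powr (\<mu> - 1) = 0"
        using \<sigma> by (cases "r = 0") (auto simp: indicator_def zero_le_mult_iff)
      thus ?thesis using False by (simp add: gamma_kernel_def)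
    qed
  qed
  also have "\<dots> = ennreal (\<sigma> powr \<mu> * Gamma \<mu>) * (\<integral>\<^sup>+r. ennreal (exp (- s * r) * gamma_kernel \<rho> \<mu> r) \<partial>lborel)"
    by (rule nn_integral_cmult) measurable
  finally have eq: "ennreal (Gamma \<mu>) = ennreal (\<sigma> powr \<mu> * Gamma \<mu>) * (\<integral>\<^sup>+r. ennreal (exp (- s * r) * gamma_kernel \<rho> \<mu> r) \<partial>lborel)" .
  have G: "Gamma \<mu> > 0" using assms by (simp add: Gamma_real_pos)
  have "ennreal (\<sigma> powr (- \<mu>) / Gamma \<mu>) * ennreal (Gamma \<mu>) = ennreal (\<sigma> powr (- \<mu>) / Gamma \<mu>) * ennreal (\<sigma> powr \<mu> * Gamma \<mu>) * (\<integral>\<^sup>+r. ennreal (exp (- s * r) * gamma_kernel \<rho> \<mu> r) \<partial>lborel)"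
    by (simp only: eq mult.assoc)
  moreover have "ennreal (\<sigma> powr (- \<mu>) / Gamma \<mu>) * ennreal (\<sigma> powr \<mu> * Gamma \<mu>) = 1"
    using G \<sigma> by (simp add: ennreal_mult[symmetric] powr_minus field_simps)
  moreover have "ennreal (\<sigma> powr (- \<mu>) / Gamma \<mu>) * ennreal (Gamma \<mu>) = ennreal (\<sigma> powr (- \<mu>))"
    using G \<sigma> by (simp add: ennreal_mult[symmetric])
  ultimately show ?thesis by (simp add: \<sigma>_def)
qed

lemma gamma_kernel_integrable:
  assumes "\<rho> > 0" "\<mu> > 0"
  shows "integrable lborel (gamma_kernel \<rho> \<mu>)"
proof (rule integrableI_bounded)
  show "(\<integral>\<^sup>+r. ennreal (norm (gamma_kernel \<rho> \<mu> r)) \<partial>lborel) < \<infinity>"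
    using nn_integral_gamma_kernel_laplace[of 0 \<rho> \<mu>] assms by (simp add: gamma_kernel_nonneg)
qed measurable

lemma nn_integral_gamma_kernel_lessThan:
  assumes "\<rho> > 0" "\<mu> > 0"
  shows "(\<integral>\<^sup>+r. ennreal (gamma_kernel \<rho> \<mu> r) * indicator {..<t} r \<partial>lborel) = ennreal (gamma_cdf \<rho> \<mu> t)"
proof -
  have "(\<integral>\<^sup>+r. ennreal (gamma_kernel \<rho> \<mu> r) * indicator {..<t} r \<partial>lborel)
     = (\<integral>\<^sup>+r. ennreal (indicator {..<t} r *\<^sub>R gamma_kernel \<rho> \<mu> r) \<partial>lborel)"
    by (intro nn_integral_cong) (auto split: split_indicator)
  also have "\<dots> = ennreal (\<integral>r. indicator {..<t} r *\<^sub>R gamma_kernel \<rho> \<mu> r \<partial>lborel)"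
    using gamma_kernel_nonneg[OF assms(2)]
    by (intro nn_integral_eq_integral integrable_mult_indicator gamma_kernel_integrable assms) auto
  finally show ?thesis using assms by (simp add: gamma_cdf_def set_lebesgue_integral_def)
qed

lemma gamma_cdf_nonneg: "\<mu> \<ge> 0 \<Longrightarrow> 0 \<le> gamma_cdf \<rho> \<mu> t"
  using gamma_kernel_nonneg[of \<mu> \<rho>] unfolding gamma_cdf_def set_lebesgue_integral_def
  by (auto intro!: Bochner_Integration.integral_nonneg)

lemma gamma_cdf_mono:
  assumes "\<rho> > 0" "\<mu> \<ge> 0" "s \<le> t"
  shows "gamma_cdf \<rho> \<mu> s \<le> gamma_cdf \<rho> \<mu> t"
proof (cases "\<mu> = 0")
  case False
  hence "\<mu> > 0" using assms by simp
  have int: "integrable lborel (\<lambda>r. indicator {..<x} r *\<^sub>R gamma_kernel \<rho> \<mu> r)" for x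
    by (intro integrable_mult_indicator gamma_kernel_integrable assms \<open>\<mu> > 0\<close>) simp
  have "(\<integral>r. indicator {..<s} r *\<^sub>R gamma_kernel \<rho> \<mu> r \<partial>lborel) \<le> (\<integral>r. indicator {..<t} r *\<^sub>R gamma_kernel \<rho> \<mu> r \<partial>lborel)"
    using gamma_kernel_nonneg[OF \<open>\<mu> > 0\<close>] assms
    by (intro integral_mono int) (auto split: split_indicator)
  thus ?thesis using False unfolding gamma_cdf_def set_lebesgue_integral_def by simp
qed (simp add: gamma_cdf_def)

lemma measurable_gamma_cdf [measurable]:
  assumes "\<rho> > 0" "\<mu> \<ge> 0"
  shows "gamma_cdf \<rho> \<mu> \<in> borel_measurable borel"
  using assms by (intro borel_measurable_mono) (auto simp: mono_def gamma_cdf_mono)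

lemma gamma_cdf_eq_0: "\<mu> \<noteq> 0 \<Longrightarrow> t \<le> 0 \<Longrightarrow> gamma_cdf \<rho> \<mu> t = 0"
proof -
  assume "\<mu> \<noteq> 0" "t \<le> 0"
  moreover have "(\<lambda>r. indicator {..<t} r *\<^sub>R gamma_kernel \<rho> \<mu> r) = (\<lambda>_. 0)"
    using \<open>t \<le> 0\<close> by (auto simp: gamma_kernel_def split: split_indicator)
  ultimately show ?thesis unfolding gamma_cdf_def set_lebesgue_integral_def by simp
qed

text \<open>Chernoff's bound: for r < t the factor exp (\<sigma> (t - r)) is at least 1, and after inserting it
the integral over all r is a Laplace transform. As \<sigma> is free, the bound
beats every geometric growth in \<mu>; this takes the place of Stirling's formula.\<close>

lemma gamma_cdf_le:
  assumes "\<rho> > 0" "\<sigma> \<ge> 0" "\<mu> \<ge> 0" "t > 0"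
  shows "gamma_cdf \<rho> \<mu> t \<le> exp (\<sigma> * t) * (\<sigma> + \<rho>) powr (- \<mu>)"
proof (cases "\<mu> = 0")
  case True
  thus ?thesis using assms by (simp add: gamma_cdf_def)
next
  case False
  hence \<mu>: "\<mu> > 0" using assms by simp
  have "ennreal (gamma_cdf \<rho> \<mu> t) = (\<integral>\<^sup>+r. ennreal (gamma_kernel \<rho> \<mu> r) * indicator {..<t} r \<partial>lborel)"
    using assms \<mu> by (simp add: nn_integral_gamma_kernel_lessThan)
  also have "\<dots> \<le> (\<integral>\<^sup>+r. ennreal (exp (\<sigma> * t)) * ennreal (exp (- \<sigma> * r) * gamma_kernel \<rho> \<mu> r) \<partial>lborel)"
  proof (intro nn_integral_mono)
    fix r
    have "1 \<le> exp (\<sigma> * t) * exp (- \<sigma> * r)" if "r < t"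
      using that assms by (simp add: exp_add[symmetric] right_diff_distrib[symmetric] mult_left_mono)
    from mult_right_mono[OF this gamma_kernel_nonneg[OF \<mu>, of \<rho> r]]
    show "ennreal (gamma_kernel \<rho> \<mu> r) * indicator {..<t} r
        \<le> ennreal (exp (\<sigma> * t)) * ennreal (exp (- \<sigma> * r) * gamma_kernel \<rho> \<mu> r)"
      by (auto split: split_indicator simp: ennreal_mult'[symmetric] mult.assoc intro!: ennreal_leI)
  qed
  also have "\<dots> = ennreal (exp (\<sigma> * t) * (\<sigma> + \<rho>) powr (- \<mu>))"
    using assms nn_integral_gamma_kernel_laplace[OF _ \<mu>, of \<sigma> \<rho>]
    by (subst nn_integral_cmult) (auto simp: ennreal_mult')
  finally show ?thesis by (subst (asm) ennreal_le_iff) auto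
qed

text \<open>Rescaling the convolution to the unit interval gives the Beta integral.\<close>

lemma nn_integral_gamma_kernel_convolution:
  assumes "\<rho> > 0" "\<mu> > 0" "\<nu> > 0"
  shows "(\<integral>\<^sup>+v. ennreal (gamma_kernel \<rho> \<mu> v * gamma_kernel \<rho> \<nu> (x - v)) \<partial>lborel) = ennreal (gamma_kernel \<rho> (\<mu> + \<nu>) x)"
proof (cases "x > 0")
  case False
  have "gamma_kernel \<rho> \<mu> v * gamma_kernel \<rho> \<nu> (x - v) = 0" for v
    using False by (auto simp: gamma_kernel_def)
  thus ?thesis using False by (subst nn_integral_cong[of _ _ "\<lambda>_. 0"]) (simp_all add: gamma_kernel_def)
next
  case x: True
  note G = Gamma_real_pos[OF assms(2)] Gamma_real_pos[OF assms(3)]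
  have B: "(\<integral>\<^sup>+t. ennreal (indicator {0..1} t * (t powr (\<mu> - 1) * (1 - t) powr (\<nu> - 1))) \<partial>lborel) = ennreal (Beta \<mu> \<nu>)"
    using nn_integral_has_integral_lebesgue[OF _ has_integral_Beta_real[OF assms(2,3)]] by simp
  have "(\<integral>\<^sup>+v. ennreal (gamma_kernel \<rho> \<mu> v * gamma_kernel \<rho> \<nu> (x - v)) \<partial>lborel)
     = \<bar>x\<bar> * (\<integral>\<^sup>+t. ennreal (gamma_kernel \<rho> \<mu> (0 + x * t) * gamma_kernel \<rho> \<nu> (x - (0 + x * t))) \<partial>lborel)"
    using x by (intro nn_integral_real_affine) auto
  also have "\<dots> = (\<integral>\<^sup>+t. ennreal (exp (- \<rho> * x) * x powr (\<mu> + \<nu> - 1) / (Gamma \<mu> * Gamma \<nu>)) *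
        ennreal (indicator {0..1} t * (t powr (\<mu> - 1) * (1 - t) powr (\<nu> - 1))) \<partial>lborel)"
  proof (subst nn_integral_cmult[symmetric], simp, intro nn_integral_cong)
    fix t :: real
    consider "t \<in> {0<..<1}" | "t \<notin> {0..1}" | "t = 0" | "t = 1" by fastforce
    thus "ennreal \<bar>x\<bar> * ennreal (gamma_kernel \<rho> \<mu> (0 + x * t) * gamma_kernel \<rho> \<nu> (x - (0 + x * t))) =
         ennreal (exp (- \<rho> * x) * x powr (\<mu> + \<nu> - 1) / (Gamma \<mu> * Gamma \<nu>)) *
         ennreal (indicator {0..1} t * (t powr (\<mu> - 1) * (1 - t) powr (\<nu> - 1)))"
    proof cases
      case 1
      have x1: "x - x * t = x * (1 - t)" by (simp add: algebra_simps)
      have e: "exp (- (\<rho> * (x * t))) * exp (- (\<rho> * (x * (1 - t)))) = exp (- (\<rho> * x))"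
        by (simp add: exp_add[symmetric] algebra_simps)
      have p: "x * ((x * t) powr (\<mu> - 1) * (x * (1 - t)) powr (\<nu> - 1)) = x powr (\<mu> + \<nu> - 1) * (t powr (\<mu> - 1) * (1 - t) powr (\<nu> - 1))"
      proof -
        have "x powr (\<mu> + \<nu> - 1) = x powr 1 * x powr (\<mu> - 1) * x powr (\<nu> - 1)"
          by (simp only: powr_add[symmetric]) (simp add: algebra_simps)
        thus ?thesis using 1 x by (simp add: powr_mult)
      qed
      have "x * (gamma_kernel \<rho> \<mu> (0 + x * t) * gamma_kernel \<rho> \<nu> (x - (0 + x * t))) =
        (exp (- (\<rho> * (x * t))) * exp (- (\<rho> * (x * (1 - t))))) * (x * ((x * t) powr (\<mu> - 1) * (x * (1 - t)) powr (\<nu> - 1))) / (Gamma \<mu> * Gamma \<nu>)"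
        using 1 x by (simp add: gamma_kernel_def x1)
      also have "\<dots> = exp (- \<rho> * x) * x powr (\<mu> + \<nu> - 1) / (Gamma \<mu> * Gamma \<nu>) *
         (indicator {0..1} t * (t powr (\<mu> - 1) * (1 - t) powr (\<nu> - 1)))"
        unfolding e p using 1 by simp
      finally show ?thesis using x G by (simp add: ennreal_mult'[symmetric])
    next
      case 2
      hence "gamma_kernel \<rho> \<mu> (0 + x * t) * gamma_kernel \<rho> \<nu> (x - (0 + x * t)) = 0"
        using x by (auto simp: gamma_kernel_def zero_less_mult_iff mult_less_cancel_left1)
      thus ?thesis using 2 by auto
    qed (auto simp: gamma_kernel_def)
  qed
  also have "\<dots> = ennreal (exp (- \<rho> * x) * x powr (\<mu> + \<nu> - 1) / (Gamma \<mu> * Gamma \<nu>)) * ennreal (Beta \<mu> \<nu>)"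
    by (subst nn_integral_cmult) (simp_all add: B)
  also have "\<dots> = ennreal (exp (- \<rho> * x) * x powr (\<mu> + \<nu> - 1) / (Gamma \<mu> * Gamma \<nu>) * Beta \<mu> \<nu>)"
    using G x by (intro ennreal_mult'[symmetric]) simp
  also have "exp (- \<rho> * x) * x powr (\<mu> + \<nu> - 1) / (Gamma \<mu> * Gamma \<nu>) * Beta \<mu> \<nu> = gamma_kernel \<rho> (\<mu> + \<nu>) x"
    using x G by (simp add: gamma_kernel_def Beta_def)
  finally show ?thesis .
qed

text \<open>Associativity of convolution: a distribution function is the convolution of the density
with the constant 1.\<close>

lemma nn_integral_gamma_kernel_cdf:
  assumes "\<rho> > 0" "\<mu> > 0" "\<nu> > 0"
  shows "(\<integral>\<^sup>+v. ennreal (gamma_kernel \<rho> \<mu> v * gamma_cdf \<rho> \<nu> (t - v)) \<partial>lborel) = ennreal (gamma_cdf \<rho> (\<mu> + \<nu>) t)"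
proof -
  have "(\<integral>\<^sup>+v. ennreal (gamma_kernel \<rho> \<mu> v * gamma_cdf \<rho> \<nu> (t - v)) \<partial>lborel)
      = (\<integral>\<^sup>+v. \<integral>\<^sup>+x. ennreal (gamma_kernel \<rho> \<mu> v * gamma_kernel \<rho> \<nu> (x - v)) * indicator {..<t} x \<partial>lborel \<partial>lborel)"
  proof (intro nn_integral_cong)
    fix v :: real
    have "ennreal (gamma_kernel \<rho> \<mu> v * gamma_cdf \<rho> \<nu> (t - v)) =
        ennreal (gamma_kernel \<rho> \<mu> v) * (\<integral>\<^sup>+r. ennreal (gamma_kernel \<rho> \<nu> r) * indicator {..<t - v} r \<partial>lborel)"
      using assms by (simp add: nn_integral_gamma_kernel_lessThan ennreal_mult' gamma_kernel_nonneg)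
    also have "(\<integral>\<^sup>+r. ennreal (gamma_kernel \<rho> \<nu> r) * indicator {..<t - v} r \<partial>lborel) =
        ennreal \<bar>1\<bar> * (\<integral>\<^sup>+x. ennreal (gamma_kernel \<rho> \<nu> (- v + 1 * x)) * indicator {..<t - v} (- v + 1 * x) \<partial>lborel)"
      by (intro nn_integral_real_affine) auto
    also have "\<dots> = (\<integral>\<^sup>+x. ennreal (gamma_kernel \<rho> \<nu> (x - v)) * indicator {..<t} x \<partial>lborel)"
      by (auto intro!: nn_integral_cong split: split_indicator)
    also have "ennreal (gamma_kernel \<rho> \<mu> v) * \<dots> = (\<integral>\<^sup>+x. ennreal (gamma_kernel \<rho> \<mu> v * gamma_kernel \<rho> \<nu> (x - v)) * indicator {..<t} x \<partial>lborel)"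
      by (subst nn_integral_cmult[symmetric])
         (auto simp: ennreal_mult' gamma_kernel_nonneg assms mult.assoc)
    finally show "ennreal (gamma_kernel \<rho> \<mu> v * gamma_cdf \<rho> \<nu> (t - v)) = \<dots>" .
  qed
  also have "\<dots> = (\<integral>\<^sup>+x. \<integral>\<^sup>+v. ennreal (gamma_kernel \<rho> \<mu> v * gamma_kernel \<rho> \<nu> (x - v)) * indicator {..<t} x \<partial>lborel \<partial>lborel)"
    by (rule lborel_pair.Fubini') measurable
  also have "\<dots> = (\<integral>\<^sup>+x. ennreal (gamma_kernel \<rho> (\<mu> + \<nu>) x) * indicator {..<t} x \<partial>lborel)"
    using assms by (subst nn_integral_multc) (simp_all add: nn_integral_gamma_kernel_convolution)
  also have "\<dots> = ennreal (gamma_cdf \<rho> (\<mu> + \<nu>) t)"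
    using assms by (intro nn_integral_gamma_kernel_lessThan) auto
  finally show ?thesis .
qed

lemma gamma_cdf_1:
  assumes "\<rho> > 0" "t > 0"
  shows "\<rho> * gamma_cdf \<rho> 1 t = 1 - exp (- \<rho> * t)"
proof -
  have "ennreal (gamma_cdf \<rho> 1 t) = (\<integral>\<^sup>+r. ennreal (gamma_kernel \<rho> 1 r) * indicator {..<t} r \<partial>lborel)"
    using assms by (simp add: nn_integral_gamma_kernel_lessThan)
  also have "\<dots> = (\<integral>\<^sup>+r. ennreal (exp (- \<rho> * r)) * indicator {0..t} r \<partial>lborel)"
  proof (rule nn_integral_cong_AE)
    have "AE r in lborel. r \<noteq> 0" "AE r in lborel. r \<noteq> t" by (rule AE_lborel_singleton)+
    thus "AE r in lborel. ennreal (gamma_kernel \<rho> 1 r) * indicator {..<t} r = ennreal (exp (- \<rho> * r)) * indicator {0..t} r"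
      by eventually_elim (auto simp: gamma_kernel_def split: split_indicator)
  qed
  also have "\<dots> = ennreal (- exp (- \<rho> * t) / \<rho> - (- exp (- \<rho> * 0) / \<rho>))"
    using assms by (intro nn_integral_FTC_Icc)
      (auto intro!: derivative_eq_intros simp flip: has_real_derivative_iff_has_vector_derivative)
  finally have "gamma_cdf \<rho> 1 t = (1 - exp (- \<rho> * t)) / \<rho>"
    using assms by (subst (asm) ennreal_inj) (auto simp: gamma_cdf_nonneg field_simps)
  thus ?thesis using assms by simp
qed

text \<open>On transforms this says (s + \<rho>)^(- \<mu> - 1) (1 + \<rho> / s) = (s + \<rho>)^(- \<mu>) / s. For shape 0 it is the
distribution function of the exponential law; convolving that case with the density of shape \<mu>
gives the general one.\<close>

lemma gamma_kernel_Suc_eq: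
  assumes "\<rho> > 0" "\<mu> \<ge> 0" "t > 0"
  shows "gamma_kernel \<rho> (\<mu> + 1) t + \<rho> * gamma_cdf \<rho> (\<mu> + 1) t = gamma_cdf \<rho> \<mu> t"
proof (cases "\<mu> = 0")
  case True
  thus ?thesis using assms by (simp add: gamma_cdf_1 gamma_kernel_def) (simp add: gamma_cdf_def)
next
  case False
  hence \<mu>: "\<mu> > 0" using assms by simp
  have "ennreal (gamma_kernel \<rho> (\<mu> + 1) t + \<rho> * gamma_cdf \<rho> (\<mu> + 1) t) =
     (\<integral>\<^sup>+v. ennreal (gamma_kernel \<rho> \<mu> v * gamma_kernel \<rho> 1 (t - v)) \<partial>lborel) +
     ennreal \<rho> * (\<integral>\<^sup>+v. ennreal (gamma_kernel \<rho> \<mu> v * gamma_cdf \<rho> 1 (t - v)) \<partial>lborel)"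
    unfolding nn_integral_gamma_kernel_convolution[OF assms(1) \<mu> zero_less_one]
      nn_integral_gamma_kernel_cdf[OF assms(1) \<mu> zero_less_one]
    using assms by (simp add: gamma_kernel_nonneg gamma_cdf_nonneg ennreal_mult')
  also have "\<dots> = (\<integral>\<^sup>+v. ennreal (gamma_kernel \<rho> \<mu> v * gamma_kernel \<rho> 1 (t - v)) +
     ennreal \<rho> * ennreal (gamma_kernel \<rho> \<mu> v * gamma_cdf \<rho> 1 (t - v)) \<partial>lborel)"
    using assms by (subst nn_integral_add) (auto intro!: nn_integral_cmult[symmetric])
  also have "\<dots> = (\<integral>\<^sup>+v. ennreal (gamma_kernel \<rho> \<mu> v) * indicator {..<t} v \<partial>lborel)"
  proof (intro nn_integral_cong)
    fix v :: real
    have "gamma_kernel \<rho> \<mu> v * gamma_kernel \<rho> 1 (t - v) + \<rho> * (gamma_kernel \<rho> \<mu> v * gamma_cdf \<rho> 1 (t - v))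
       = gamma_kernel \<rho> \<mu> v * (gamma_kernel \<rho> 1 (t - v) + \<rho> * gamma_cdf \<rho> 1 (t - v))"
      by (simp add: algebra_simps)
    also have "\<dots> = gamma_kernel \<rho> \<mu> v * indicator {..<t} v"
      using assms by (cases "v < t") (simp_all add: gamma_cdf_1 gamma_cdf_eq_0, simp_all add: gamma_kernel_def)
    finally have "gamma_kernel \<rho> \<mu> v * gamma_kernel \<rho> 1 (t - v) + \<rho> * (gamma_kernel \<rho> \<mu> v * gamma_cdf \<rho> 1 (t - v))
       = gamma_kernel \<rho> \<mu> v * indicator {..<t} v" .
    thus "ennreal (gamma_kernel \<rho> \<mu> v * gamma_kernel \<rho> 1 (t - v)) +
     ennreal \<rho> * ennreal (gamma_kernel \<rho> \<mu> v * gamma_cdf \<rho> 1 (t - v)) = ennreal (gamma_kernel \<rho> \<mu> v) * indicator {..<t} v"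
      using assms \<mu> by (simp add: ennreal_mult'[symmetric] ennreal_plus[symmetric] gamma_kernel_nonneg
          gamma_cdf_nonneg del: ennreal_plus split: split_indicator)
  qed
  also have "\<dots> = ennreal (gamma_cdf \<rho> \<mu> t)"
    using assms \<mu> by (simp add: nn_integral_gamma_kernel_lessThan)
  finally show ?thesis
    using assms \<mu> by (subst (asm) ennreal_inj) (auto simp: gamma_kernel_nonneg gamma_cdf_nonneg)
qed

section \<open>The tail of the tempered stable Levy measure\<close>

text \<open>The kernel of the generalized Caputo-Djrbashian derivative. It is the mass of (s, \<infinity>) under the
Levy measure \<beta> / Gamma (1 - \<beta>) exp (- \<rho> z) z^(- \<beta> - 1) dz of the tempered stable subordinator.\<close>

definition levy_tail :: "real \<Rightarrow> real \<Rightarrow> real \<Rightarrow> real" where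
  "levy_tail \<rho> \<beta> s = \<beta> * \<rho> powr \<beta> / Gamma (1 - \<beta>) * upper_Gamma (- \<beta>) (\<rho> * s)"

lemma upper_Gamma_nonneg: "0 \<le> upper_Gamma a x"
  unfolding upper_Gamma_def set_lebesgue_integral_def by (intro Bochner_Integration.integral_nonneg) auto

lemma levy_tail_nonneg: "0 < \<beta> \<Longrightarrow> \<beta> < 1 \<Longrightarrow> 0 \<le> levy_tail \<rho> \<beta> s"
  using Gamma_real_pos[of "1 - \<beta>"] by (simp add: levy_tail_def upper_Gamma_nonneg)

text \<open>Integration by parts in the tail integral trades the singularity z^(- \<beta> - 1) for z^(- \<beta>). On
transforms, ((s + \<rho>)^\<beta> - \<rho>^\<beta>) / s is written as (s + \<rho>)^(\<beta> - 1) (1 + \<rho> / s) - \<rho>^\<beta> / s.\<close>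

lemma levy_tail_eq:
  assumes "\<rho> > 0" "0 < \<beta>" "\<beta> < 1" "s > 0"
  shows "levy_tail \<rho> \<beta> s + \<rho> powr \<beta> = gamma_kernel \<rho> (1 - \<beta>) s + \<rho> * gamma_cdf \<rho> (1 - \<beta>) s"
proof -
  define G where "G = Gamma (1 - \<beta>)"
  have G: "G > 0" using assms by (simp add: G_def Gamma_real_pos)
  define f where "f r = \<beta> / G * (exp (- \<rho> * r) * r powr (- \<beta> - 1))" for r
  define F where "F r = - (exp (- \<rho> * r) * r powr (- \<beta>) / G)" for r
  have f_nonneg: "0 \<le> f r" for r using assms G by (simp add: f_def)
  have [measurable]: "f \<in> borel_measurable borel" unfolding f_def[abs_def] by measurable
  have gk: "gamma_kernel \<rho> (1 - \<beta>) r = exp (- \<rho> * r) * r powr (- \<beta>) / G" if "r > 0" for r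
    using that by (simp add: gamma_kernel_def G_def)
  \<comment> \<open>The integrand is the derivative of the negative gamma density of shape 1 - \<beta>;
    its two parts are the Levy density and a multiple of that gamma density.\<close>
  have "(\<integral>\<^sup>+r. ennreal (f r + \<rho> * gamma_kernel \<rho> (1 - \<beta>) r) * indicator {s..} r \<partial>lborel) = ennreal (0 - F s)"
  proof (rule nn_integral_FTC_atLeast)
    fix r assume "s \<le> r"
    hence r: "r > 0" using assms by simp
    show "0 \<le> f r + \<rho> * gamma_kernel \<rho> (1 - \<beta>) r"
      using assms f_nonneg by (simp add: gamma_kernel_nonneg)
    show "(F has_real_derivative f r + \<rho> * gamma_kernel \<rho> (1 - \<beta>) r) (at r)"
      unfolding F_def f_def gk[OF r]
      using r G by (auto intro!: derivative_eq_intros simp: field_simps)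
  next
    have "((\<lambda>r. exp (- \<rho> * r) * r powr (- \<beta>)) \<longlongrightarrow> 0) at_top"
    proof (rule tendsto_mult_zero)
      show "((\<lambda>r. exp (- \<rho> * r)) \<longlongrightarrow> 0) at_top"
        using assms by (intro filterlim_compose[OF exp_at_bot] filterlim_tendsto_neg_mult_at_bot[OF tendsto_const])
           (auto simp: filterlim_ident)
      show "((\<lambda>r::real. r powr (- \<beta>)) \<longlongrightarrow> 0) at_top"
        using assms by (intro tendsto_neg_powr filterlim_ident) auto
    qed
    from tendsto_minus[OF tendsto_divide[OF this tendsto_const[of G]]] G
    show "(F \<longlongrightarrow> 0) at_top" unfolding F_def by simp
  qed measurable
  also have "0 - F s = gamma_kernel \<rho> (1 - \<beta>) s" using assms by (simp add: F_def gk)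
  also have "(\<integral>\<^sup>+r. ennreal (f r + \<rho> * gamma_kernel \<rho> (1 - \<beta>) r) * indicator {s..} r \<partial>lborel) =
     (\<integral>\<^sup>+r. ennreal (f r) * indicator {s..} r + ennreal \<rho> * (ennreal (gamma_kernel \<rho> (1 - \<beta>) r) * indicator {s..} r) \<partial>lborel)"
    using assms by (intro nn_integral_cong)
      (auto simp: f_nonneg gamma_kernel_nonneg ennreal_mult' split: split_indicator)
  also have "\<dots> = (\<integral>\<^sup>+r. ennreal (f r) * indicator {s..} r \<partial>lborel) +
      ennreal \<rho> * (\<integral>\<^sup>+r. ennreal (gamma_kernel \<rho> (1 - \<beta>) r) * indicator {s..} r \<partial>lborel)"
    by (subst nn_integral_add) (auto intro!: nn_integral_cmult)
  finally have sum: "ennreal (gamma_kernel \<rho> (1 - \<beta>) s) = (\<integral>\<^sup>+r. ennreal (f r) * indicator {s..} r \<partial>lborel) +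
      ennreal \<rho> * (\<integral>\<^sup>+r. ennreal (gamma_kernel \<rho> (1 - \<beta>) r) * indicator {s..} r \<partial>lborel)" ..
  have "ennreal (\<rho> powr (- (1 - \<beta>))) = (\<integral>\<^sup>+r. ennreal (gamma_kernel \<rho> (1 - \<beta>) r) \<partial>lborel)"
    using nn_integral_gamma_kernel_laplace[of 0 \<rho> "1 - \<beta>"] assms by simp
  also have "\<dots> = (\<integral>\<^sup>+r. ennreal (gamma_kernel \<rho> (1 - \<beta>) r) * indicator {..<s} r + ennreal (gamma_kernel \<rho> (1 - \<beta>) r) * indicator {s..} r \<partial>lborel)"
    by (intro nn_integral_cong) (auto split: split_indicator)
  also have "\<dots> = ennreal (gamma_cdf \<rho> (1 - \<beta>) s) + (\<integral>\<^sup>+r. ennreal (gamma_kernel \<rho> (1 - \<beta>) r) * indicator {s..} r \<partial>lborel)"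
    using assms by (subst nn_integral_add) (auto simp: nn_integral_gamma_kernel_lessThan)
  finally have tot: "ennreal (\<rho> powr (- (1 - \<beta>))) = \<dots>" .
  have "\<beta> * \<rho> powr \<beta> / G * upper_Gamma (- \<beta>) (\<rho> * s) = enn2real (\<integral>\<^sup>+r. ennreal (f r) * indicator {s..} r \<partial>lborel)"
  proof -
    have "upper_Gamma (- \<beta>) (\<rho> * s) = \<bar>\<rho>\<bar> *\<^sub>R (\<integral>r. indicator {\<rho> * s<..} (0 + \<rho> * r) *\<^sub>R (exp (- (0 + \<rho> * r)) * (0 + \<rho> * r) powr (- \<beta> - 1)) \<partial>lborel)"
      unfolding upper_Gamma_def set_lebesgue_integral_def
      using assms by (intro lborel_integral_real_affine) auto
    also have "(\<integral>r. indicator {\<rho> * s<..} (0 + \<rho> * r) *\<^sub>R (exp (- (0 + \<rho> * r)) * (0 + \<rho> * r) powr (- \<beta> - 1)) \<partial>lborel)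
       = (\<integral>r. G / \<beta> * \<rho> powr (- \<beta> - 1) * (f r * indicator {s..} r) \<partial>lborel)"
    proof (intro integral_cong_AE)
      show "AE r in lborel. indicator {\<rho> * s<..} (0 + \<rho> * r) *\<^sub>R (exp (- (0 + \<rho> * r)) * (0 + \<rho> * r) powr (- \<beta> - 1)) = G / \<beta> * \<rho> powr (- \<beta> - 1) * (f r * indicator {s..} r)"
        using AE_lborel_singleton[of s]
        by eventually_elim (use assms G in \<open>auto simp: f_def powr_mult split: split_indicator\<close>)
    qed measurable
    also have "\<dots> = G / \<beta> * \<rho> powr (- \<beta> - 1) * (\<integral>r. f r * indicator {s..} r \<partial>lborel)"
      by simp
    also have "(\<integral>r. f r * indicator {s..} r \<partial>lborel) = enn2real (\<integral>\<^sup>+r. ennreal (f r * indicator {s..} r) \<partial>lborel)"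
      by (intro integral_eq_nn_integral) (auto simp: f_nonneg)
    also have "(\<integral>\<^sup>+r. ennreal (f r * indicator {s..} r) \<partial>lborel) = (\<integral>\<^sup>+r. ennreal (f r) * indicator {s..} r \<partial>lborel)"
      by (intro nn_integral_cong) (auto split: split_indicator)
    finally have "upper_Gamma (- \<beta>) (\<rho> * s) = \<rho> * (G / \<beta> * \<rho> powr (- \<beta> - 1) * enn2real (\<integral>\<^sup>+r. ennreal (f r) * indicator {s..} r \<partial>lborel))"
      using assms by simp
    hence "\<beta> * \<rho> powr \<beta> / G * upper_Gamma (- \<beta>) (\<rho> * s) =
        (\<rho> * (\<rho> powr \<beta> * \<rho> powr (- \<beta> - 1))) * enn2real (\<integral>\<^sup>+r. ennreal (f r) * indicator {s..} r \<partial>lborel)"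
      using assms G by simp
    also have "\<rho> * (\<rho> powr \<beta> * \<rho> powr (- \<beta> - 1)) = 1"
      using assms by (simp add: powr_add[symmetric] powr_minus)
    finally show ?thesis by simp
  qed
  hence tail: "levy_tail \<rho> \<beta> s = enn2real (\<integral>\<^sup>+r. ennreal (f r) * indicator {s..} r \<partial>lborel)"
    by (simp add: levy_tail_def G_def)
  define A where "A = (\<integral>\<^sup>+r. ennreal (f r) * indicator {s..} r \<partial>lborel)"
  define B where "B = (\<integral>\<^sup>+r. ennreal (gamma_kernel \<rho> (1 - \<beta>) r) * indicator {s..} r \<partial>lborel)"
  have "A \<noteq> \<infinity>" using sum unfolding A_def[symmetric] by (metis ennreal_neq_top ennreal_add_eq_top infinity_ennreal_def)
  then obtain a where a: "A = ennreal a" "a \<ge> 0" by (cases A) auto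
  have "B \<noteq> \<infinity>" using tot unfolding B_def[symmetric] by (metis ennreal_neq_top ennreal_add_eq_top infinity_ennreal_def)
  then obtain b where b: "B = ennreal b" "b \<ge> 0" by (cases B) auto
  have 1: "gamma_kernel \<rho> (1 - \<beta>) s = a + \<rho> * b"
    using sum a b assms unfolding A_def[symmetric] B_def[symmetric]
    by (simp add: ennreal_mult'[symmetric] ennreal_plus[symmetric] gamma_kernel_nonneg del: ennreal_plus)
  have 2: "\<rho> powr (- (1 - \<beta>)) = gamma_cdf \<rho> (1 - \<beta>) s + b"
    using tot b assms unfolding B_def[symmetric]
    by (simp add: ennreal_plus[symmetric] gamma_cdf_nonneg del: ennreal_plus)
  have "\<rho> * \<rho> powr (- (1 - \<beta>)) = \<rho> powr \<beta>"
    using assms by (simp add: powr_mult_base)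
  thus ?thesis using 1 2 tail a unfolding A_def[symmetric] by (simp add: algebra_simps)
qed

text \<open>The rule behind everything: the Levy tail lowers the shape of a gamma density by \<beta> and subtracts
\<rho>^\<beta> times the distribution function. Adding back the constant \<rho>^\<beta> turns the tail into a sum of
a gamma density and a gamma distribution function, for which the convolutions are known.\<close>

lemma has_bochner_integral_levy_tail_gamma_kernel:
  assumes "\<rho> > 0" "0 < \<beta>" "\<beta> < 1" "\<beta> \<le> \<mu>" "t > 0"
  shows "has_bochner_integral lborel (\<lambda>s. indicator {0<..<t} s * (levy_tail \<rho> \<beta> s * gamma_kernel \<rho> \<mu> (t - s)))
           (gamma_cdf \<rho> (\<mu> - \<beta>) t - \<rho> powr \<beta> * gamma_cdf \<rho> \<mu> t)"
proof -
  have \<mu>: "\<mu> > 0" using assms by simp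
  define K where "K s = indicator {0<..} s * (gamma_kernel \<rho> (1 - \<beta>) s + \<rho> * gamma_cdf \<rho> (1 - \<beta>) s - \<rho> powr \<beta>)" for s
  have K: "K s = indicator {0<..} s * levy_tail \<rho> \<beta> s" for s
    using levy_tail_eq[OF assms(1-3), of s] by (auto simp: K_def split: split_indicator)
  have [measurable]: "gamma_cdf \<rho> (1 - \<beta>) \<in> borel_measurable borel" using assms by simp
  have K_meas [measurable]: "K \<in> borel_measurable borel" unfolding K_def[abs_def] by measurable
  have K_nonneg: "0 \<le> K s" for s using assms by (simp add: K levy_tail_nonneg)
  define I where "I = (\<integral>\<^sup>+v. ennreal (gamma_kernel \<rho> \<mu> v * K (t - v)) \<partial>lborel)"
  have "I + ennreal (\<rho> powr \<beta> * gamma_cdf \<rho> \<mu> t) = I + ennreal (\<rho> powr \<beta>) * (\<integral>\<^sup>+r. ennreal (gamma_kernel \<rho> \<mu> r) * indicator {..<t} r \<partial>lborel)"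
    using assms \<mu> by (simp add: nn_integral_gamma_kernel_lessThan ennreal_mult')
  also have "\<dots> = (\<integral>\<^sup>+v. ennreal (gamma_kernel \<rho> \<mu> v * K (t - v)) + ennreal (\<rho> powr \<beta>) * (ennreal (gamma_kernel \<rho> \<mu> v) * indicator {..<t} v) \<partial>lborel)"
    unfolding I_def by (subst nn_integral_add) (auto intro!: nn_integral_cmult[symmetric])
  also have "\<dots> = (\<integral>\<^sup>+v. ennreal (gamma_kernel \<rho> \<mu> v * gamma_kernel \<rho> (1 - \<beta>) (t - v)) +
       ennreal \<rho> * ennreal (gamma_kernel \<rho> \<mu> v * gamma_cdf \<rho> (1 - \<beta>) (t - v)) \<partial>lborel)"
  proof (intro nn_integral_cong)
    fix v
    have g: "0 \<le> gamma_kernel \<rho> \<mu> v" "0 \<le> gamma_kernel \<rho> (1 - \<beta>) (t - v)" "0 \<le> gamma_cdf \<rho> (1 - \<beta>) (t - v)"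
      using assms \<mu> by (simp_all add: gamma_kernel_nonneg gamma_cdf_nonneg)
    have "gamma_kernel \<rho> \<mu> v * K (t - v) + \<rho> powr \<beta> * (gamma_kernel \<rho> \<mu> v * indicator {..<t} v) =
       gamma_kernel \<rho> \<mu> v * gamma_kernel \<rho> (1 - \<beta>) (t - v) + \<rho> * (gamma_kernel \<rho> \<mu> v * gamma_cdf \<rho> (1 - \<beta>) (t - v))"
    proof (cases "v < t")
      case False
      hence "gamma_kernel \<rho> (1 - \<beta>) (t - v) = 0" "gamma_cdf \<rho> (1 - \<beta>) (t - v) = 0"
        using assms by (auto simp: gamma_kernel_def intro!: gamma_cdf_eq_0)
      thus ?thesis using False by (simp add: K_def)
    qed (simp add: K_def algebra_simps)
    moreover have "ennreal (gamma_kernel \<rho> \<mu> v * K (t - v)) + ennreal (\<rho> powr \<beta>) * (ennreal (gamma_kernel \<rho> \<mu> v) * indicator {..<t} v) =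
       ennreal (gamma_kernel \<rho> \<mu> v * K (t - v) + \<rho> powr \<beta> * (gamma_kernel \<rho> \<mu> v * indicator {..<t} v))"
      using g K_nonneg by (auto simp: ennreal_mult' split: split_indicator)
    moreover have "ennreal (gamma_kernel \<rho> \<mu> v * gamma_kernel \<rho> (1 - \<beta>) (t - v)) +
       ennreal \<rho> * ennreal (gamma_kernel \<rho> \<mu> v * gamma_cdf \<rho> (1 - \<beta>) (t - v)) =
       ennreal (gamma_kernel \<rho> \<mu> v * gamma_kernel \<rho> (1 - \<beta>) (t - v) + \<rho> * (gamma_kernel \<rho> \<mu> v * gamma_cdf \<rho> (1 - \<beta>) (t - v)))"
      using g assms by (simp add: ennreal_mult')
    ultimately show "ennreal (gamma_kernel \<rho> \<mu> v * K (t - v)) + ennreal (\<rho> powr \<beta>) * (ennreal (gamma_kernel \<rho> \<mu> v) * indicator {..<t} v) =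
       ennreal (gamma_kernel \<rho> \<mu> v * gamma_kernel \<rho> (1 - \<beta>) (t - v)) +
       ennreal \<rho> * ennreal (gamma_kernel \<rho> \<mu> v * gamma_cdf \<rho> (1 - \<beta>) (t - v))" by simp
  qed
  also have "\<dots> = (\<integral>\<^sup>+v. ennreal (gamma_kernel \<rho> \<mu> v * gamma_kernel \<rho> (1 - \<beta>) (t - v)) \<partial>lborel) +
      ennreal \<rho> * (\<integral>\<^sup>+v. ennreal (gamma_kernel \<rho> \<mu> v * gamma_cdf \<rho> (1 - \<beta>) (t - v)) \<partial>lborel)"
    by (subst nn_integral_add) (auto intro!: nn_integral_cmult)
  also have "\<dots> = ennreal (gamma_kernel \<rho> (\<mu> + (1 - \<beta>)) t) + ennreal \<rho> * ennreal (gamma_cdf \<rho> (\<mu> + (1 - \<beta>)) t)"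
    using assms \<mu> by (simp add: nn_integral_gamma_kernel_convolution nn_integral_gamma_kernel_cdf)
  also have "\<dots> = ennreal (gamma_kernel \<rho> (\<mu> - \<beta> + 1) t + \<rho> * gamma_cdf \<rho> (\<mu> - \<beta> + 1) t)"
    using assms by (simp add: ennreal_mult' gamma_kernel_nonneg gamma_cdf_nonneg algebra_simps)
  also have "\<dots> = ennreal (gamma_cdf \<rho> (\<mu> - \<beta>) t)"
    using assms by (subst gamma_kernel_Suc_eq) auto
  finally have sum: "I + ennreal (\<rho> powr \<beta> * gamma_cdf \<rho> \<mu> t) = ennreal (gamma_cdf \<rho> (\<mu> - \<beta>) t)" .
  have "I \<noteq> \<infinity>" using sum by (metis ennreal_neq_top ennreal_add_eq_top infinity_ennreal_def)
  then obtain i where i: "I = ennreal i" "i \<ge> 0" by (cases I) auto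
  have "i + \<rho> powr \<beta> * gamma_cdf \<rho> \<mu> t = gamma_cdf \<rho> (\<mu> - \<beta>) t"
    using sum i assms \<mu> by (simp add: ennreal_plus[symmetric] gamma_cdf_nonneg del: ennreal_plus)
  hence i_eq: "i = gamma_cdf \<rho> (\<mu> - \<beta>) t - \<rho> powr \<beta> * gamma_cdf \<rho> \<mu> t" by simp
  have "has_bochner_integral lborel (\<lambda>v. gamma_kernel \<rho> \<mu> v * K (t - v)) i"
    using i K_nonneg \<mu> unfolding I_def
    by (intro has_bochner_integral_nn_integral) (auto simp: gamma_kernel_nonneg)
  hence "has_bochner_integral lborel (\<lambda>s. gamma_kernel \<rho> \<mu> (t + (-1) * s) * K (t - (t + (-1) * s))) i"
    using lborel_has_bochner_integral_real_affine_iff[of "-1" "\<lambda>v. gamma_kernel \<rho> \<mu> v * K (t - v)" i t] by simp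
  also have "(\<lambda>s. gamma_kernel \<rho> \<mu> (t + (-1) * s) * K (t - (t + (-1) * s))) =
      (\<lambda>s. indicator {0<..<t} s * (levy_tail \<rho> \<beta> s * gamma_kernel \<rho> \<mu> (t - s)))"
    by (auto simp: K gamma_kernel_def fun_eq_iff split: split_indicator)
  finally show ?thesis by (simp add: i_eq)
qed

section \<open>Series of gamma distribution functions\<close>

definition gamma_series :: "real \<Rightarrow> real \<Rightarrow> (nat \<Rightarrow> 'b) \<Rightarrow> real \<Rightarrow> 'b::real_normed_vector" where
  "gamma_series \<rho> \<alpha> a t = (\<Sum>k. gamma_cdf \<rho> (\<alpha> * real k) t *\<^sub>R a k)"

text \<open>Gamma 0 is 0 by convention and so is the quotient. This is the right value, because it is the
derivative of the constant distribution function of shape 0.\<close>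

lemma gamma_kernel_0 [simp]: "gamma_kernel \<rho> 0 t = 0"
  by (simp add: gamma_kernel_def)

text \<open>The density of shape \<mu> is \<mu> / t times the density of shape \<mu> + 1 at t, which is at most the
distribution function of shape \<mu>.\<close>

lemma gamma_kernel_le_cdf:
  assumes "\<rho> > 0" "\<mu> \<ge> 0" "t > 0"
  shows "gamma_kernel \<rho> \<mu> t \<le> \<mu> / t * gamma_cdf \<rho> \<mu> t"
proof (cases "\<mu> = 0")
  case False
  hence \<mu>: "\<mu> > 0" using assms by simp
  have "\<mu> \<notin> \<int>\<^sub>\<le>\<^sub>0" using \<mu> by (auto elim!: nonpos_Ints_cases)
  hence G: "Gamma (\<mu> + 1) = \<mu> * Gamma \<mu>" by (rule Gamma_plus1)
  have "gamma_kernel \<rho> \<mu> t = \<mu> / t * gamma_kernel \<rho> (\<mu> + 1) t"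
    unfolding gamma_kernel_def G using assms \<mu> Gamma_real_pos[OF \<mu>]
    by (simp add: powr_diff field_simps)
  also have "\<dots> \<le> \<mu> / t * gamma_cdf \<rho> \<mu> t"
    using gamma_kernel_Suc_eq[OF assms] assms \<mu> gamma_cdf_nonneg[of "\<mu> + 1" \<rho> t]
    by (intro mult_left_mono) (auto simp flip: gamma_kernel_Suc_eq[OF assms])
  finally show ?thesis .
qed simp

lemma has_real_derivative_gamma_cdf:
  assumes "\<rho> > 0" "\<mu> \<ge> 0" "t > 0"
  shows "(gamma_cdf \<rho> \<mu> has_real_derivative gamma_kernel \<rho> \<mu> t) (at t)"
proof (cases "\<mu> = 0")
  case True
  thus ?thesis by (simp add: gamma_cdf_def[abs_def])
next
  case False
  hence \<mu>: "\<mu> > 0" using assms by simp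
  have int: "set_integrable lborel A (gamma_kernel \<rho> \<mu>)" if "A \<in> sets borel" for A
    unfolding set_integrable_def using that by (intro integrable_mult_indicator gamma_kernel_integrable assms \<mu>) simp
  have cont: "continuous_on {t/2..2*t} (gamma_kernel \<rho> \<mu>)"
  proof (rule continuous_on_eq)
    show "continuous_on {t/2..2*t} (\<lambda>r. exp (- \<rho> * r) * r powr (\<mu> - 1) / Gamma \<mu>)"
      using assms Gamma_real_pos[OF \<mu>] by (intro continuous_intros) auto
  qed (use assms in \<open>auto simp: gamma_kernel_def\<close>)
  have eq: "gamma_cdf \<rho> \<mu> x = gamma_cdf \<rho> \<mu> (t/2) + integral {t/2..x} (gamma_kernel \<rho> \<mu>)" if x: "x > t / 2" for x
  proof -
    have "gamma_cdf \<rho> \<mu> x = (LBINT r:{..<t/2} \<union> {t/2..<x}. gamma_kernel \<rho> \<mu> r)"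
      using False x by (simp add: gamma_cdf_def ivl_disj_un)
    also have "\<dots> = (LBINT r:{..<t/2}. gamma_kernel \<rho> \<mu> r) + (LBINT r:{t/2..<x}. gamma_kernel \<rho> \<mu> r)"
      by (intro set_integral_Un int) auto
    also have "(LBINT r:{t/2..<x}. gamma_kernel \<rho> \<mu> r) = (LBINT r:{t/2..x}. gamma_kernel \<rho> \<mu> r)"
    proof (rule set_integral_cong_set)
      show "AE r in lborel. (r \<in> {t/2..x}) = (r \<in> {t/2..<x})"
        using AE_lborel_singleton[of x] by eventually_elim auto
    qed (auto simp: set_borel_measurable_def)
    also have "\<dots> = integral {t/2..x} (gamma_kernel \<rho> \<mu>)"
      by (intro set_borel_integral_eq_integral int) auto
    finally show ?thesis using False by (simp add: gamma_cdf_def)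
  qed
  have "((\<lambda>x. integral {t/2..x} (gamma_kernel \<rho> \<mu>)) has_real_derivative gamma_kernel \<rho> \<mu> t) (at t within {t/2..2*t})"
    using assms by (intro integral_has_real_derivative cont) auto
  hence "((\<lambda>x. integral {t/2..x} (gamma_kernel \<rho> \<mu>)) has_real_derivative gamma_kernel \<rho> \<mu> t) (at t)"
    using assms by (subst (asm) at_within_interior) (auto simp: interior_atLeastAtMost_real)
  hence "((\<lambda>x. gamma_cdf \<rho> \<mu> (t/2) + integral {t/2..x} (gamma_kernel \<rho> \<mu>)) has_real_derivative gamma_kernel \<rho> \<mu> t) (at t)"
    by (auto intro!: derivative_eq_intros)
  thus ?thesis
    by (rule has_field_derivative_transform_within_open[where S="{t/2<..}"]) (use assms eq in auto)
qed

text \<open>Any geometric growth of the coefficients is dominated, with a ratio that is the same for all times.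
The ratio 1/4 leaves room for the factor k that differentiation brings in.\<close>

lemma gamma_cdf_geometric_bound:
  assumes "\<rho> > 0" "\<alpha> > 0" "C > 0"
  obtains \<sigma> where "\<sigma> \<ge> 0" "\<And>k t. t > 0 \<Longrightarrow> gamma_cdf \<rho> (\<alpha> * real k) t * C ^ k \<le> exp (\<sigma> * t) * (1/4) ^ k"
proof
  \<comment> \<open>This makes (\<sigma> + \<rho>)^\<alpha> at least 4 C, so that every further index gains a factor 1/4.\<close>
  define \<sigma> where "\<sigma> = (4 * C) powr (1 / \<alpha>)"
  show \<sigma>: "\<sigma> \<ge> 0" by (simp add: \<sigma>_def)
  fix k :: nat and t :: real assume t: "t > 0"
  have "4 * C = \<sigma> powr \<alpha>" using assms by (simp add: \<sigma>_def powr_powr)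
  also have "\<dots> \<le> (\<sigma> + \<rho>) powr \<alpha>" using assms \<sigma> by (intro powr_mono2) auto
  finally have "4 * C \<le> (\<sigma> + \<rho>) powr \<alpha>" .
  hence *: "(\<sigma> + \<rho>) powr (- \<alpha>) * C \<le> 1/4"
    using assms \<sigma> by (simp add: powr_minus field_simps)
  have "gamma_cdf \<rho> (\<alpha> * real k) t * C ^ k \<le> exp (\<sigma> * t) * (\<sigma> + \<rho>) powr (- (\<alpha> * real k)) * C ^ k"
    using assms \<sigma> t by (intro mult_right_mono gamma_cdf_le) auto
  also have "(\<sigma> + \<rho>) powr (- (\<alpha> * real k)) = ((\<sigma> + \<rho>) powr (- \<alpha>)) ^ k"
    using assms \<sigma> by (simp add: powr_powr flip: powr_realpow)
  also have "exp (\<sigma> * t) * ((\<sigma> + \<rho>) powr (- \<alpha>)) ^ k * C ^ k = exp (\<sigma> * t) * ((\<sigma> + \<rho>) powr (- \<alpha>) * C) ^ k"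
    by (simp add: power_mult_distrib)
  also have "\<dots> \<le> exp (\<sigma> * t) * (1/4) ^ k"
    using * assms by (intro mult_left_mono power_mono) auto
  finally show "gamma_cdf \<rho> (\<alpha> * real k) t * C ^ k \<le> exp (\<sigma> * t) * (1/4) ^ k" .
qed

lemma summable_gamma_cdf:
  assumes "\<rho> > 0" "\<alpha> > 0" "C > 0" "t > 0"
  shows "summable (\<lambda>k. gamma_cdf \<rho> (\<alpha> * real k) t * C ^ k)"
proof -
  obtain \<sigma> where \<sigma>: "\<And>k t. t > 0 \<Longrightarrow> gamma_cdf \<rho> (\<alpha> * real k) t * C ^ k \<le> exp (\<sigma> * t) * (1/4) ^ k"
    using gamma_cdf_geometric_bound[OF assms(1-3)] by blast
  have "summable (\<lambda>k. exp (\<sigma> * t) * (1/4::real) ^ k)" by (intro summable_mult summable_geometric) auto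
  thus ?thesis
    by (rule summable_comparison_test') (use assms \<sigma>[of t] in \<open>auto simp: gamma_cdf_nonneg abs_mult\<close>)
qed

lemma summable_gamma_series:
  fixes a :: "nat \<Rightarrow> 'b::banach"
  assumes "\<rho> > 0" "\<alpha> > 0" "C > 0" "\<And>k. norm (a k) \<le> C ^ k" "t > 0"
  shows "summable (\<lambda>k. norm (gamma_cdf \<rho> (\<alpha> * real k) t *\<^sub>R a k))"
    and "summable (\<lambda>k. gamma_cdf \<rho> (\<alpha> * real k) t *\<^sub>R a k)"
proof -
  show "summable (\<lambda>k. norm (gamma_cdf \<rho> (\<alpha> * real k) t *\<^sub>R a k))"
    by (rule summable_comparison_test'[OF summable_gamma_cdf[OF assms(1-3,5)], of 0])
       (use assms in \<open>auto simp: gamma_cdf_nonneg mult_left_mono\<close>)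
  thus "summable (\<lambda>k. gamma_cdf \<rho> (\<alpha> * real k) t *\<^sub>R a k)" by (rule summable_norm_cancel)
qed

text \<open>Uniformity in t on compact subsets of the open half line is what termwise differentiation requires;
the factor 1 / t explains why the left end has to stay away from 0.\<close>

lemma gamma_kernel_geometric_bound:
  assumes "\<rho> > 0" "\<alpha> > 0" "C > 0" "0 < t1"
  obtains B where "\<And>k t. t1 \<le> t \<Longrightarrow> t \<le> t2 \<Longrightarrow> gamma_kernel \<rho> (\<alpha> * real k) t * C ^ k \<le> B * (1/2) ^ k"
proof -
  obtain \<sigma> where \<sigma>: "\<sigma> \<ge> 0" "\<And>k t. t > 0 \<Longrightarrow> gamma_cdf \<rho> (\<alpha> * real k) t * C ^ k \<le> exp (\<sigma> * t) * (1/4) ^ k"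
    using gamma_cdf_geometric_bound[OF assms(1-3)] by blast
  show ?thesis
  proof (rule that[of "\<alpha> / t1 * exp (\<sigma> * t2)"])
    fix k t assume t: "t1 \<le> t" "t \<le> t2"
    have "gamma_kernel \<rho> (\<alpha> * real k) t * C ^ k \<le> (\<alpha> * real k / t * gamma_cdf \<rho> (\<alpha> * real k) t) * C ^ k"
      using assms t by (intro mult_right_mono gamma_kernel_le_cdf) auto
    also have "\<dots> = \<alpha> / t * real k * (gamma_cdf \<rho> (\<alpha> * real k) t * C ^ k)" by simp
    also have "\<dots> \<le> \<alpha> / t1 * 2 ^ k * (exp (\<sigma> * t2) * (1/4) ^ k)"
    proof (rule mult_mono[OF mult_mono])
      show "\<alpha> / t \<le> \<alpha> / t1" using assms t by (intro divide_left_mono) auto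
      show "real k \<le> 2 ^ k" using of_nat_less_two_power[of k] by (simp add: less_imp_le)
      have "gamma_cdf \<rho> (\<alpha> * real k) t * C ^ k \<le> exp (\<sigma> * t) * (1/4) ^ k" using assms t by (intro \<sigma>) auto
      also have "\<dots> \<le> exp (\<sigma> * t2) * (1/4) ^ k"
        using \<sigma>(1) t by (intro mult_right_mono) (auto intro: mult_left_mono)
      finally show "gamma_cdf \<rho> (\<alpha> * real k) t * C ^ k \<le> exp (\<sigma> * t2) * (1/4) ^ k" .
    qed (use assms t in \<open>auto simp: gamma_cdf_nonneg\<close>)
    also have "\<dots> = \<alpha> / t1 * exp (\<sigma> * t2) * (2 * (1/4)) ^ k" by (simp only: power_mult_distrib mult_ac)
    finally show "gamma_kernel \<rho> (\<alpha> * real k) t * C ^ k \<le> \<alpha> / t1 * exp (\<sigma> * t2) * (1/2) ^ k" by simp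
  qed
qed

lemma gamma_kernel_nonneg': "\<mu> \<ge> 0 \<Longrightarrow> 0 \<le> gamma_kernel \<rho> \<mu> r"
  using gamma_kernel_nonneg[of \<mu>] by (cases "\<mu> = 0") auto

lemma summable_gamma_kernel:
  fixes a :: "nat \<Rightarrow> 'b::banach"
  assumes "\<rho> > 0" "\<alpha> > 0" "C > 0" "\<And>k. norm (a k) \<le> C ^ k"
  shows "summable (\<lambda>k. norm (gamma_kernel \<rho> (\<alpha> * real k) t *\<^sub>R a k))"
proof (cases "t > 0")
  case True
  obtain B where B: "\<And>k s. t \<le> s \<Longrightarrow> s \<le> t \<Longrightarrow> gamma_kernel \<rho> (\<alpha> * real k) s * C ^ k \<le> B * (1/2) ^ k"
    using gamma_kernel_geometric_bound[OF assms(1-3) True] by blast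
  have "summable (\<lambda>k. B * (1/2::real) ^ k)" by (intro summable_mult summable_geometric) auto
  thus ?thesis
  proof (rule summable_comparison_test'[of _ 0])
    fix k :: nat
    have "norm (gamma_kernel \<rho> (\<alpha> * real k) t *\<^sub>R a k) \<le> gamma_kernel \<rho> (\<alpha> * real k) t * C ^ k"
      using assms by (auto simp: gamma_kernel_nonneg' intro!: mult_left_mono)
    also have "\<dots> \<le> B * (1/2) ^ k" by (intro B) auto
    finally show "norm (norm (gamma_kernel \<rho> (\<alpha> * real k) t *\<^sub>R a k)) \<le> B * (1/2) ^ k" by simp
  qed
qed (simp add: gamma_kernel_def)

lemma has_vector_derivative_gamma_series:
  fixes a :: "nat \<Rightarrow> 'b::banach"
  assumes "\<rho> > 0" "\<alpha> > 0" "C > 0" and a: "\<And>k. norm (a k) \<le> C ^ k" and t: "t > 0"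
  shows "(gamma_series \<rho> \<alpha> a has_vector_derivative (\<Sum>k. gamma_kernel \<rho> (\<alpha> * real k) t *\<^sub>R a k)) (at t)"
proof -
  define S where "S = {t/2<..<2*t}"
  define P where "P x = (\<Sum>k. gamma_kernel \<rho> (\<alpha> * real k) x *\<^sub>R a k)" for x
  obtain B where B: "\<And>k s. t/2 \<le> s \<Longrightarrow> s \<le> 2*t \<Longrightarrow> gamma_kernel \<rho> (\<alpha> * real k) s * C ^ k \<le> B * (1/2) ^ k"
    using gamma_kernel_geometric_bound[OF assms(1-3), of "t/2"] t by (metis half_gt_zero)
  have ul: "uniform_limit S (\<lambda>n x. \<Sum>i<n. gamma_kernel \<rho> (\<alpha> * real i) x *\<^sub>R a i) P sequentially"
    unfolding P_def
  proof (rule Weierstrass_m_test)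
    show "summable (\<lambda>k. B * (1/2::real) ^ k)" by (intro summable_mult summable_geometric) auto
    fix k x assume "x \<in> S"
    have "norm (gamma_kernel \<rho> (\<alpha> * real k) x *\<^sub>R a k) \<le> gamma_kernel \<rho> (\<alpha> * real k) x * C ^ k"
      using assms by (auto simp: gamma_kernel_nonneg' intro!: mult_left_mono)
    also have "\<dots> \<le> B * (1/2) ^ k" using \<open>x \<in> S\<close> by (intro B) (auto simp: S_def)
    finally show "norm (gamma_kernel \<rho> (\<alpha> * real k) x *\<^sub>R a k) \<le> B * (1/2) ^ k" .
  qed
  have "\<exists>g. \<forall>x\<in>S. (\<lambda>k. gamma_cdf \<rho> (\<alpha> * real k) x *\<^sub>R a k) sums g x \<and> (g has_derivative (\<lambda>h. h *\<^sub>R P x)) (at x within S)"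
  proof (rule has_derivative_series)
    show "convex S" by (simp add: S_def)
    show "((\<lambda>x. gamma_cdf \<rho> (\<alpha> * real k) x *\<^sub>R a k) has_derivative (\<lambda>h. h *\<^sub>R (gamma_kernel \<rho> (\<alpha> * real k) x *\<^sub>R a k))) (at x within S)"
      if "x \<in> S" for k x
    proof -
      have "(gamma_cdf \<rho> (\<alpha> * real k) has_real_derivative gamma_kernel \<rho> (\<alpha> * real k) x) (at x)"
        using that t assms by (intro has_real_derivative_gamma_cdf) (auto simp: S_def)
      hence "(gamma_cdf \<rho> (\<alpha> * real k) has_vector_derivative gamma_kernel \<rho> (\<alpha> * real k) x) (at x within S)"
        by (simp add: has_real_derivative_iff_has_vector_derivative has_vector_derivative_at_within)
      from bounded_linear.has_vector_derivative[OF bounded_linear_scaleR_left this, of "a k"]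
      show ?thesis by (simp add: has_vector_derivative_def)
    qed
    show "\<forall>\<^sub>F n in sequentially. \<forall>x\<in>S. \<forall>h. norm ((\<Sum>i<n. h *\<^sub>R (gamma_kernel \<rho> (\<alpha> * real i) x *\<^sub>R a i)) - h *\<^sub>R P x) \<le> e * norm h"
      if e: "e > 0" for e
      using uniform_limitD[OF ul e]
    proof eventually_elim
      case (elim n)
      show ?case
      proof (intro ballI allI)
        fix x h assume "x \<in> S"
        have "norm ((\<Sum>i<n. h *\<^sub>R (gamma_kernel \<rho> (\<alpha> * real i) x *\<^sub>R a i)) - h *\<^sub>R P x) =
           norm h * norm ((\<Sum>i<n. gamma_kernel \<rho> (\<alpha> * real i) x *\<^sub>R a i) - P x)"
          unfolding scaleR_sum_right[symmetric] scaleR_diff_right[symmetric] by simp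
        also have "\<dots> \<le> norm h * e"
          using elim \<open>x \<in> S\<close> by (intro mult_left_mono) (auto simp: dist_norm less_imp_le)
        finally show "norm ((\<Sum>i<n. h *\<^sub>R (gamma_kernel \<rho> (\<alpha> * real i) x *\<^sub>R a i)) - h *\<^sub>R P x) \<le> e * norm h"
          by (simp add: mult.commute)
      qed
    qed
    show "t \<in> S" using t by (simp add: S_def)
    show "(\<lambda>k. gamma_cdf \<rho> (\<alpha> * real k) t *\<^sub>R a k) sums gamma_series \<rho> \<alpha> a t"
      unfolding gamma_series_def by (intro summable_sums summable_gamma_series(2)[where C=C] assms)
  qed
  then obtain g where g: "\<And>x. x \<in> S \<Longrightarrow> (\<lambda>k. gamma_cdf \<rho> (\<alpha> * real k) x *\<^sub>R a k) sums g x"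
     "\<And>x. x \<in> S \<Longrightarrow> (g has_derivative (\<lambda>h. h *\<^sub>R P x)) (at x within S)" by blast
  have "open S" "t \<in> S" using t by (auto simp: S_def)
  have "(g has_vector_derivative P t) (at t)"
    using g(2)[OF \<open>t \<in> S\<close>] at_within_open[OF \<open>t \<in> S\<close> \<open>open S\<close>] by (simp add: has_vector_derivative_def)
  thus ?thesis unfolding P_def[symmetric]
    by (rule has_vector_derivative_transform_within_open[OF _ \<open>open S\<close> \<open>t \<in> S\<close>])
       (use g(1) in \<open>simp add: gamma_series_def sums_iff\<close>)
qed

lemma sums_gamma_series_cmult:
  fixes a :: "nat \<Rightarrow> 'b::{real_normed_field, banach}"
  assumes "\<rho> > 0" "\<alpha> > 0" "C > 0" "\<And>k. norm (a k) \<le> C ^ k" "t > 0"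
  shows "(\<lambda>k. gamma_cdf \<rho> (\<alpha> * real k) t *\<^sub>R (r * a k)) sums (r * gamma_series \<rho> \<alpha> a t)"
  using sums_mult[OF summable_sums[OF summable_gamma_series(2)[OF assms]], of r]
  by (simp add: gamma_series_def)

section \<open>Caputo-Djrbashian derivatives of gamma series\<close>

text \<open>Since the coefficients with index strictly between 0 and j vanish, no term of
negative shape remains; reindexing the first half of the difference by j gives a series of
the same kind.\<close>

lemma sums_gamma_series_shift:
  fixes a :: "nat \<Rightarrow> 'b::banach"
  assumes "\<rho> > 0" "\<alpha> > 0" "C > 0" and a: "\<And>k. norm (a k) \<le> C ^ k" and t: "t > 0"
    and a0: "\<And>i. 0 < i \<Longrightarrow> i < j \<Longrightarrow> a i = 0" and j: "j > 0"
  shows "(\<lambda>k. if k < j then 0 else (gamma_cdf \<rho> (\<alpha> * real k - \<alpha> * real j) t - r * gamma_cdf \<rho> (\<alpha> * real k) t) *\<^sub>R a k)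
     sums gamma_series \<rho> \<alpha> (\<lambda>k. a (k + j) - (if k = 0 then 0 else r *\<^sub>R a k)) t" (is ?sums)
    and "summable (\<lambda>k. gamma_cdf \<rho> (\<alpha> * real k) t *\<^sub>R (a (k + j) - (if k = 0 then 0 else r *\<^sub>R a k)))"
      (is ?summable)
proof -
  define W where "W k = gamma_cdf \<rho> (\<alpha> * real k) t" for k
  have sW: "summable (\<lambda>k. W k * C ^ k)"
    unfolding W_def using assms by (intro summable_gamma_cdf) auto
  have Wn: "0 \<le> W k" for k unfolding W_def using assms by (intro gamma_cdf_nonneg) auto
  have s1: "summable (\<lambda>k. W k *\<^sub>R a (k + j))"
  proof (rule summable_norm_cancel, rule summable_comparison_test'[of _ 0])
    show "summable (\<lambda>k. C ^ j * (W k * C ^ k))" by (intro summable_mult sW)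
    show "norm (norm (W k *\<^sub>R a (k + j))) \<le> C ^ j * (W k * C ^ k)" for k
      using mult_left_mono[OF a[of "k + j"] Wn[of k]] Wn by (simp add: power_add mult_ac)
  qed
  have s2: "summable (\<lambda>k. W k *\<^sub>R (if k = 0 then 0 else r *\<^sub>R a k))"
  proof (rule summable_norm_cancel, rule summable_comparison_test'[of _ 0])
    show "summable (\<lambda>k. \<bar>r\<bar> * (W k * C ^ k))" by (intro summable_mult sW)
    show "norm (norm (W k *\<^sub>R (if k = 0 then 0 else r *\<^sub>R a k))) \<le> \<bar>r\<bar> * (W k * C ^ k)" for k
      using mult_left_mono[OF a[of k], of "\<bar>r\<bar> * W k"] Wn[of k] assms by (auto simp: mult_ac)
  qed
  have 1: "(\<lambda>k. if k < j then 0 else gamma_cdf \<rho> (\<alpha> * real k - \<alpha> * real j) t *\<^sub>R a k) sums (\<Sum>k. W k *\<^sub>R a (k + j))"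
    using summable_sums[OF s1]
    by (subst sums_zero_iff_shift[of j, symmetric]) (auto simp: W_def algebra_simps)
  have 2: "(\<lambda>k. W k *\<^sub>R (if k = 0 then 0 else r *\<^sub>R a k)) sums (\<Sum>k. W k *\<^sub>R (if k = 0 then 0 else r *\<^sub>R a k))"
    by (rule summable_sums[OF s2])
  have "(\<Sum>k. W k *\<^sub>R a (k + j)) - (\<Sum>k. W k *\<^sub>R (if k = 0 then 0 else r *\<^sub>R a k)) =
     gamma_series \<rho> \<alpha> (\<lambda>k. a (k + j) - (if k = 0 then 0 else r *\<^sub>R a k)) t"
    unfolding gamma_series_def W_def[symmetric] using suminf_diff[OF s1 s2] by (simp add: scaleR_diff_right)
  moreover have "(\<lambda>k. (if k < j then 0 else gamma_cdf \<rho> (\<alpha> * real k - \<alpha> * real j) t *\<^sub>R a k) - W k *\<^sub>R (if k = 0 then 0 else r *\<^sub>R a k))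
    = (\<lambda>k. if k < j then 0 else (gamma_cdf \<rho> (\<alpha> * real k - \<alpha> * real j) t - r * gamma_cdf \<rho> (\<alpha> * real k) t) *\<^sub>R a k)"
    using a0 j by (auto simp: fun_eq_iff W_def scaleR_diff_left mult_ac)
  ultimately show ?sums using sums_diff[OF 1 2] by simp
  show ?summable
    using summable_diff[OF s1 s2] by (simp only: W_def scaleR_diff_right)
qed

text \<open>The derivative of order j \<alpha> of a gamma series is again a gamma series, with shifted
coefficients. Without the vanishing of a_i for 0 < i < j negative shapes would appear. The function
u is prescribed on the positive half line only, because the derivative at t sees no other values.\<close>

lemma caputo_gamma_series:
  fixes a :: "nat \<Rightarrow> 'b::{banach, second_countable_topology}"
  assumes "\<rho> > 0" "\<alpha> > 0" "C > 0" and a: "\<And>k. norm (a k) \<le> C ^ k" and t: "t > 0"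
    and u: "\<And>x. x > 0 \<Longrightarrow> u x = gamma_series \<rho> \<alpha> a x"
    and a0: "\<And>i. 0 < i \<Longrightarrow> i < j \<Longrightarrow> a i = 0" and j: "j > 0" and \<beta>: "\<beta> = \<alpha> * real j" "\<beta> \<le> 1"
  shows "caputo_differentiable \<beta> \<rho> u t" (is ?diff)
    and "caputo_derivative \<beta> \<rho> u t =
           gamma_series \<rho> \<alpha> (\<lambda>k. a (k + j) - (if k = 0 then 0 else \<rho> powr \<beta> *\<^sub>R a k)) t" (is ?eq)
proof -
  define v where "v k = (if k < j then 0 else (gamma_cdf \<rho> (\<alpha> * real k - \<beta>) t - \<rho> powr \<beta> * gamma_cdf \<rho> (\<alpha> * real k) t) *\<^sub>R a k)" for k
  have v: "v sums gamma_series \<rho> \<alpha> (\<lambda>k. a (k + j) - (if k = 0 then 0 else \<rho> powr \<beta> *\<^sub>R a k)) t"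
    unfolding v_def \<beta>(1) by (rule sums_gamma_series_shift(1)[OF assms(1-3) a t a0 j])
  define P where "P x = (\<Sum>k. gamma_kernel \<rho> (\<alpha> * real k) x *\<^sub>R a k)" for x
  have deriv: "(u has_vector_derivative P x) (at x)" if "x > 0" for x
    using has_vector_derivative_gamma_series[OF assms(1-3) a that] unfolding P_def
    by (rule has_vector_derivative_transform_within_open[of _ _ _ "{0<..}"]) (use that u in auto)
  have \<beta>0: "\<beta> > 0" using \<beta> assms by simp
  have low: "gamma_kernel \<rho> (\<alpha> * real k) x *\<^sub>R a k = 0" if "k < j" for k x
    using that a0[of k] by (cases "k = 0") auto
  have \<beta>k: "\<beta> \<le> \<alpha> * real k" if "\<not> k < j" for k
    using that \<beta> assms by (simp add: mult_left_mono)
  have "?diff \<and> ?eq"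
  proof (cases "\<beta> = 1")
    case True
    \<comment> \<open>For order 1 the derivative is the series of densities, and the density of shape
      \<mu> is itself the distribution function of shape \<mu> - 1 minus \<rho> times that of shape \<mu>.\<close>
    have "gamma_kernel \<rho> (\<alpha> * real k) t *\<^sub>R a k = v k" for k
    proof (cases "k < j")
      case False
      have "gamma_kernel \<rho> (\<alpha> * real k) t = gamma_cdf \<rho> (\<alpha> * real k - 1) t - \<rho> * gamma_cdf \<rho> (\<alpha> * real k) t"
        using gamma_kernel_Suc_eq[OF assms(1) _ t, of "\<alpha> * real k - 1"] \<beta>k[OF False] True by simp
      thus ?thesis using False True assms by (simp add: v_def)
    qed (use low in \<open>simp add: v_def\<close>)
    hence "P t = gamma_series \<rho> \<alpha> (\<lambda>k. a (k + j) - (if k = 0 then 0 else \<rho> powr \<beta> *\<^sub>R a k)) t"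
      using v unfolding P_def by (simp add: sums_iff)
    thus ?thesis using deriv[OF t] True
      by (auto simp: caputo_differentiable_def caputo_derivative_def vector_derivative_at
          intro: differentiableI_vector)
  next
    case False
    hence \<beta>1: "\<beta> < 1" using \<beta> by simp
    define c where "c = \<beta> * \<rho> powr \<beta> / Gamma (1 - \<beta>)"
    have c: "c > 0" using \<beta>1 \<beta>0 assms Gamma_real_pos[of "1 - \<beta>"] by (simp add: c_def)
    have shift: "((\<lambda>\<tau>. u (\<tau> - s)) has_vector_derivative P (t - s)) (at t)" if "s < t" for s
    proof -
      have "((u \<circ> (\<lambda>\<tau>. \<tau> - s)) has_vector_derivative 1 *\<^sub>R P (t - s)) (at t)"
        by (intro vector_diff_chain_at) (use that deriv in \<open>auto intro!: derivative_eq_intros\<close>)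
      thus ?thesis by (simp add: o_def)
    qed
    \<comment> \<open>The k-th term of the integrand; the kernel is nonnegative, so its integral and the
      integral of its norm come from the same formula.\<close>
    define f where "f k s = (indicator {0<..<t} s * (levy_tail \<rho> \<beta> s * gamma_kernel \<rho> (\<alpha> * real k) (t - s))) *\<^sub>R a k" for k s
    have hb: "has_bochner_integral lborel (f k) (v k)" for k
    proof (cases "k < j")
      case True
      hence "f k = (\<lambda>_. 0)" using a0[of k] by (cases "k = 0") (auto simp: f_def)
      thus ?thesis using True by (simp add: v_def has_bochner_integral_zero)
    next
      case False
      show ?thesis unfolding f_def v_def using False
        by (simp del: scaleR_scaleR, intro has_bochner_integral_scaleR_left
             has_bochner_integral_levy_tail_gamma_kernel assms \<beta>0 \<beta>1 \<beta>k)
    qed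
    have hb_norm: "has_bochner_integral lborel (\<lambda>s. norm (f k s))
        (if k < j then 0 else (gamma_cdf \<rho> (\<alpha> * real k - \<alpha> * real j) t - \<rho> powr \<beta> * gamma_cdf \<rho> (\<alpha> * real k) t) *\<^sub>R norm (a k))" for k
    proof (cases "k < j")
      case True
      hence "f k = (\<lambda>_. 0)" using a0[of k] by (cases "k = 0") (auto simp: f_def)
      thus ?thesis using True by (simp add: has_bochner_integral_zero)
    next
      case False
      have "norm (f k s) = (indicator {0<..<t} s * (levy_tail \<rho> \<beta> s * gamma_kernel \<rho> (\<alpha> * real k) (t - s))) *\<^sub>R norm (a k)" for s
        using \<beta>0 \<beta>1 assms by (simp add: f_def levy_tail_nonneg gamma_kernel_nonneg' abs_mult)
      moreover have "has_bochner_integral lborel (\<lambda>s. (indicator {0<..<t} s * (levy_tail \<rho> \<beta> s * gamma_kernel \<rho> (\<alpha> * real k) (t - s))) *\<^sub>R norm (a k))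
          ((gamma_cdf \<rho> (\<alpha> * real k - \<alpha> * real j) t - \<rho> powr \<beta> * gamma_cdf \<rho> (\<alpha> * real k) t) *\<^sub>R norm (a k))"
        using has_bochner_integral_levy_tail_gamma_kernel[OF assms(1) \<beta>0 \<beta>1 \<beta>k[OF False] t] \<beta>(1)
        by (intro has_bochner_integral_scaleR_left) auto
      ultimately show ?thesis using False by simp
    qed
    have sumk: "summable (\<lambda>k. norm (gamma_kernel \<rho> (\<alpha> * real k) x *\<^sub>R a k))" for x
      by (rule summable_gamma_kernel[OF assms(1-3) a])
    have f_eq: "f k s = (indicator {0<..<t} s * levy_tail \<rho> \<beta> s) *\<^sub>R (gamma_kernel \<rho> (\<alpha> * real k) (t - s) *\<^sub>R a k)" for k s
      by (simp add: f_def mult_ac)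
    have int: "integrable lborel (f k)" for k using hb by (rule integrable.intros)
    have sum_norm: "summable (\<lambda>k. \<integral>s. norm (f k s) \<partial>lborel)"
    proof -
      have "summable (\<lambda>k. if k < j then 0 else (gamma_cdf \<rho> (\<alpha> * real k - \<alpha> * real j) t - \<rho> powr \<beta> * gamma_cdf \<rho> (\<alpha> * real k) t) *\<^sub>R norm (a k))"
        using assms by (intro sums_summable[OF sums_gamma_series_shift(1)[where C=C]]) auto
      thus ?thesis using hb_norm by (simp add: has_bochner_integral_iff)
    qed
    have ae: "AE s in lborel. summable (\<lambda>k. norm (f k s))"
      unfolding f_eq norm_scaleR[of "indicator A s * b" for A s b] by (intro AE_I2 summable_mult sumk)
    have sum_f: "(\<Sum>k. f k s) = (indicator {0<..<t} s * levy_tail \<rho> \<beta> s) *\<^sub>R P (t - s)" for s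
      unfolding f_eq P_def by (rule suminf_scaleR_right[symmetric, OF summable_norm_cancel[OF sumk]])
    have I1: "integrable lborel (\<lambda>s. (indicator {0<..<t} s * levy_tail \<rho> \<beta> s) *\<^sub>R P (t - s))"
      using integrable_suminf[OF int ae sum_norm] unfolding sum_f .
    have I2: "(\<integral>s. (indicator {0<..<t} s * levy_tail \<rho> \<beta> s) *\<^sub>R P (t - s) \<partial>lborel) =
        gamma_series \<rho> \<alpha> (\<lambda>k. a (k + j) - (if k = 0 then 0 else \<rho> powr \<beta> *\<^sub>R a k)) t"
      using sums_integral[OF int ae sum_norm] v hb unfolding sum_f
      by (simp add: has_bochner_integral_iff sums_iff)
    have ci: "indicator {0<..<t} s *\<^sub>R caputo_integrand \<beta> \<rho> u t s =
        (1 / c) *\<^sub>R ((indicator {0<..<t} s * levy_tail \<rho> \<beta> s) *\<^sub>R P (t - s))" for s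
    proof (cases "s \<in> {0<..<t}")
      case True
      thus ?thesis using c shift[of s]
        by (simp add: caputo_integrand_def levy_tail_def c_def[symmetric] vector_derivative_at)
    qed simp
    have "set_integrable lborel {0<..<t} (caputo_integrand \<beta> \<rho> u t)"
      unfolding set_integrable_def ci by (intro integrable_scaleR_right I1)
    moreover have "(\<lambda>\<tau>. u (\<tau> - s)) differentiable (at t)" if "s < t" for s
      using shift[OF that] by (rule differentiableI_vector)
    ultimately have ?diff unfolding caputo_differentiable_def using False by auto
    moreover have ?eq unfolding caputo_derivative_def c_def[symmetric] set_lebesgue_integral_def ci
      using c False by (simp add: I2 del: scaleR_scaleR) simp
    ultimately show ?thesis ..
  qed
  thus ?diff ?eq by auto
qed

lemma caputo_sum_gamma_series:
  fixes a :: "nat \<Rightarrow> 'b::{banach, second_countable_topology}"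
  assumes "\<rho> > 0" "\<alpha> > 0" "\<alpha> \<le> 1/2" "C > 0" and a: "\<And>k. norm (a k) \<le> C ^ k" and t: "t > 0"
    and u: "\<And>x. x > 0 \<Longrightarrow> u x = gamma_series \<rho> \<alpha> a x" and a1: "a 1 = 0"
  shows "caputo_differentiable (2 * \<alpha>) \<rho> u t" "caputo_differentiable \<alpha> \<rho> u t"
    and "caputo_derivative (2 * \<alpha>) \<rho> u t + caputo_derivative \<alpha> \<rho> u t =
           gamma_series \<rho> \<alpha> (\<lambda>k. a (k + 2) + a (k + 1) - (if k = 0 then 0 else (\<rho> powr (2 * \<alpha>) + \<rho> powr \<alpha>) *\<^sub>R a k)) t"
proof -
  have a2: "a i = 0" if "0 < i" "i < 2" for i using that a1 by (cases "i = 1") auto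
  note c2 = caputo_gamma_series[OF assms(1,2,4) a t u a2, where j = 2 and \<beta> = "2 * \<alpha>"]
  note c1 = caputo_gamma_series[OF assms(1,2,4) a t u, where j = 1 and \<beta> = \<alpha>]
  note s2 = sums_gamma_series_shift(2)[OF assms(1,2,4) a t a2, where j = 2 and r = "\<rho> powr (2 * \<alpha>)"]
  note s1 = sums_gamma_series_shift(2)[OF assms(1,2,4) a t, where j = 1 and r = "\<rho> powr \<alpha>"]
  show "caputo_differentiable (2 * \<alpha>) \<rho> u t" using assms by (intro c2) auto
  show "caputo_differentiable \<alpha> \<rho> u t" using assms by (intro c1) auto
  have "caputo_derivative (2 * \<alpha>) \<rho> u t + caputo_derivative \<alpha> \<rho> u t =
     gamma_series \<rho> \<alpha> (\<lambda>k. a (k + 2) - (if k = 0 then 0 else \<rho> powr (2 * \<alpha>) *\<^sub>R a k)) t +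
     gamma_series \<rho> \<alpha> (\<lambda>k. a (k + 1) - (if k = 0 then 0 else \<rho> powr \<alpha> *\<^sub>R a k)) t"
    using assms by (intro arg_cong2[where f="(+)"] c2 c1) auto
  also have "\<dots> = gamma_series \<rho> \<alpha> (\<lambda>k. a (k + 2) + a (k + 1) - (if k = 0 then 0 else (\<rho> powr (2 * \<alpha>) + \<rho> powr \<alpha>) *\<^sub>R a k)) t"
    unfolding gamma_series_def
    by (subst suminf_add, rule s2, (simp_all)[3], rule s1, (simp_all)[2])
       (auto intro!: suminf_cong simp: scaleR_add_right[symmetric] scaleR_add_left)
  finally show "caputo_derivative (2 * \<alpha>) \<rho> u t + caputo_derivative \<alpha> \<rho> u t = \<dots>" .
qed

section \<open>Laplace transforms: computation and uniqueness\<close>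

text \<open>After the substitution x = exp (- t) the hypothesis says that all moments of a signed measure on the
unit interval vanish; by Weierstrass' theorem it annihilates every continuous function.\<close>

lemma integral_continuous_comp_exp_eq_0:
  fixes h :: "real \<Rightarrow> real"
  assumes h: "integrable lborel h" "\<And>t. t \<le> 0 \<Longrightarrow> h t = 0"
    and mom: "\<And>n::nat. (\<integral>t. h t * exp (- real n * t) \<partial>lborel) = 0"
    and \<phi>: "continuous_on UNIV \<phi>"
  shows "(\<integral>t. h t * \<phi> (exp (- t)) \<partial>lborel) = 0"
proof -
  have [measurable]: "\<phi> \<in> borel_measurable borel" using \<phi> by (rule borel_measurable_continuous_onI)
  have [measurable]: "h \<in> borel_measurable borel" using h(1) by auto
  have le: "exp (- t) \<in> {0..1}" if "h t \<noteq> 0" for t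
    using h(2)[of t] that by force
  have int: "integrable lborel (\<lambda>t. h t * g (exp (- t)))" if "continuous_on UNIV g" for g :: "real \<Rightarrow> real"
  proof -
    have [measurable]: "g \<in> borel_measurable borel" using that by (rule borel_measurable_continuous_onI)
    have "bounded (g ` {0..1})"
      using compact_continuous_image[OF continuous_on_subset[OF that]] by (intro compact_imp_bounded) auto
    then have "\<exists>B. \<forall>x\<in>{0..1}. \<bar>g x\<bar> \<le> B" unfolding bounded_iff by auto
    then obtain B where B: "\<And>x. x \<in> {0..1} \<Longrightarrow> \<bar>g x\<bar> \<le> B" by blast
    show ?thesis
    proof (rule Bochner_Integration.integrable_bound)
      show "integrable lborel (\<lambda>t. B * h t)" using h by simp
      show "AE t in lborel. norm (h t * g (exp (- t))) \<le> norm (B * h t)"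
      proof (rule AE_I2)
        fix t show "norm (h t * g (exp (- t))) \<le> norm (B * h t)"
        proof (cases "h t = 0")
          case False
          have "\<bar>g (exp (- t))\<bar> \<le> \<bar>B\<bar>" using B[OF le[OF False]] by simp
          thus ?thesis by (simp add: abs_mult mult.commute[of "\<bar>B\<bar>"] mult_left_mono)
        qed simp
      qed
    qed measurable
  qed
  define I where "I = (\<integral>t. \<bar>h t\<bar> \<partial>lborel)"
  have I: "I \<ge> 0" by (simp add: I_def)
  have bound: "\<bar>\<integral>t. h t * \<phi> (exp (- t)) \<partial>lborel\<bar> \<le> e * I" if e: "e > 0" for e
  proof -
    obtain p where p: "real_polynomial_function p" "\<And>x. x \<in> {0..1} \<Longrightarrow> \<bar>\<phi> x - p x\<bar> < e"
      using Stone_Weierstrass_real_polynomial_function[of "{0..1::real}" \<phi> e] e continuous_on_subset[OF \<phi>] by auto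
    then obtain a n where pa: "p = (\<lambda>x. \<Sum>i\<le>n. a i * x ^ i)"
      unfolding real_polynomial_function_iff_sum by auto
    have "(\<integral>t. h t * p (exp (- t)) \<partial>lborel) = (\<integral>t. (\<Sum>i\<le>n. a i * (h t * exp (- real i * t))) \<partial>lborel)"
      unfolding pa by (simp add: sum_distrib_left exp_of_nat_mult[symmetric] mult_ac)
    also have "\<dots> = (\<Sum>i\<le>n. a i * (\<integral>t. h t * exp (- real i * t) \<partial>lborel))"
    proof (subst Bochner_Integration.integral_sum)
      fix i
      have "continuous_on UNIV (\<lambda>x::real. x ^ i)" by (intro continuous_intros)
      from int[OF this] show "integrable lborel (\<lambda>t. a i * (h t * exp (- real i * t)))"
        by (simp add: exp_of_nat_mult[symmetric] mult_ac)
    qed simp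
    also have "\<dots> = 0" using mom by simp
    finally have p0: "(\<integral>t. h t * p (exp (- t)) \<partial>lborel) = 0" .
    have cp: "continuous_on UNIV p" unfolding pa by (intro continuous_intros)
    have "(\<integral>t. h t * \<phi> (exp (- t)) \<partial>lborel) = (\<integral>t. h t * \<phi> (exp (- t)) \<partial>lborel) - (\<integral>t. h t * p (exp (- t)) \<partial>lborel)"
      using p0 by simp
    also have "\<dots> = (\<integral>t. h t * (\<phi> (exp (- t)) - p (exp (- t))) \<partial>lborel)"
      by (subst Bochner_Integration.integral_diff[symmetric]) (auto intro: int \<phi> cp simp: right_diff_distrib)
    finally have "\<bar>\<integral>t. h t * \<phi> (exp (- t)) \<partial>lborel\<bar> \<le> (\<integral>t. norm (h t * (\<phi> (exp (- t)) - p (exp (- t)))) \<partial>lborel)"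
      using integral_norm_bound[of lborel "\<lambda>t. h t * (\<phi> (exp (- t)) - p (exp (- t)))"] by simp
    also have "\<dots> \<le> (\<integral>t. e * \<bar>h t\<bar> \<partial>lborel)"
    proof (intro integral_mono integrable_norm)
      show "integrable lborel (\<lambda>t. h t * (\<phi> (exp (- t)) - p (exp (- t))))"
        using int[of "\<lambda>x. \<phi> x - p x"] \<phi> cp by (simp add: continuous_on_diff)
      show "integrable lborel (\<lambda>t. e * \<bar>h t\<bar>)" using h by simp
      show "norm (h t * (\<phi> (exp (- t)) - p (exp (- t)))) \<le> e * \<bar>h t\<bar>" for t
      proof (cases "h t = 0")
        case False
        show ?thesis using p(2)[OF le[OF False]] by (simp add: abs_mult mult.commute[of e] mult_left_mono less_imp_le)
      qed simp
    qed
    finally show ?thesis by (simp add: I_def)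
  qed
  show ?thesis
  proof (rule ccontr)
    assume "\<not> ?thesis"
    hence pos: "\<bar>\<integral>t. h t * \<phi> (exp (- t)) \<partial>lborel\<bar> > 0" by simp
    define e where "e = \<bar>\<integral>t. h t * \<phi> (exp (- t)) \<partial>lborel\<bar> / (2 * (I + 1))"
    have "e > 0" using pos I by (simp add: e_def)
    from bound[OF this] have "\<bar>\<integral>t. h t * \<phi> (exp (- t)) \<partial>lborel\<bar> \<le> e * I" .
    also have "\<dots> \<le> e * (I + 1)" using \<open>e > 0\<close> by simp
    also have "\<dots> = \<bar>\<integral>t. h t * \<phi> (exp (- t)) \<partial>lborel\<bar> / 2"
    proof -
      have *: "x / (2 * y) * y = x / 2" if "y \<noteq> 0" for x y :: real using that by simp
      show ?thesis unfolding e_def by (rule *) (use I in simp)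
    qed
    finally show False using pos by simp
  qed
qed

text \<open>Test with a bump function supported exactly on the interval: if h were positive there, the integral
would be positive as well.\<close>

lemma exponential_moments_eq_0_imp_nonpos:
  fixes h :: "real \<Rightarrow> real"
  assumes h: "integrable lborel h" "\<And>t. t \<le> 0 \<Longrightarrow> h t = 0"
    and mom: "\<And>n::nat. (\<integral>t. h t * exp (- real n * t) \<partial>lborel) = 0"
    and ab: "a < b"
  shows "\<exists>t\<in>{a<..<b}. h t \<le> 0"
proof (rule ccontr)
  assume "\<not> ?thesis"
  hence pos: "\<And>t. a < t \<Longrightarrow> t < b \<Longrightarrow> h t > 0" by (auto simp: not_le)
  define \<phi> where "\<phi> x = max 0 ((x - exp (- b)) * (exp (- a) - x))" for x
  have \<phi>: "continuous_on UNIV \<phi>" unfolding \<phi>_def[abs_def] by (intro continuous_intros)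
  have \<phi>_pos: "\<phi> (exp (- t)) > 0" if "a < t" "t < b" for t
    using that by (simp add: \<phi>_def less_max_iff_disj)
  have \<phi>_0: "\<phi> (exp (- t)) = 0" if "\<not> (a < t \<and> t < b)" for t
  proof -
    have "(exp (- t) - exp (- b)) * (exp (- a) - exp (- t)) \<le> 0"
      using that ab by (cases "t \<le> a") (auto intro: mult_nonneg_nonpos mult_nonpos_nonneg)
    thus ?thesis by (simp add: \<phi>_def max_def)
  qed
  have nonneg: "0 \<le> h t * \<phi> (exp (- t))" for t
    using pos[of t] \<phi>_pos[of t] \<phi>_0[of t] by (cases "a < t \<and> t < b") auto
  have zero: "(\<integral>t. h t * \<phi> (exp (- t)) \<partial>lborel) = 0"
    by (rule integral_continuous_comp_exp_eq_0[OF h mom \<phi>])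
  have int: "integrable lborel (\<lambda>t. h t * \<phi> (exp (- t)))"
  proof (rule Bochner_Integration.integrable_bound)
    have [measurable]: "\<phi> \<in> borel_measurable borel" using \<phi> by (rule borel_measurable_continuous_onI)
    have [measurable]: "h \<in> borel_measurable borel" using h(1) by auto
    show "(\<lambda>t. h t * \<phi> (exp (- t))) \<in> borel_measurable lborel" by measurable
    show "integrable lborel (\<lambda>t. exp (- a) * exp (- a) * h t)" using h(1) by simp
    have "\<bar>\<phi> (exp (- t))\<bar> \<le> exp (- a) * exp (- a)" for t
    proof (cases "a < t \<and> t < b")
      case True
      have "(exp (- t) - exp (- b)) * (exp (- a) - exp (- t)) \<le> exp (- a) * exp (- a)"
        by (rule mult_mono) (use True in \<open>auto intro: order_trans[of _ "exp (- t)"]\<close>)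
      thus ?thesis by (simp add: \<phi>_def)
    qed (simp add: \<phi>_0)
    thus "AE t in lborel. norm (h t * \<phi> (exp (- t))) \<le> norm (exp (- a) * exp (- a) * h t)"
      by (intro AE_I2) (simp add: abs_mult mult.commute mult_left_mono)
  qed
  have "AE t in lborel. h t * \<phi> (exp (- t)) = 0"
    using integral_nonneg_eq_0_iff_AE[OF int] nonneg zero by simp
  hence "AE t in lborel. t \<notin> {a<..<b}"
    by eventually_elim (use pos \<phi>_pos in force)
  moreover have "{t. a < t \<and> t < b} = {a<..<b}" by auto
  ultimately have "emeasure lborel {a<..<b} = 0"
    by (subst (asm) AE_iff_measurable[OF _ refl]) auto
  thus False using ab by simp
qed

text \<open>Equal transforms force equality almost everywhere only. Continuity of g and monotonicity of f upgrade
this: an excess of f over g at t persists on an interval to the left of t, a deficit on an interval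
to the right.\<close>

lemma laplace_unique_antimono_continuous:
  fixes f g :: "real \<Rightarrow> real"
  assumes mono: "\<And>s t. 0 < s \<Longrightarrow> s \<le> t \<Longrightarrow> f t \<le> f s"
    and cont: "continuous_on {0<..} g"
    and int: "\<And>s. s \<ge> s0 \<Longrightarrow> has_bochner_integral lborel (\<lambda>t. indicator {0<..} t * (exp (- s * t) * f t)) (F s)"
             "\<And>s. s \<ge> s0 \<Longrightarrow> has_bochner_integral lborel (\<lambda>t. indicator {0<..} t * (exp (- s * t) * g t)) (F s)"
    and t: "t > 0"
  shows "f t = g t"
proof -
  define h where "h t = indicator {0<..} t * (exp (- s0 * t) * (f t - g t))" for t
  have hb: "has_bochner_integral lborel (\<lambda>t. h t * exp (- real n * t)) 0" for n
  proof -
    have "has_bochner_integral lborel (\<lambda>t. indicator {0<..} t * (exp (- (s0 + n) * t) * f t) - indicator {0<..} t * (exp (- (s0 + n) * t) * g t)) (F (s0 + n) - F (s0 + n))"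
      by (intro has_bochner_integral_diff int) auto
    also have "(\<lambda>t. indicator {0<..} t * (exp (- (s0 + n) * t) * f t) - indicator {0<..} t * (exp (- (s0 + n) * t) * g t)) = (\<lambda>t. h t * exp (- real n * t))"
    proof
      fix t
      have "exp (- (s0 + n) * t) = exp (- s0 * t) * exp (- real n * t)"
        by (simp add: exp_add[symmetric] algebra_simps)
      thus "indicator {0<..} t * (exp (- (s0 + n) * t) * f t) - indicator {0<..} t * (exp (- (s0 + n) * t) * g t) = h t * exp (- real n * t)"
        by (simp add: h_def algebra_simps)
    qed
    finally show ?thesis by simp
  qed
  have ih: "integrable lborel h" using hb[of 0] by (simp add: has_bochner_integral_iff)
  have h0: "h t = 0" if "t \<le> 0" for t using that by (simp add: h_def)
  have mom: "(\<integral>t. h t * exp (- real n * t) \<partial>lborel) = 0" for n using hb[of n] by (simp add: has_bochner_integral_iff)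
  have mom': "(\<integral>t. - h t * exp (- real n * t) \<partial>lborel) = 0" for n using mom[of n] by simp
  have gt: "isCont g t" using cont t by (simp add: continuous_on_eq_continuous_at)
  show ?thesis
  proof (rule ccontr)
    assume "f t \<noteq> g t"
    then consider "f t > g t" | "f t < g t" by linarith
    thus False
    proof cases
      case 1
      have "eventually (\<lambda>x. g x < f t) (nhds t)"
        using gt 1 by (auto simp: isCont_def intro!: order_tendstoD(2) simp: tendsto_at_iff_tendsto_nhds)
      then obtain d where d: "d > 0" "\<And>x. dist x t < d \<Longrightarrow> g x < f t" by (auto simp: eventually_nhds_metric)
      have "\<exists>x\<in>{max (t / 2) (t - d)<..<t}. h x \<le> 0"
        using t d by (intro exponential_moments_eq_0_imp_nonpos ih h0 mom) auto
      then obtain x where x: "x < t" "t / 2 < x" "t - d < x" "h x \<le> 0" by auto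
      have "g x < f t" using x by (intro d) (auto simp: dist_real_def)
      also have "f t \<le> f x" using x t by (intro mono) auto
      finally show False using x t by (auto simp: h_def mult_le_0_iff)
    next
      case 2
      have "eventually (\<lambda>x. f t < g x) (nhds t)"
        using gt 2 by (auto simp: isCont_def intro!: order_tendstoD(1) simp: tendsto_at_iff_tendsto_nhds)
      then obtain d where d: "d > 0" "\<And>x. dist x t < d \<Longrightarrow> f t < g x" by (auto simp: eventually_nhds_metric)
      have "\<exists>x\<in>{t<..<t + d}. - h x \<le> 0"
        using t d ih by (intro exponential_moments_eq_0_imp_nonpos mom') (auto simp: h0)
      then obtain x where x: "x > t" "x < t + d" "h x \<ge> 0" by auto
      have "f x \<le> f t" using x t by (intro mono) auto
      also have "f t < g x" using x by (intro d) (auto simp: dist_real_def)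
      finally show False using x t by (auto simp: h_def zero_le_mult_iff)
    qed
  qed
qed

text \<open>Tonelli's theorem applied to the region X < t. It serves both the gamma distribution functions and
the distribution functions of the subordinators, hence the weight g on a general measure space.\<close>

lemma nn_integral_laplace_distribution_function:
  assumes M: "sigma_finite_measure M" and [measurable]: "X \<in> borel_measurable M" "g \<in> borel_measurable M"
    and X: "AE x in M. g x = 0 \<or> 0 \<le> X x" and s: "s > (0::real)"
  shows "(\<integral>\<^sup>+t. indicator {0<..} t * ennreal (exp (- s * t)) * (\<integral>\<^sup>+x. g x * indicator {..<t} (X x) \<partial>M) \<partial>lborel)
       = ennreal (1 / s) * (\<integral>\<^sup>+x. g x * ennreal (exp (- s * X x)) \<partial>M)"
proof -
  interpret M: sigma_finite_measure M by fact
  interpret pair_sigma_finite M lborel ..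
  have tail: "(\<integral>\<^sup>+t. indicator {0<..} t * ennreal (exp (- s * t)) * indicator {..<t} x \<partial>lborel) = ennreal (1 / s * exp (- s * x))"
    if "x \<ge> 0" for x
  proof -
    have "(\<integral>\<^sup>+t. indicator {0<..} t * ennreal (exp (- s * t)) * indicator {..<t} x \<partial>lborel) =
       (\<integral>\<^sup>+t. ennreal (exp (- s * t)) * indicator {x..} t \<partial>lborel)"
    proof (rule nn_integral_cong_AE)
      show "AE t in lborel. indicator {0<..} t * ennreal (exp (- s * t)) * indicator {..<t} x = ennreal (exp (- s * t)) * indicator {x..} t"
        using AE_lborel_singleton[of x] by eventually_elim (use that in \<open>auto split: split_indicator\<close>)
    qed
    also have "\<dots> = ennreal (0 - (- exp (- s * x) / s))"
    proof (rule nn_integral_FTC_atLeast)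
      have "((\<lambda>r. exp (- s * r)) \<longlongrightarrow> 0) at_top"
        using s by (intro filterlim_compose[OF exp_at_bot] filterlim_tendsto_neg_mult_at_bot[OF tendsto_const])
           (auto simp: filterlim_ident)
      from tendsto_minus[OF tendsto_divide[OF this tendsto_const[of s]]] s
      show "((\<lambda>r. - exp (- s * r) / s) \<longlongrightarrow> 0) at_top" by simp
    qed (use s in \<open>auto intro!: derivative_eq_intros\<close>)
    finally show ?thesis by simp
  qed
  have "(\<integral>\<^sup>+t. indicator {0<..} t * ennreal (exp (- s * t)) * (\<integral>\<^sup>+x. g x * indicator {..<t} (X x) \<partial>M) \<partial>lborel) =
     (\<integral>\<^sup>+t. \<integral>\<^sup>+x. g x * (indicator {0<..} t * ennreal (exp (- s * t)) * (if X x < t then 1 else 0)) \<partial>M \<partial>lborel)"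
    by (intro nn_integral_cong, subst nn_integral_cmult[symmetric]) (auto simp: mult_ac indicator_def intro!: nn_integral_cong)
  also have "\<dots> = (\<integral>\<^sup>+x. \<integral>\<^sup>+t. g x * (indicator {0<..} t * ennreal (exp (- s * t)) * (if X x < t then 1 else 0)) \<partial>lborel \<partial>M)"
    by (rule Fubini') measurable
  also have "\<dots> = (\<integral>\<^sup>+x. g x * (\<integral>\<^sup>+t. indicator {0<..} t * ennreal (exp (- s * t)) * indicator {..<t} (X x) \<partial>lborel) \<partial>M)"
    by (subst nn_integral_cmult[symmetric]) (auto simp: indicator_def intro!: nn_integral_cong)
  also have "\<dots> = (\<integral>\<^sup>+x. ennreal (1 / s) * (g x * ennreal (exp (- s * X x))) \<partial>M)"
  proof (rule nn_integral_cong_AE)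
    show "AE x in M. g x * (\<integral>\<^sup>+t. indicator {0<..} t * ennreal (exp (- s * t)) * indicator {..<t} (X x) \<partial>lborel) =
       ennreal (1 / s) * (g x * ennreal (exp (- s * X x)))"
      using X
    proof eventually_elim
      case (elim x)
      show ?case
      proof (cases "g x = 0")
        case False
        with elim have "0 \<le> X x" by simp
        thus ?thesis unfolding tail[OF \<open>0 \<le> X x\<close>] using s by (subst ennreal_mult') (auto simp: mult_ac)
      qed simp
    qed
  qed
  also have "\<dots> = ennreal (1 / s) * (\<integral>\<^sup>+x. g x * ennreal (exp (- s * X x)) \<partial>M)"
    by (rule nn_integral_cmult) measurable
  finally show ?thesis .
qed

lemma has_bochner_integral_laplace_gamma_cdf:
  assumes "\<rho> > 0" "\<mu> \<ge> 0" "s > 0"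
  shows "has_bochner_integral lborel (\<lambda>t. indicator {0<..} t * (exp (- s * t) * gamma_cdf \<rho> \<mu> t)) ((s + \<rho>) powr (- \<mu>) / s)"
proof (rule has_bochner_integral_nn_integral)
  have [measurable]: "gamma_cdf \<rho> \<mu> \<in> borel_measurable borel" using assms by simp
  show "(\<lambda>t. indicator {0<..} t * (exp (- s * t) * gamma_cdf \<rho> \<mu> t)) \<in> borel_measurable lborel" by measurable
  show "(\<integral>\<^sup>+t. ennreal (indicator {0<..} t * (exp (- s * t) * gamma_cdf \<rho> \<mu> t)) \<partial>lborel) = ennreal ((s + \<rho>) powr (- \<mu>) / s)"
  proof (cases "\<mu> = 0")
    case True
    have "(\<integral>\<^sup>+t. ennreal (indicator {0<..} t * (exp (- s * t) * gamma_cdf \<rho> \<mu> t)) \<partial>lborel) =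
       (\<integral>\<^sup>+t. ennreal (exp (- 0 * t) * gamma_kernel s 1 t) \<partial>lborel)"
      using True by (intro nn_integral_cong) (auto simp: gamma_cdf_def gamma_kernel_def split: split_indicator)
    also have "\<dots> = ennreal ((0 + s) powr (- 1))" using assms by (intro nn_integral_gamma_kernel_laplace) auto
    finally show ?thesis using True assms by (simp add: powr_minus divide_simps)
  next
    case False
    hence \<mu>: "\<mu> > 0" using assms by simp
    have "(\<integral>\<^sup>+t. ennreal (indicator {0<..} t * (exp (- s * t) * gamma_cdf \<rho> \<mu> t)) \<partial>lborel) =
      (\<integral>\<^sup>+t. indicator {0<..} t * ennreal (exp (- s * t)) * (\<integral>\<^sup>+r. ennreal (gamma_kernel \<rho> \<mu> r) * indicator {..<t} r \<partial>lborel) \<partial>lborel)"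
      using assms \<mu> by (intro nn_integral_cong) (auto simp: nn_integral_gamma_kernel_lessThan ennreal_mult' split: split_indicator)
    also have "\<dots> = ennreal (1 / s) * (\<integral>\<^sup>+r. ennreal (gamma_kernel \<rho> \<mu> r) * ennreal (exp (- s * r)) \<partial>lborel)"
      using assms by (intro nn_integral_laplace_distribution_function sigma_finite_lborel AE_I2) (auto simp: gamma_kernel_def)
    also have "(\<integral>\<^sup>+r. ennreal (gamma_kernel \<rho> \<mu> r) * ennreal (exp (- s * r)) \<partial>lborel) = ennreal ((s + \<rho>) powr (- \<mu>))"
      using nn_integral_gamma_kernel_laplace[of s \<rho> \<mu>] assms \<mu>
      by (simp add: ennreal_mult''[symmetric] mult.commute)
    also have "ennreal (1 / s) * \<dots> = ennreal ((s + \<rho>) powr (- \<mu>) / s)"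
      using assms by (simp add: ennreal_mult'[symmetric])
    finally show ?thesis .
  qed
qed (use assms in \<open>auto simp: gamma_cdf_nonneg\<close>)

lemma has_bochner_integral_laplace_gamma_series:
  fixes a :: "nat \<Rightarrow> real"
  assumes "\<rho> > 0" "\<alpha> > 0" "C > 0" and a: "\<And>k. norm (a k) \<le> C ^ k"
    and s: "s > 0" "C * (s + \<rho>) powr (- \<alpha>) < 1"
  shows "has_bochner_integral lborel (\<lambda>t. indicator {0<..} t * (exp (- s * t) * gamma_series \<rho> \<alpha> a t))
     ((\<Sum>k. a k * ((s + \<rho>) powr (- \<alpha>)) ^ k) / s)"
proof -
  define x where "x = (s + \<rho>) powr (- \<alpha>)"
  have x: "x > 0" using assms by (simp add: x_def)
  have xk: "(s + \<rho>) powr (- (\<alpha> * real k)) = x ^ k" for k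
    using assms by (simp add: x_def powr_powr flip: powr_realpow)
  define f where "f k t = a k * (indicator {0<..} t * (exp (- s * t) * gamma_cdf \<rho> (\<alpha> * real k) t))" for k t
  have hb: "has_bochner_integral lborel (f k) (a k * (x ^ k / s))" for k
    unfolding f_def xk[symmetric] using assms by (intro has_bochner_integral_mult_right has_bochner_integral_laplace_gamma_cdf) auto
  have hbn: "has_bochner_integral lborel (\<lambda>t. norm (f k t)) (\<bar>a k\<bar> * (x ^ k / s))" for k
  proof -
    have "(\<lambda>t. norm (f k t)) = (\<lambda>t. \<bar>a k\<bar> * (indicator {0<..} t * (exp (- s * t) * gamma_cdf \<rho> (\<alpha> * real k) t)))"
      using assms by (auto simp: f_def abs_mult gamma_cdf_nonneg)
    thus ?thesis
      unfolding xk[symmetric]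
      by (simp only:) (intro has_bochner_integral_mult_right has_bochner_integral_laplace_gamma_cdf,
        use assms in auto)
  qed
  have sm: "summable (\<lambda>k. \<bar>a k\<bar> * x ^ k)"
  proof (rule summable_comparison_test'[of _ 0])
    show "summable (\<lambda>k. (C * x) ^ k)" using assms x by (intro summable_geometric) (auto simp: x_def)
    show "norm (\<bar>a k\<bar> * x ^ k) \<le> (C * x) ^ k" for k
      using a[of k] x by (auto simp: power_mult_distrib intro!: mult_right_mono)
  qed
  have int: "integrable lborel (f k)" for k using hb by (rule integrable.intros)
  have sn: "summable (\<lambda>k. \<integral>t. norm (f k t) \<partial>lborel)"
    using summable_divide[OF sm, of s] hbn by (simp add: has_bochner_integral_iff)
  have sf: "summable (\<lambda>k. norm (f k t))" for t
  proof (cases "t > 0")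
    case True
    have "summable (\<lambda>k. exp (- s * t) * norm (gamma_cdf \<rho> (\<alpha> * real k) t *\<^sub>R a k))"
      by (intro summable_mult summable_gamma_series(1)[where C=C] assms True)
    thus ?thesis using True assms by (simp add: f_def abs_mult mult_ac)
  qed (simp add: f_def)
  have sum_f: "(\<Sum>k. f k t) = indicator {0<..} t * (exp (- s * t) * gamma_series \<rho> \<alpha> a t)" for t
  proof (cases "t > 0")
    case True
    have "(\<lambda>k. exp (- s * t) * (gamma_cdf \<rho> (\<alpha> * real k) t *\<^sub>R a k)) sums (exp (- s * t) * gamma_series \<rho> \<alpha> a t)"
      unfolding gamma_series_def by (intro sums_mult summable_sums summable_gamma_series(2)[where C=C] assms True)
    moreover have "(\<lambda>k. exp (- s * t) * (gamma_cdf \<rho> (\<alpha> * real k) t *\<^sub>R a k)) = (\<lambda>k. f k t)"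
      using True by (auto simp: f_def)
    ultimately show ?thesis using True by (simp add: sums_iff)
  qed (simp add: f_def)
  have "(\<Sum>k. a k * (x ^ k / s)) = (\<Sum>k. a k * x ^ k) / s"
    using suminf_divide[of "\<lambda>k. a k * x ^ k" s] summable_norm_cancel[of "\<lambda>k. a k * x ^ k"] sm x
    by (simp add: abs_mult)
  thus ?thesis unfolding has_bochner_integral_iff x_def[symmetric]
    using integrable_suminf[OF int AE_I2[OF sf] sn] integral_suminf[OF int AE_I2[OF sf] sn] hb unfolding sum_f
    by (simp add: has_bochner_integral_iff)
qed

section \<open>Coefficients of the state probabilities and of their generating function\<close>

text \<open>The expansion coefficients of psi / (psi - w) in powers of 1/z, where psi = z^2 + z - c;
for w = \<lambda> (u - 1) they belong to the generating function G(u, .).\<close>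

fun gf_coeff :: "real \<Rightarrow> 'b::real_normed_field \<Rightarrow> nat \<Rightarrow> 'b" where
  "gf_coeff c w 0 = 1"
| "gf_coeff c w (Suc 0) = 0"
| "gf_coeff c w (Suc (Suc k)) = (of_real (if k = 0 then 0 else c) + w) * gf_coeff c w k - gf_coeff c w (Suc k)"

text \<open>The coefficient of u^n in the expansion coefficient of G(u, .); here n is the state and
the last argument is the index of the series. The difference in the last line
mirrors the right-hand side of the equations for the state probabilities.\<close>

fun prob_coeff :: "real \<Rightarrow> real \<Rightarrow> nat \<Rightarrow> nat \<Rightarrow> real" where
  "prob_coeff c lam n 0 = (if n = 0 then 1 else 0)"
| "prob_coeff c lam n (Suc 0) = 0"
| "prob_coeff c lam n (Suc (Suc k)) = (if k = 0 then 0 else c) * prob_coeff c lam n k - prob_coeff c lam n (Suc k)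
     - lam * (prob_coeff c lam n k - (if n = 0 then 0 else prob_coeff c lam (n - 1) k))"

lemma norm_gf_coeff_le:
  assumes "c \<ge> 0" "norm w \<le> r"
  shows "norm (gf_coeff c w k) \<le> (1 + c + r) ^ k"
proof (induction k rule: induct_nat_012)
  case (ge2 k)
  have r: "0 \<le> r" using assms norm_ge_zero order_trans by blast
  define C where "C = 1 + c + r"
  have "norm (of_real (if k = 0 then 0 else c) + w) \<le> c + r"
    using norm_triangle_ineq[of "of_real (if k = 0 then 0 else c)" w] assms by auto
  hence "norm (gf_coeff c w (Suc (Suc k))) \<le> (c + r) * C ^ k + C ^ Suc k"
    unfolding gf_coeff.simps C_def using ge2 assms r
    by (intro order_trans[OF norm_triangle_ineq4] add_mono) (auto simp: norm_mult intro!: mult_mono)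
  also have "\<dots> \<le> (c + r) * C ^ Suc k + C ^ Suc k"
    using assms r by (auto simp: C_def intro!: mult_left_mono)
  also have "\<dots> = C ^ Suc (Suc k)" by (simp add: C_def algebra_simps)
  finally show ?case by (simp add: C_def)
qed (use assms norm_ge_zero[of w] in \<open>auto simp del: norm_ge_zero\<close>)

text \<open>As a polynomial in u, the k-th coefficient of G(u, .) has l1-norm at most C^k. The
base C = 1 + c + 2 \<lambda> satisfies C^2 \<ge> C + c + 2 \<lambda>, as the recursion demands. The l1-bound is what makes
the double series in n and k converge absolutely on the closed unit disc.\<close>

lemma sum_prob_coeff_le:
  assumes "c \<ge> 0" "lam \<ge> 0"
  shows "(\<Sum>n<m. \<bar>prob_coeff c lam n k\<bar>) \<le> (1 + c + 2 * lam) ^ k"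
proof (induction k rule: induct_nat_012)
  case 0
  show ?case by (cases m) (simp_all add: sum.lessThan_Suc_shift)
next
  case (ge2 k)
  define C where "C = 1 + c + 2 * lam"
  define A where "A n k = \<bar>prob_coeff c lam n k\<bar>" for n k
  have shift: "(\<Sum>n<m. if n = 0 then 0 else A (n - 1) k) \<le> (\<Sum>n<m. A n k)"
  proof (cases m)
    case (Suc m')
    have "(\<Sum>n<m. if n = 0 then 0 else A (n - 1) k) = (\<Sum>n<m'. A n k)"
      unfolding Suc sum.lessThan_Suc_shift by simp
    also have "\<dots> \<le> (\<Sum>n<m. A n k)" unfolding Suc by (simp add: A_def)
    finally show ?thesis .
  qed simp
  have "A n (Suc (Suc k)) \<le> c * A n k + A n (Suc k) + lam * (A n k + (if n = 0 then 0 else A (n - 1) k))" for n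
  proof -
    have 1: "\<bar>(if k = 0 then 0 else c) * prob_coeff c lam n k\<bar> \<le> c * A n k"
      using assms by (auto simp: A_def abs_mult)
    have 2: "\<bar>lam * (prob_coeff c lam n k - (if n = 0 then 0 else prob_coeff c lam (n - 1) k))\<bar>
        \<le> lam * (A n k + (if n = 0 then 0 else A (n - 1) k))"
      using assms by (auto simp: A_def abs_mult intro!: mult_left_mono abs_triangle_ineq4)
    show ?thesis using 1 2 unfolding A_def[of n "Suc _"] prob_coeff.simps by linarith
  qed
  hence "(\<Sum>n<m. A n (Suc (Suc k))) \<le> (\<Sum>n<m. c * A n k + A n (Suc k) + lam * (A n k + (if n = 0 then 0 else A (n - 1) k)))"
    by (intro sum_mono) auto
  also have "\<dots> = c * (\<Sum>n<m. A n k) + (\<Sum>n<m. A n (Suc k)) + lam * ((\<Sum>n<m. A n k) + (\<Sum>n<m. if n = 0 then 0 else A (n - 1) k))"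
    by (simp only: sum.distrib sum_distrib_left[symmetric])
  also have "\<dots> \<le> c * C ^ k + C ^ Suc k + lam * (C ^ k + C ^ k)"
    using ge2 shift assms unfolding A_def[symmetric] C_def[symmetric]
    by (intro add_mono mult_left_mono) auto
  also have "\<dots> = (c + 2 * lam) * C ^ k + C ^ Suc k" by (simp add: algebra_simps)
  also have "\<dots> \<le> (c + 2 * lam) * C ^ Suc k + C ^ Suc k"
    using assms by (auto simp: C_def intro!: mult_left_mono)
  also have "\<dots> = C ^ Suc (Suc k)" by (simp add: C_def algebra_simps)
  finally show ?case by (simp add: C_def A_def)
qed (use assms in auto)

lemma abs_prob_coeff_le:
  assumes "c \<ge> 0" "lam \<ge> 0"
  shows "\<bar>prob_coeff c lam n k\<bar> \<le> (1 + c + 2 * lam) ^ k"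
proof -
  have "\<bar>prob_coeff c lam n k\<bar> \<le> (\<Sum>n<Suc n. \<bar>prob_coeff c lam n k\<bar>)" by (simp add: sum_nonneg)
  thus ?thesis using sum_prob_coeff_le[OF assms, where m="Suc n" and k=k] by linarith
qed

lemma sums_prob_coeff:
  fixes u :: "'b::{real_normed_field}"
  shows "(\<lambda>n. of_real (prob_coeff c lam n k) * u ^ n) sums gf_coeff c (of_real lam * (u - 1)) k"
proof (induction k rule: induct_nat_012)
  case 0
  show ?case using sums_single[of 0 "\<lambda>n. u ^ n"] by (simp add: if_distrib[of of_real] if_distrib[of "\<lambda>x. x * _"] cong: if_cong)
next
  case (ge2 k)
  have "(\<lambda>n. u * (of_real (prob_coeff c lam n k) * u ^ n)) sums (u * gf_coeff c (of_real lam * (u - 1)) k)"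
    by (intro sums_mult ge2)
  hence s: "(\<lambda>n. of_real (if n = 0 then 0 else prob_coeff c lam (n - 1) k) * u ^ n) sums (u * gf_coeff c (of_real lam * (u - 1)) k)"
    by (subst sums_Suc_iff[symmetric, where f="\<lambda>n. of_real (if n = 0 then 0 else prob_coeff c lam (n - 1) k) * u ^ n", simplified]) (simp_all add: mult_ac)
  have "(\<lambda>n. of_real (if k = 0 then 0 else c) * (of_real (prob_coeff c lam n k) * u ^ n) - of_real (prob_coeff c lam n (Suc k)) * u ^ n
        - of_real lam * (of_real (prob_coeff c lam n k) * u ^ n - of_real (if n = 0 then 0 else prob_coeff c lam (n - 1) k) * u ^ n))
     sums (of_real (if k = 0 then 0 else c) * gf_coeff c (of_real lam * (u - 1)) k - gf_coeff c (of_real lam * (u - 1)) (Suc k)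
        - of_real lam * (gf_coeff c (of_real lam * (u - 1)) k - u * gf_coeff c (of_real lam * (u - 1)) k))"
    by (intro sums_diff sums_mult ge2 s)
  thus ?case by (simp add: algebra_simps)
qed simp

text \<open>Interchange of the sums over states and over shapes.\<close>

lemma sums_gamma_series_prob_coeff:
  fixes u :: "'b::{real_normed_field, banach, second_countable_topology}"
  assumes "\<rho> > 0" "\<alpha> > 0" "c \<ge> 0" "lam \<ge> 0" "t > 0" and u: "norm u \<le> 1"
  shows "(\<lambda>n. u ^ n * of_real (gamma_series \<rho> \<alpha> (prob_coeff c lam n) t)) sums
     gamma_series \<rho> \<alpha> (gf_coeff c (of_real lam * (u - 1))) t"
proof -
  define W where "W k = gamma_cdf \<rho> (\<alpha> * real k) t" for k
  define C where "C = 1 + c + 2 * lam"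
  have C: "C > 0" using assms by (simp add: C_def)
  have sW: "summable (\<lambda>k. W k * C ^ k)"
    unfolding W_def using assms C by (intro summable_gamma_cdf) auto
  have Wn: "0 \<le> W k" for k unfolding W_def using assms by (intro gamma_cdf_nonneg) auto
  define f where "f n k = of_real (W k * prob_coeff c lam n k) * u ^ n" for n k
  have le: "norm (f n k) \<le> W k * \<bar>prob_coeff c lam n k\<bar>" for n k
    using power_le_one[OF norm_ge_zero u, of n] Wn[of k]
    by (auto simp: f_def norm_mult norm_power abs_mult mult_left_le)
  have le2: "W k * \<bar>prob_coeff c lam n k\<bar> \<le> W k * C ^ k" for n k
    unfolding C_def using assms Wn by (intro mult_left_mono abs_prob_coeff_le) auto
  have sn: "summable (\<lambda>k. W k * \<bar>prob_coeff c lam n k\<bar>)" for n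
    by (rule summable_comparison_test'[OF sW, of 0]) (use le2 Wn in auto)
  have sf: "summable (\<lambda>k. norm (f n k))" for n
    by (rule summable_comparison_test'[OF sn, of 0]) (use le in auto)
  have int: "integrable (count_space UNIV) (f n)" for n
    using sf by (simp add: integrable_count_space_nat_iff)
  have ae: "AE k in count_space UNIV. summable (\<lambda>n. norm (f n k))"
  proof (rule AE_I2)
    fix k
    show "summable (\<lambda>n. norm (f n k))"
    proof (rule summableI_nonneg_bounded)
      fix m
      have "(\<Sum>n<m. norm (f n k)) \<le> W k * (\<Sum>n<m. \<bar>prob_coeff c lam n k\<bar>)"
        unfolding sum_distrib_left by (intro sum_mono le)
      also have "\<dots> \<le> W k * C ^ k"
        unfolding C_def using assms Wn by (intro mult_left_mono sum_prob_coeff_le) auto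
      finally show "(\<Sum>n<m. norm (f n k)) \<le> W k * C ^ k" .
    qed simp
  qed
  have sumint: "summable (\<lambda>n. \<integral>k. norm (f n k) \<partial>count_space UNIV)"
  proof (rule summableI_nonneg_bounded)
    fix m
    have "(\<Sum>n<m. \<integral>k. norm (f n k) \<partial>count_space UNIV) = (\<Sum>n<m. \<Sum>k. norm (f n k))"
      using sf by (intro sum.cong refl integral_count_space_nat) (simp add: integrable_count_space_nat_iff)
    also have "\<dots> = (\<Sum>k. \<Sum>n<m. norm (f n k))"
      by (rule suminf_sum[symmetric]) (rule sf)
    also have "\<dots> \<le> (\<Sum>k. W k * C ^ k)"
    proof (intro suminf_le sW summable_sum sf)
      fix k
      have "(\<Sum>n<m. norm (f n k)) \<le> W k * (\<Sum>n<m. \<bar>prob_coeff c lam n k\<bar>)"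
        unfolding sum_distrib_left by (intro sum_mono le)
      also have "\<dots> \<le> W k * C ^ k"
        unfolding C_def using assms Wn by (intro mult_left_mono sum_prob_coeff_le) auto
      finally show "(\<Sum>n<m. norm (f n k)) \<le> W k * C ^ k" .
    qed
    finally show "(\<Sum>n<m. \<integral>k. norm (f n k) \<partial>count_space UNIV) \<le> (\<Sum>k. W k * C ^ k)" .
  qed simp
  have sum_n: "(\<Sum>n. f n k) = W k *\<^sub>R gf_coeff c (of_real lam * (u - 1)) k" for k
    using sums_scaleR_right[OF sums_prob_coeff[of c lam k u], of "W k"]
    by (simp add: f_def sums_iff scaleR_conv_of_real mult_ac)
  have sum_k: "(\<integral>k. f n k \<partial>count_space UNIV) = u ^ n * of_real (gamma_series \<rho> \<alpha> (prob_coeff c lam n) t)" for n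
  proof -
    have sr: "summable (\<lambda>k. W k * prob_coeff c lam n k)"
      by (rule summable_comparison_test'[OF sn[of n], of 0]) (use Wn in \<open>simp add: abs_mult\<close>)
    have "(\<integral>k. f n k \<partial>count_space UNIV) = (\<Sum>k. f n k)"
      by (rule integral_count_space_nat[OF int])
    also have "\<dots> = of_real (\<Sum>k. W k * prob_coeff c lam n k) * u ^ n"
      unfolding f_def using sums_mult2[OF sums_of_real[OF summable_sums[OF sr]], of "u ^ n"] by (simp add: sums_iff)
    finally show ?thesis by (simp add: gamma_series_def W_def mult.commute)
  qed
  have "integrable (count_space UNIV) (\<lambda>k. W k *\<^sub>R gf_coeff c (of_real lam * (u - 1)) k)"
    using integrable_suminf[OF int ae sumint] by (simp add: sum_n)
  from integral_count_space_nat[OF this] sums_integral[OF int ae sumint]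
  show ?thesis by (simp add: sum_n sum_k gamma_series_def W_def)
qed

text \<open>Summing the recursion against x^k gives a linear equation for the generating function in x = 1/z.\<close>

lemma suminf_gf_coeff:
  assumes "c \<ge> 0" "\<bar>w\<bar> \<le> r" "0 < x" "(1 + c + r) * x < 1" "1 + x - (c + w) * x\<^sup>2 \<noteq> 0"
  shows "(\<Sum>k. gf_coeff c w k * x ^ k) = (1 + x - c * x\<^sup>2) / (1 + x - (c + w) * x\<^sup>2)"
proof -
  have sm: "summable (\<lambda>k. gf_coeff c w k * x ^ k)"
  proof (rule summable_comparison_test'[of _ 0])
    show "summable (\<lambda>k. ((1 + c + r) * x) ^ k)"
      using assms by (intro summable_geometric) auto
    show "norm (gf_coeff c w k * x ^ k) \<le> ((1 + c + r) * x) ^ k" for k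
      using norm_gf_coeff_le[of c w r k] assms
      by (auto simp: power_mult_distrib abs_mult intro!: mult_right_mono)
  qed
  define A where "A = (\<Sum>k. gf_coeff c w k * x ^ k)"
  have s0: "(\<lambda>k. gf_coeff c w k * x ^ k) sums A" unfolding A_def by (rule summable_sums[OF sm])
  have s1: "(\<lambda>k. gf_coeff c w (Suc k) * x ^ Suc k) sums (A - 1)"
    using s0 by (subst sums_Suc_iff) simp
  have s2: "(\<lambda>k. gf_coeff c w (Suc (Suc k)) * x ^ Suc (Suc k)) sums (A - 1)"
    using s1 by (subst sums_Suc_iff) simp
  have s3: "(\<lambda>k. if k = 0 then c else 0) sums c" using sums_single[of 0 "\<lambda>_. c"] by simp
  have "(\<lambda>k. (c + w) * x\<^sup>2 * (gf_coeff c w k * x ^ k) - x\<^sup>2 * (if k = 0 then c else 0) - x * (gf_coeff c w (Suc k) * x ^ Suc k))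
     sums ((c + w) * x\<^sup>2 * A - x\<^sup>2 * c - x * (A - 1))"
    by (intro sums_diff sums_mult s0 s1 s3)
  also have "(\<lambda>k. (c + w) * x\<^sup>2 * (gf_coeff c w k * x ^ k) - x\<^sup>2 * (if k = 0 then c else 0) - x * (gf_coeff c w (Suc k) * x ^ Suc k))
     = (\<lambda>k. gf_coeff c w (Suc (Suc k)) * x ^ Suc (Suc k))"
    by (auto simp: fun_eq_iff algebra_simps power2_eq_square)
  finally have "(c + w) * x\<^sup>2 * A - x\<^sup>2 * c - x * (A - 1) = A - 1" using s2 by (rule sums_unique2)
  hence "A * (1 + x - (c + w) * x\<^sup>2) = 1 + x - c * x\<^sup>2" by (simp add: algebra_simps)
  thus ?thesis using assms by (simp add: A_def field_simps)
qed

text \<open>The lowest coefficient is the limit of the power series at 0; remove it and divide by u.\<close>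

lemma powser_coeffs_eq_0:
  fixes d :: "nat \<Rightarrow> real"
  assumes "\<And>u. \<bar>u\<bar> < 1 \<Longrightarrow> (\<lambda>n. d n * u ^ n) sums 0"
  shows "d n = 0"
proof (induction n rule: less_induct)
  case (less n)
  have sums: "(\<lambda>i. d (i + n) * u ^ i) sums 0" if u: "u \<noteq> 0" "\<bar>u\<bar> < 1" for u
  proof -
    have "(\<lambda>i. d (i + n) * u ^ (i + n)) sums 0"
      using assms[OF u(2)] less by (subst sums_zero_iff_shift) auto
    from sums_mult[OF this, of "1 / u ^ n"] show ?thesis using u by (simp add: power_add)
  qed
  have "((\<lambda>_. 0) \<longlongrightarrow> d (0 + n)) (at (0::real))"
    by (rule powser_limit_0_strong[of 1, OF _ sums]) auto
  from LIM_const_eq[OF this] show ?case by simp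
qed

section \<open>First passage times of increasing processes\<close>

text \<open>With J the first grid index at which the path has reached the level t, the sum telescopes to
1 - q^J, and L lies between (J - 1) \<delta> and J \<delta>.\<close>

lemma first_passage_grid_sandwich:
  fixes x :: "real \<Rightarrow> real"
  assumes mono: "mono_on {0..} x" and x0: "x 0 = 0" and t: "t > 0" and s0: "s0 > 0" "x s0 \<ge> t"
    and \<delta>: "\<delta> > 0" and \<theta>: "\<theta> > 0"
  defines "q \<equiv> exp (- \<theta> * \<delta>)" and "L \<equiv> Inf {s. s > 0 \<and> x s \<ge> t}"
  obtains D where "(\<lambda>j. (q ^ j - q ^ Suc j) * indicator {..<t} (x (real j * \<delta>))) sums D"
    "1 - exp (- \<theta> * L) \<le> D" "D \<le> (1 - q) + (1 - exp (- \<theta> * L))"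
proof -
  have L0: "L \<ge> 0" unfolding L_def using s0 by (intro cInf_greatest) auto
  obtain j0 :: nat where "s0 / \<delta> \<le> real j0" using real_arch_simple by blast
  hence "s0 \<le> real j0 * \<delta>" using \<delta> by (simp add: field_simps)
  hence ex: "x (real j0 * \<delta>) \<ge> t" using mono_onD[OF mono, of s0 "real j0 * \<delta>"] s0 by auto
  define J where "J = (LEAST j. x (real j * \<delta>) \<ge> t)"
  have J: "x (real J * \<delta>) \<ge> t" unfolding J_def by (rule LeastI[of "\<lambda>j. x (real j * \<delta>) \<ge> t", OF ex])
  have J_less: "x (real j * \<delta>) < t" if "j < J" for j
    using not_less_Least[OF that[unfolded J_def]] by simp
  have J_ge: "x (real j * \<delta>) \<ge> t" if "j \<ge> J" for j
    using mono_onD[OF mono, of "real J * \<delta>" "real j * \<delta>"] J that \<delta> by auto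
  have "J \<noteq> 0" using J x0 t by (intro notI) auto
  then obtain J' where J': "J = Suc J'" by (cases J) auto
  have "L \<le> real J * \<delta>" unfolding L_def using J \<delta> J' by (intro cInf_lower bdd_belowI[of _ 0]) auto
  hence *: "\<theta> * L \<le> \<theta> * (real J * \<delta>)" using \<theta> by (intro mult_left_mono) auto
  have qJ: "q ^ J = exp (- \<theta> * (real J * \<delta>))" for J
    unfolding q_def exp_of_nat_mult[symmetric] by (simp add: algebra_simps)
  have up: "q ^ J \<le> exp (- \<theta> * L)" unfolding qJ using * by simp
  have "real J' * \<delta> \<le> L" unfolding L_def
  proof (rule cInf_greatest)
    fix s assume s: "s \<in> {s. s > 0 \<and> x s \<ge> t}"
    show "real J' * \<delta> \<le> s"
    proof (rule ccontr)
      assume "\<not> real J' * \<delta> \<le> s"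
      hence "x s \<le> x (real J' * \<delta>)" using s \<delta> by (intro mono_onD[OF mono]) auto
      thus False using s J_less[of J'] J' by simp
    qed
  qed (use s0 in auto)
  hence "\<theta> * (real J' * \<delta>) \<le> \<theta> * L" using \<theta> by (intro mult_left_mono) auto
  hence lo: "exp (- \<theta> * L) \<le> q ^ J'" unfolding qJ by simp
  have q: "0 < q" "q \<le> 1" using \<theta> \<delta> by (simp_all add: q_def)
  have E: "exp (- \<theta> * L) \<le> 1" using \<theta> L0 by simp
  show ?thesis
  proof (rule that[of "1 - q ^ J"])
    have "(\<lambda>j. (q ^ j - q ^ Suc j) * indicator {..<t} (x (real j * \<delta>))) sums (\<Sum>j<J. (q ^ j - q ^ Suc j) * indicator {..<t} (x (real j * \<delta>)))"
      using J_ge by (intro sums_finite) (auto simp: not_less)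
    also have "(\<Sum>j<J. (q ^ j - q ^ Suc j) * indicator {..<t} (x (real j * \<delta>))) = (\<Sum>j<J. q ^ j - q ^ Suc j)"
      using J_less by (intro sum.cong) auto
    also have "\<dots> = 1 - q ^ J" by (subst sum_lessThan_telescope') simp
    finally show "(\<lambda>j. (q ^ j - q ^ Suc j) * indicator {..<t} (x (real j * \<delta>))) sums (1 - q ^ J)" .
    show "1 - exp (- \<theta> * L) \<le> 1 - q ^ J" using up by simp
    have "q * exp (- \<theta> * L) \<le> q ^ J" unfolding J' using lo q by simp
    moreover have "(1 - q) * (1 - exp (- \<theta> * L)) \<ge> 0" using q E by (intro mult_nonneg_nonneg) auto
    ultimately show "1 - q ^ J \<le> (1 - q) + (1 - exp (- \<theta> * L))" by (simp add: algebra_simps)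
  qed
qed

text \<open>By the grid sandwich, 1 - E[exp (- \<theta> L(t))] differs by at most 1 - q from a
combination of the distribution functions P(S(j \<delta>) < t), whose transforms exp (- j \<delta> psi) / s form a
geometric series. Letting the mesh tend to 0 avoids any joint measurability of S in time and chance.\<close>

lemma (in prob_space) laplace_first_passage:
  fixes S :: "real \<Rightarrow> 'a \<Rightarrow> real" and L :: "real \<Rightarrow> 'a \<Rightarrow> real"
  assumes S_meas: "\<And>x. x \<ge> 0 \<Longrightarrow> S x \<in> borel_measurable M"
    and S_mono: "AE \<omega> in M. mono_on {0..} (\<lambda>x. S x \<omega>)" and S0: "AE \<omega> in M. S 0 \<omega> = 0"
    and lap: "\<And>x. x \<ge> 0 \<Longrightarrow> expectation (\<lambda>\<omega>. exp (- s * S x \<omega>)) = exp (- x * \<psi>)"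
    and s: "s > 0" and \<psi>: "\<psi> > 0" and \<theta>: "\<theta> > 0"
    and unbdd: "\<And>t. AE \<omega> in M. \<exists>x>0. S x \<omega> \<ge> t"
    and L_meas: "\<And>t. t > 0 \<Longrightarrow> L t \<in> borel_measurable (completion M)"
    and L: "\<And>t \<omega>. t > 0 \<Longrightarrow> L t \<omega> = Inf {x. x > 0 \<and> S x \<omega> \<ge> t}"
  shows "has_bochner_integral lborel
      (\<lambda>t. indicator {0<..} t * (exp (- s * t) * (\<integral>\<omega>. exp (- \<theta> * L t \<omega>) \<partial>completion M))) (\<psi> / (s * (\<theta> + \<psi>)))"
    and "0 < t1 \<Longrightarrow> t1 \<le> t2 \<Longrightarrow>
      (\<integral>\<omega>. exp (- \<theta> * L t2 \<omega>) \<partial>completion M) \<le> (\<integral>\<omega>. exp (- \<theta> * L t1 \<omega>) \<partial>completion M)"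
    and "t1 > 0 \<Longrightarrow> AE \<omega> in M. L t1 \<omega> \<ge> 0"
proof -
  interpret C: prob_space "completion M" by (rule prob_space_completion)
  define f where "f t = (\<integral>\<omega>. exp (- \<theta> * L t \<omega>) \<partial>completion M)" for t
  have L_nonneg: "AE \<omega> in M. L t \<omega> \<ge> 0" if "t > 0" for t
    using unbdd[of t] by eventually_elim (auto simp: L[OF that] intro!: cInf_greatest)
  show "t1 > 0 \<Longrightarrow> AE \<omega> in M. L t1 \<omega> \<ge> 0" by (rule L_nonneg)
  have [measurable]: "L t \<in> borel_measurable (completion M)" if "t > 0" for t by (rule L_meas[OF that])
  have int: "integrable (completion M) (\<lambda>\<omega>. exp (- \<theta> * L t \<omega>))" if "t > 0" for t
  proof (rule C.integrable_const_bound[of _ 1])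
    show "AE \<omega> in completion M. norm (exp (- \<theta> * L t \<omega>)) \<le> 1"
      using AE_completion[OF L_nonneg[OF that]] by eventually_elim (use \<theta> in auto)
  qed (use that in measurable)
  have f_le: "f t \<le> 1" if "t > 0" for t
  proof -
    have "f t \<le> (\<integral>\<omega>. 1 \<partial>completion M)" unfolding f_def
      using AE_completion[OF L_nonneg[OF that]] \<theta>
      by (intro integral_mono_AE int that) (auto elim!: eventually_mono)
    thus ?thesis by (simp add: C.prob_space prob_space)
  qed
  have f_nonneg: "0 \<le> f t" for t unfolding f_def by (intro Bochner_Integration.integral_nonneg) auto
  have f_mono: "f t2 \<le> f t1" if "0 < t1" "t1 \<le> t2" for t1 t2
    unfolding f_def
  proof (intro integral_mono_AE int)
    show "AE \<omega> in completion M. exp (- \<theta> * L t2 \<omega>) \<le> exp (- \<theta> * L t1 \<omega>)"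
      using AE_completion[OF unbdd[of t2]]
    proof eventually_elim
      case (elim \<omega>)
      have "L t1 \<omega> \<le> L t2 \<omega>" using that elim
        by (auto simp: L intro!: cInf_superset_mono bdd_belowI[of _ 0])
      thus ?case using \<theta> by simp
    qed
  qed (use that in auto)
  show "0 < t1 \<Longrightarrow> t1 \<le> t2 \<Longrightarrow>
      (\<integral>\<omega>. exp (- \<theta> * L t2 \<omega>) \<partial>completion M) \<le> (\<integral>\<omega>. exp (- \<theta> * L t1 \<omega>) \<partial>completion M)"
    using f_mono[of t1 t2] by (simp add: f_def)
  have [measurable]: "(\<lambda>t. indicator {0<..} t * f t) \<in> borel_measurable borel"
  proof -
    have "mono (\<lambda>t. - (if t > 0 then f t else 1))"
      using f_le f_mono by (auto simp: mono_def)
    from borel_measurable_mono[OF this]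
    have [measurable]: "(\<lambda>t. if t > 0 then f t else 1) \<in> borel_measurable borel" by simp
    have "(\<lambda>t. indicator {0<..} t * f t) = (\<lambda>t. indicator {0<..} t * (if t > 0 then f t else 1))"
      by (auto simp: fun_eq_iff)
    thus ?thesis by simp
  qed
  define E where "E t = ennreal (indicator {0<..} t * exp (- s * t))" for t
  have E_int: "(\<integral>\<^sup>+t. E t \<partial>lborel) = ennreal (1 / s)"
    using nn_integral_gamma_kernel_laplace[of 0 s 1] s
    by (subst nn_integral_cong[of _ E "\<lambda>r. ennreal (exp (- 0 * r) * gamma_kernel s 1 r)"])
       (auto simp: E_def gamma_kernel_def powr_minus divide_simps split: split_indicator)
  have [measurable]: "E \<in> borel_measurable borel" unfolding E_def[abs_def] by measurable
  define gt where "gt t = ennreal (indicator {0<..} t * (1 - f t))" for t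
  have [measurable]: "gt \<in> borel_measurable borel"
    unfolding gt_def[abs_def] right_diff_distrib by measurable
  define I where "I = (\<integral>\<^sup>+t. E t * gt t \<partial>lborel)"
  \<comment> \<open>The transform of the discretised functional: the geometric series summed up.\<close>
  define R where "R \<delta> = (1 / s) * ((1 - exp (- \<theta> * \<delta>)) / (1 - exp (- \<theta> * \<delta>) * exp (- \<delta> * \<psi>)))" for \<delta>
  define F where "F \<delta> j t = (\<integral>\<^sup>+\<omega>. indicator {..<t} (S (real j * \<delta>) \<omega>) \<partial>M)" for \<delta> j t
  have R: "I \<le> ennreal (R \<delta>)" "ennreal (R \<delta>) \<le> ennreal ((1 - exp (- \<theta> * \<delta>)) / s) + I" if \<delta>: "\<delta> > 0" for \<delta>
  proof -
    define q where "q = exp (- \<theta> * \<delta>)"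
    have q: "0 < q" "q < 1" using \<theta> \<delta> by (simp_all add: q_def)
    define \<phi> where "\<phi> = exp (- \<delta> * \<psi>)"
    have \<phi>: "0 < \<phi>" "\<phi> < 1" using \<psi> \<delta> by (simp_all add: \<phi>_def)
    have qn: "0 \<le> q ^ j - q ^ Suc j" for j using q by (simp add: mult_left_le_one_le)
    have [measurable]: "S (real j * \<delta>) \<in> borel_measurable M" for j using \<delta> by (intro S_meas) auto
    have F_meas [measurable]: "F \<delta> j \<in> borel_measurable borel" for j
    proof -
      have "F \<delta> j = (\<lambda>t. \<integral>\<^sup>+\<omega>. (if S (real j * \<delta>) \<omega> < t then 1 else 0) \<partial>M)"
        unfolding F_def by (intro ext nn_integral_cong) auto
      thus ?thesis by simp
    qed
    have F_lap: "(\<integral>\<^sup>+t. E t * F \<delta> j t \<partial>lborel) = ennreal (1 / s * \<phi> ^ j)" for j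
    proof -
      have ae: "AE \<omega> in M. 0 \<le> S (real j * \<delta>) \<omega>"
        using S_mono S0 by eventually_elim (use \<delta> mono_onD[of "{0..}" _ 0 "real j * \<delta>"] in force)
      have "(\<integral>\<^sup>+t. E t * F \<delta> j t \<partial>lborel) = (\<integral>\<^sup>+t. indicator {0<..} t * ennreal (exp (- s * t)) * (\<integral>\<^sup>+\<omega>. 1 * indicator {..<t} (S (real j * \<delta>) \<omega>) \<partial>M) \<partial>lborel)"
        by (intro nn_integral_cong) (auto simp: E_def F_def split: split_indicator)
      also have "\<dots> = ennreal (1 / s) * (\<integral>\<^sup>+\<omega>. 1 * ennreal (exp (- s * S (real j * \<delta>) \<omega>)) \<partial>M)"
        using ae by (intro nn_integral_laplace_distribution_function s) (auto intro: sigma_finite_measure_axioms)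
      also have "(\<integral>\<^sup>+\<omega>. 1 * ennreal (exp (- s * S (real j * \<delta>) \<omega>)) \<partial>M) = ennreal (expectation (\<lambda>\<omega>. exp (- s * S (real j * \<delta>) \<omega>)))"
      proof (subst nn_integral_eq_integral[symmetric])
        show "integrable M (\<lambda>\<omega>. exp (- s * S (real j * \<delta>) \<omega>))"
          using ae s by (intro integrable_const_bound[of _ 1]) (auto elim!: eventually_mono)
      qed auto
      also have "expectation (\<lambda>\<omega>. exp (- s * S (real j * \<delta>) \<omega>)) = \<phi> ^ j"
        using \<delta> by (subst lap) (auto simp: \<phi>_def exp_of_nat_mult[symmetric] algebra_simps)
      also have "ennreal (1 / s) * ennreal (\<phi> ^ j) = ennreal (1 / s * \<phi> ^ j)"
        using s by (intro ennreal_mult'[symmetric]) simp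
      finally show ?thesis .
    qed
    define T where "T t = (\<Sum>j. ennreal (q ^ j - q ^ Suc j) * F \<delta> j t)" for t
    have "q * \<phi> < 1" using q \<phi> by (metis less_eq_real_def mult_strict_mono mult_1 zero_less_one)
    have T_int: "(\<integral>\<^sup>+t. E t * T t \<partial>lborel) = ennreal (R \<delta>)"
    proof -
      have "(\<integral>\<^sup>+t. E t * T t \<partial>lborel) = (\<integral>\<^sup>+t. (\<Sum>j. E t * (ennreal (q ^ j - q ^ Suc j) * F \<delta> j t)) \<partial>lborel)"
        unfolding T_def by (simp only: ennreal_suminf_cmult)
      also have "\<dots> = (\<Sum>j. \<integral>\<^sup>+t. E t * (ennreal (q ^ j - q ^ Suc j) * F \<delta> j t) \<partial>lborel)"
        by (rule nn_integral_suminf) measurable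
      also have "\<dots> = (\<Sum>j. ennreal (q ^ j - q ^ Suc j) * ennreal (1 / s * \<phi> ^ j))"
      proof (rule arg_cong[where f = suminf], rule ext)
        fix j
        have "(\<integral>\<^sup>+t. E t * (ennreal (q ^ j - q ^ Suc j) * F \<delta> j t) \<partial>lborel) = (\<integral>\<^sup>+t. ennreal (q ^ j - q ^ Suc j) * (E t * F \<delta> j t) \<partial>lborel)"
          by (simp only: mult_ac)
        also have "\<dots> = ennreal (q ^ j - q ^ Suc j) * ennreal (1 / s * \<phi> ^ j)"
          unfolding F_lap[symmetric] by (rule nn_integral_cmult) measurable
        finally show "(\<integral>\<^sup>+t. E t * (ennreal (q ^ j - q ^ Suc j) * F \<delta> j t) \<partial>lborel) = ennreal (q ^ j - q ^ Suc j) * ennreal (1 / s * \<phi> ^ j)" .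
      qed
      also have "\<dots> = (\<Sum>j. ennreal ((1 - q) / s * (q * \<phi>) ^ j))"
      proof (rule arg_cong[where f = suminf], rule ext)
        fix j
        have "(q ^ j - q ^ Suc j) * (1 / s * \<phi> ^ j) = (1 - q) / s * (q * \<phi>) ^ j"
          by (simp add: power_mult_distrib field_simps)
        thus "ennreal (q ^ j - q ^ Suc j) * ennreal (1 / s * \<phi> ^ j) = ennreal ((1 - q) / s * (q * \<phi>) ^ j)"
          unfolding ennreal_mult'[OF qn, symmetric] by (rule arg_cong)
      qed
      also have "\<dots> = ennreal ((1 - q) / s * (1 / (1 - q * \<phi>)))"
        using q \<phi> s \<open>q * \<phi> < 1\<close>
        by (intro suminf_ennreal_eq sums_mult geometric_sums) auto
      finally show ?thesis by (simp add: R_def q_def \<phi>_def)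
    qed
    have T_bounds: "ennreal (1 - f t) \<le> T t" "T t \<le> ennreal (1 - q) + ennreal (1 - f t)" if t: "t > 0" for t
    proof -
      define D where "D \<omega> = (\<Sum>j. ennreal (q ^ j - q ^ Suc j) * indicator {..<t} (S (real j * \<delta>) \<omega>))" for \<omega>
      have TD: "T t = (\<integral>\<^sup>+\<omega>. D \<omega> \<partial>completion M)"
      proof -
        have "(\<integral>\<^sup>+\<omega>. D \<omega> \<partial>completion M) = (\<Sum>j. \<integral>\<^sup>+\<omega>. ennreal (q ^ j - q ^ Suc j) * indicator {..<t} (S (real j * \<delta>) \<omega>) \<partial>M)"
          unfolding nn_integral_completion D_def by (rule nn_integral_suminf) measurable
        also have "\<dots> = T t" unfolding T_def F_def
          by (intro arg_cong[where f = suminf] ext nn_integral_cmult) measurable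
        finally show ?thesis ..
      qed
      have D_bounds: "AE \<omega> in completion M. ennreal (1 - exp (- \<theta> * L t \<omega>)) \<le> D \<omega> \<and> D \<omega> \<le> ennreal ((1 - q) + (1 - exp (- \<theta> * L t \<omega>)))"
        using AE_completion[OF S_mono] AE_completion[OF S0] AE_completion[OF unbdd[of t]]
      proof eventually_elim
        case (elim \<omega>)
        then obtain s0 where s0: "s0 > 0" "S s0 \<omega> \<ge> t" by auto
        obtain d where d: "(\<lambda>j. (q ^ j - q ^ Suc j) * indicator {..<t} (S (real j * \<delta>) \<omega>)) sums d"
           "1 - exp (- \<theta> * L t \<omega>) \<le> d" "d \<le> (1 - q) + (1 - exp (- \<theta> * L t \<omega>))"
          using first_passage_grid_sandwich[OF elim(1,2) t s0 \<delta> \<theta>] unfolding q_def L[OF t] by blast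
        have "D \<omega> = (\<Sum>j. ennreal ((q ^ j - q ^ Suc j) * indicator {..<t} (S (real j * \<delta>) \<omega>)))"
          unfolding D_def by (intro arg_cong[where f = suminf] ext) (auto split: split_indicator)
        also have "\<dots> = ennreal d" using qn d(1) by (intro suminf_ennreal_eq) (auto split: split_indicator)
        finally show ?case using d by (simp add: ennreal_leI)
      qed
      have i1: "(\<integral>\<^sup>+\<omega>. ennreal (r + (1 - exp (- \<theta> * L t \<omega>))) \<partial>completion M) = ennreal (r + (1 - f t))" if "r \<ge> 0" for r
      proof -
        have "(\<integral>\<^sup>+\<omega>. ennreal (r + (1 - exp (- \<theta> * L t \<omega>))) \<partial>completion M) = ennreal (\<integral>\<omega>. r + (1 - exp (- \<theta> * L t \<omega>)) \<partial>completion M)"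
          using AE_completion[OF L_nonneg[OF t]] \<theta> that int[OF t]
          by (intro nn_integral_eq_integral) (auto elim!: eventually_mono)
        also have "(\<integral>\<omega>. r + (1 - exp (- \<theta> * L t \<omega>)) \<partial>completion M) = r + (1 - f t)"
          using int[OF t] by (simp add: f_def C.prob_space prob_space)
        finally show ?thesis .
      qed
      have "ennreal (1 - f t) = (\<integral>\<^sup>+\<omega>. ennreal (1 - exp (- \<theta> * L t \<omega>)) \<partial>completion M)" using i1[of 0] by simp
      also have "\<dots> \<le> T t" unfolding TD by (intro nn_integral_mono_AE) (use D_bounds in auto)
      finally show "ennreal (1 - f t) \<le> T t" .
      have "T t \<le> (\<integral>\<^sup>+\<omega>. ennreal ((1 - q) + (1 - exp (- \<theta> * L t \<omega>))) \<partial>completion M)"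
        unfolding TD by (intro nn_integral_mono_AE) (use D_bounds in auto)
      also have "\<dots> = ennreal ((1 - q) + (1 - f t))" using q by (intro i1) auto
      also have "\<dots> = ennreal (1 - q) + ennreal (1 - f t)" using q f_le[OF t] by (intro ennreal_plus) auto
      finally show "T t \<le> ennreal (1 - q) + ennreal (1 - f t)" .
    qed
    have "I \<le> (\<integral>\<^sup>+t. E t * T t \<partial>lborel)" unfolding I_def
    proof (intro nn_integral_mono)
      fix t show "E t * gt t \<le> E t * T t"
        using T_bounds(1)[of t] by (cases "t > 0") (auto simp: E_def gt_def intro!: mult_left_mono)
    qed
    thus "I \<le> ennreal (R \<delta>)" by (simp add: T_int)
    have "ennreal (R \<delta>) \<le> (\<integral>\<^sup>+t. ennreal (1 - q) * E t + E t * gt t \<partial>lborel)" unfolding T_int[symmetric]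
    proof (intro nn_integral_mono)
      fix t show "E t * T t \<le> ennreal (1 - q) * E t + E t * gt t"
      proof (cases "t > 0")
        case True
        have "E t * T t \<le> E t * (ennreal (1 - q) + gt t)"
          using T_bounds(2)[OF True] True by (intro mult_left_mono) (auto simp: gt_def)
        thus ?thesis by (simp add: distrib_left mult.commute)
      qed (simp add: E_def)
    qed
    also have "\<dots> = ennreal (1 - q) * ennreal (1 / s) + I"
      unfolding I_def E_int[symmetric] by (subst nn_integral_add) (auto intro!: nn_integral_cmult)
    also have "ennreal (1 - q) * ennreal (1 / s) = ennreal ((1 - q) / s)"
      using q s by (simp add: ennreal_mult'[symmetric])
    finally show "ennreal (R \<delta>) \<le> ennreal ((1 - exp (- \<theta> * \<delta>)) / s) + I" by (simp add: q_def)
  qed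
  have "I \<le> ennreal (R 1)" by (rule R) simp
  hence "I \<noteq> \<infinity>" by (auto simp: top_unique)
  then obtain i where i: "I = ennreal i" "i \<ge> 0" by (cases I) auto
  have Rn: "R \<delta> \<ge> 0" if "\<delta> > 0" for \<delta>
  proof -
    have e: "exp (- \<theta> * \<delta>) \<le> 1" "exp (- \<delta> * \<psi>) \<le> 1" using that \<theta> \<psi> by auto
    hence "exp (- \<theta> * \<delta>) * exp (- \<delta> * \<psi>) \<le> 1" by (intro mult_le_one) auto
    thus ?thesis unfolding R_def using s e by (intro mult_nonneg_nonneg divide_nonneg_nonneg) auto
  qed
  have R': "i \<le> R \<delta>" "R \<delta> \<le> (1 - exp (- \<theta> * \<delta>)) / s + i" if \<delta>: "\<delta> > 0" for \<delta>
  proof -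
    have "0 \<le> (1 - exp (- \<theta> * \<delta>)) / s" using \<theta> \<delta> s by simp
    thus "i \<le> R \<delta>" "R \<delta> \<le> (1 - exp (- \<theta> * \<delta>)) / s + i"
      using R[OF \<delta>] Rn[OF \<delta>] i by (auto simp: ennreal_plus[symmetric] simp del: ennreal_plus)
  qed
  have lim: "(R \<longlongrightarrow> (1 / s) * (\<theta> / (\<theta> + \<psi>))) (at_right 0)"
  proof -
    have d: "((\<lambda>\<delta>. (1 - exp (- a * \<delta>)) / \<delta>) \<longlongrightarrow> a) (at_right 0)" for a :: real
    proof -
      have "((\<lambda>\<delta>. 1 - exp (- a * \<delta>)) has_real_derivative a) (at_right 0)"
        by (auto intro!: derivative_eq_intros)
      thus ?thesis unfolding has_field_derivative_iff by simp
    qed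
    have "((\<lambda>\<delta>. (1 / s) * (((1 - exp (- \<theta> * \<delta>)) / \<delta>) / ((1 - exp (- (\<theta> + \<psi>) * \<delta>)) / \<delta>))) \<longlongrightarrow> (1 / s) * (\<theta> / (\<theta> + \<psi>))) (at_right 0)"
      using \<theta> \<psi> by (intro tendsto_intros d) auto
    moreover have "eventually (\<lambda>\<delta>. (1 / s) * (((1 - exp (- \<theta> * \<delta>)) / \<delta>) / ((1 - exp (- (\<theta> + \<psi>) * \<delta>)) / \<delta>)) = R \<delta>) (at_right 0)"
      using eventually_at_right_less[of "0::real"]
    proof eventually_elim
      case (elim \<delta>)
      have e: "exp (- (\<theta> + \<psi>) * \<delta>) = exp (- \<theta> * \<delta>) * exp (- \<delta> * \<psi>)"
        by (simp add: exp_add[symmetric] algebra_simps)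
      have "x / \<delta> / (y / \<delta>) = x / y" for x y using elim by simp
      thus ?case unfolding R_def e by (rule arg_cong)
    qed
    ultimately show ?thesis by (rule Lim_transform_eventually)
  qed
  have "i \<le> (1 / s) * (\<theta> / (\<theta> + \<psi>))"
    by (rule tendsto_lowerbound[OF lim]) (use R'(1) in \<open>auto simp: eventually_at_right_less eventually_at_filter\<close>)
  moreover have "(1 / s) * (\<theta> / (\<theta> + \<psi>)) \<le> i"
  proof (rule tendsto_upperbound)
    have "((\<lambda>\<delta>. R \<delta> - (1 - exp (- \<theta> * \<delta>)) / s) \<longlongrightarrow> (1 / s) * (\<theta> / (\<theta> + \<psi>)) - (1 - exp (- \<theta> * 0)) / s) (at_right 0)"
      using s by (intro tendsto_intros lim) auto
    thus "((\<lambda>\<delta>. R \<delta> - (1 - exp (- \<theta> * \<delta>)) / s) \<longlongrightarrow> (1 / s) * (\<theta> / (\<theta> + \<psi>))) (at_right 0)" by simp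
    show "eventually (\<lambda>\<delta>. R \<delta> - (1 - exp (- \<theta> * \<delta>)) / s \<le> i) (at_right 0)"
      using eventually_at_right_less[of "0::real"] by eventually_elim (use R'(2) in force)
  qed simp
  ultimately have i_eq: "i = (1 / s) * (\<theta> / (\<theta> + \<psi>))" by simp
  have "has_bochner_integral lborel (\<lambda>t. indicator {0<..} t * (exp (- s * t) * (1 - f t))) i"
  proof (rule has_bochner_integral_nn_integral)
    have eq: "(\<lambda>t. indicator {0<..} t * (exp (- s * t) * (1 - f t))) =
       (\<lambda>t. indicator {0<..} t * exp (- s * t) - exp (- s * t) * (indicator {0<..} t * f t))"
      by (auto simp: fun_eq_iff algebra_simps)
    show "(\<lambda>t. indicator {0<..} t * (exp (- s * t) * (1 - f t))) \<in> borel_measurable lborel"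
      unfolding eq by measurable
    show "AE t in lborel. 0 \<le> indicator {0<..} t * (exp (- s * t) * (1 - f t))"
      using f_le by (intro AE_I2) (auto split: split_indicator)
    show "(\<integral>\<^sup>+t. ennreal (indicator {0<..} t * (exp (- s * t) * (1 - f t))) \<partial>lborel) = ennreal i"
      unfolding i(1)[symmetric] I_def
      by (intro nn_integral_cong) (auto simp: E_def gt_def ennreal_mult'[symmetric] split: split_indicator)
  qed (fact i(2))
  moreover have "has_bochner_integral lborel (\<lambda>t. indicator {0<..} t * exp (- s * t)) (1 / s)"
    using E_int s unfolding E_def by (intro has_bochner_integral_nn_integral) auto
  ultimately have "has_bochner_integral lborel (\<lambda>t. indicator {0<..} t * exp (- s * t) - indicator {0<..} t * (exp (- s * t) * (1 - f t))) (1 / s - i)"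
    by (intro has_bochner_integral_diff)
  also have "(\<lambda>t. indicator {0<..} t * exp (- s * t) - indicator {0<..} t * (exp (- s * t) * (1 - f t))) = (\<lambda>t. indicator {0<..} t * (exp (- s * t) * f t))"
    by (auto simp: fun_eq_iff algebra_simps)
  also have "1 / s - i = \<psi> / (s * (\<theta> + \<psi>))"
  proof -
    have "1 / s - 1 / s * (\<theta> / y) = (y - \<theta>) / (s * y)" if "y > 0" for y
      using s that by (simp add: diff_divide_distrib)
    from this[of "\<theta> + \<psi>"] show ?thesis using \<theta> \<psi> by (simp add: i_eq)
  qed
  finally show "has_bochner_integral lborel
      (\<lambda>t. indicator {0<..} t * (exp (- s * t) * (\<integral>\<omega>. exp (- \<theta> * L t \<omega>) \<partial>completion M))) (\<psi> / (s * (\<theta> + \<psi>)))"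
    by (simp add: f_def)
qed

lemma (in prob_space) laplace_subordinator:
  assumes "tempered_stable_subordinator M \<beta> \<rho> H" "t \<ge> 0" "s > 0" "\<rho> > 0"
  shows "expectation (\<lambda>\<omega>. exp (- s * H t \<omega>)) = exp (- t * ((s + \<rho>) powr \<beta> - \<rho> powr \<beta>))"
    and "integrable M (\<lambda>\<omega>. exp (- s * H t \<omega>))"
proof -
  have H: "H t \<in> borel_measurable M" "AE \<omega> in M. H 0 \<omega> = 0" "AE \<omega> in M. mono_on {0..} (\<lambda>t. H t \<omega>)"
    using assms by (auto simp: tempered_stable_subordinator_def levy_process_def)
  show "expectation (\<lambda>\<omega>. exp (- s * H t \<omega>)) = exp (- t * ((s + \<rho>) powr \<beta> - \<rho> powr \<beta>))"
  proof (cases "\<beta> = 1")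
    case True
    hence "AE \<omega> in M. \<forall>t\<ge>0. H t \<omega> = t" using assms by (simp add: tempered_stable_subordinator_def)
    hence "expectation (\<lambda>\<omega>. exp (- s * H t \<omega>)) = expectation (\<lambda>\<omega>. exp (- s * t))"
    proof (intro integral_cong_AE)
      assume *: "AE \<omega> in M. \<forall>t\<ge>0. H t \<omega> = t"
      show "AE \<omega> in M. exp (- s * H t \<omega>) = exp (- s * t)"
        using * by eventually_elim (use assms(2) in simp)
    qed (use H(1) in measurable)
    also have "\<dots> = exp (- s * t)" by (simp add: prob_space)
    finally show ?thesis using True assms by (simp add: algebra_simps)
  next
    case False
    thus ?thesis using assms by (simp add: tempered_stable_subordinator_def)
  qed
  have "AE \<omega> in M. 0 \<le> H t \<omega>"
    using H(2,3) by eventually_elim (use assms(2) mono_onD[of "{0..}" _ 0 t] in force)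
  thus "integrable M (\<lambda>\<omega>. exp (- s * H t \<omega>))"
    using H(1) assms by (intro integrable_const_bound[of _ 1]) (auto elim!: eventually_mono)
qed

lemma (in prob_space) indep_processes_indep_var:
  assumes "indep_processes M X Y" "s \<ge> 0" "t \<ge> 0"
  shows "indep_var borel (X s) borel (Y t)"
proof -
  have "indep_var borel ((\<lambda>x. x s) \<circ> (\<lambda>\<omega>. restrict (\<lambda>t. X t \<omega>) {0..})) borel ((\<lambda>x. x t) \<circ> (\<lambda>\<omega>. restrict (\<lambda>t. Y t \<omega>) {0..}))"
    using assms unfolding indep_processes_def
    by (rule_tac indep_var_compose) (auto intro!: measurable_component_singleton)
  thus ?thesis using assms by (simp add: o_def)
qed

lemma (in prob_space) laplace_sum_subordinators:
  assumes "tempered_stable_subordinator M \<beta>1 \<rho> H1" "tempered_stable_subordinator M \<beta>2 \<rho> H2"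
    "indep_processes M H1 H2" "t \<ge> 0" "s > 0" "\<rho> > 0"
  shows "expectation (\<lambda>\<omega>. exp (- s * (H1 t \<omega> + H2 t \<omega>))) =
    exp (- t * (((s + \<rho>) powr \<beta>1 - \<rho> powr \<beta>1) + ((s + \<rho>) powr \<beta>2 - \<rho> powr \<beta>2)))"
    and "integrable M (\<lambda>\<omega>. exp (- s * (H1 t \<omega> + H2 t \<omega>)))"
proof -
  have "indep_var borel ((\<lambda>x. exp (- s * x)) \<circ> H1 t) borel ((\<lambda>x. exp (- s * x)) \<circ> H2 t)"
    by (rule indep_var_compose[OF indep_processes_indep_var[OF assms(3,4,4)]]) measurable
  hence iv: "indep_var borel (\<lambda>\<omega>. exp (- s * H1 t \<omega>)) borel (\<lambda>\<omega>. exp (- s * H2 t \<omega>))" by (simp add: o_def)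
  note l1 = laplace_subordinator[OF assms(1,4,5,6)] and l2 = laplace_subordinator[OF assms(2,4,5,6)]
  have eq: "exp (- s * (H1 t \<omega> + H2 t \<omega>)) = exp (- s * H1 t \<omega>) * exp (- s * H2 t \<omega>)" for \<omega>
    by (simp add: exp_add[symmetric] algebra_simps)
  show "expectation (\<lambda>\<omega>. exp (- s * (H1 t \<omega> + H2 t \<omega>))) =
    exp (- t * (((s + \<rho>) powr \<beta>1 - \<rho> powr \<beta>1) + ((s + \<rho>) powr \<beta>2 - \<rho> powr \<beta>2)))"
    unfolding eq indep_var_lebesgue_integral[OF iv l1(2) l2(2)] l1(1) l2(1)
    by (simp add: exp_add[symmetric] algebra_simps)
  show "integrable M (\<lambda>\<omega>. exp (- s * (H1 t \<omega> + H2 t \<omega>)))"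
    unfolding eq by (rule indep_var_integrable[OF iv l1(2) l2(2)])
qed

text \<open>Markov's inequality for exp (- S) bounds the probability that the path stays below t up to time n by
a quantity that decays geometrically in n.\<close>

lemma (in prob_space) AE_unbounded_if_laplace_decay:
  assumes S_meas: "\<And>x. x \<ge> 0 \<Longrightarrow> S x \<in> borel_measurable M"
    and int: "\<And>x. x \<ge> 0 \<Longrightarrow> integrable M (\<lambda>\<omega>. exp (- S x \<omega>))"
    and lap: "\<And>x. x \<ge> 0 \<Longrightarrow> expectation (\<lambda>\<omega>. exp (- S x \<omega>)) = exp (- x * \<psi>)" and \<psi>: "\<psi> > 0"
  shows "AE \<omega> in M. \<exists>x>0. S x \<omega> \<ge> (t :: real)"
proof -
  have [measurable]: "S (real n) \<in> borel_measurable M" for n by (rule S_meas) simp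
  define A where "A = {\<omega> \<in> space M. \<forall>n. S (real (Suc n)) \<omega> < t}"
  have [measurable]: "A \<in> sets M" unfolding A_def by measurable
  have "prob A * exp (- t) \<le> exp (- \<psi>) ^ Suc n" for n
  proof -
    have "prob A * exp (- t) = expectation (\<lambda>\<omega>. indicator A \<omega> * exp (- t))" by simp
    also have "\<dots> \<le> expectation (\<lambda>\<omega>. exp (- S (real (Suc n)) \<omega>))"
    proof (rule integral_mono)
      show "indicator A \<omega> * exp (- t) \<le> exp (- S (real (Suc n)) \<omega>)" for \<omega>
        by (auto simp: A_def less_imp_le simp del: of_nat_Suc split: split_indicator)
    qed (auto intro!: int integrable_real_mult_indicator simp: emeasure_eq_measure simp del: of_nat_Suc)
    also have "\<dots> = exp (- \<psi>) ^ Suc n" unfolding exp_of_nat_mult[symmetric] by (subst lap) (auto simp: algebra_simps)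
    finally show ?thesis .
  qed
  moreover have "(\<lambda>n. exp (- \<psi>) ^ Suc n) \<longlonglongrightarrow> 0"
    using \<psi> by (intro LIMSEQ_power_zero[THEN LIMSEQ_Suc]) auto
  ultimately have "prob A * exp (- t) \<le> 0"
    by (blast intro: LIMSEQ_le_const)
  hence "prob A = 0" by (simp add: mult_le_0_iff measure_le_0_iff)
  hence "AE \<omega> in M. \<omega> \<notin> A"
    by (intro AE_not_in) (simp add: null_sets_def emeasure_eq_measure)
  thus ?thesis using AE_space
  proof eventually_elim
    case (elim \<omega>)
    then obtain n where "t \<le> S (real (Suc n)) \<omega>" by (auto simp: A_def not_less)
    thus ?case by (intro exI[of _ "real (Suc n)"]) auto
  qed
qed

section \<open>A Poisson process at an independent random time\<close>

definition poisson_prob :: "real \<Rightarrow> nat \<Rightarrow> real \<Rightarrow> real" where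
  "poisson_prob lam n x = (lam * x) ^ n / fact n * exp (- lam * x)"

lemma poisson_prob_bounds: "lam \<ge> 0 \<Longrightarrow> x \<ge> 0 \<Longrightarrow> 0 \<le> poisson_prob lam n x"
   "lam > 0 \<Longrightarrow> x \<ge> 0 \<Longrightarrow> poisson_prob lam n x \<le> 1"
proof -
  show "lam \<ge> 0 \<Longrightarrow> x \<ge> 0 \<Longrightarrow> 0 \<le> poisson_prob lam n x" by (simp add: poisson_prob_def)
  assume "lam > 0" "x \<ge> 0"
  show "poisson_prob lam n x \<le> 1"
  proof (cases "x = 0")
    case True
    thus ?thesis by (cases n) (simp_all add: poisson_prob_def)
  next
    case False
    thus ?thesis using pmf_le_1[of "poisson_pmf (lam * x)" n] \<open>lam > 0\<close> \<open>x \<ge> 0\<close>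
      by (simp add: poisson_prob_def)
  qed
qed

text \<open>N is evaluated at the grid points Y_m just to the right of X. There independence and
the law of N at fixed times apply, since Y_m is discrete, and right continuity of the paths passes to the limit.
As path properties hold almost surely only, the event at time X is measurable for the completion.\<close>

lemma (in prob_space) prob_at_independent_time:
  fixes N :: "real \<Rightarrow> 'a \<Rightarrow> nat" and X :: "'a \<Rightarrow> real" and h :: "real \<Rightarrow> real"
  defines "Q \<equiv> completion M"
  assumes N_meas: "\<And>s. s > 0 \<Longrightarrow> N s \<in> measurable Q (count_space UNIV)"
    and N_dist: "\<And>s. s > 0 \<Longrightarrow> measure Q {\<omega> \<in> space M. N s \<omega> = n} = h s"
    and indep: "\<And>s. s > 0 \<Longrightarrow> prob_space.indep_var Q borel (\<lambda>\<omega>. real (N s \<omega>)) borel X"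
    and cont: "AE \<omega> in M. \<forall>t\<ge>0. continuous (at_right t) (\<lambda>s. real (N s \<omega>))"
    and X: "X \<in> borel_measurable Q" "AE \<omega> in M. X \<omega> \<ge> 0"
    and h: "continuous_on UNIV h" "\<And>x. x \<ge> 0 \<Longrightarrow> 0 \<le> h x" "\<And>x. x \<ge> 0 \<Longrightarrow> h x \<le> 1"
  shows "{\<omega> \<in> space M. N (X \<omega>) \<omega> = n} \<in> sets Q"
    and "measure Q {\<omega> \<in> space M. N (X \<omega>) \<omega> = n} = (\<integral>\<omega>. h (X \<omega>) \<partial>Q)"
proof -
  interpret Q: prob_space Q unfolding Q_def by (rule prob_space_completion)
  have sp: "space Q = space M" by (simp add: Q_def)
  note [measurable] = X(1)
  \<comment> \<open>The added 1 puts the grid point strictly to the right of X, hence also strictly above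
    0, where N has a Poisson law.\<close>
  define K where "K m \<omega> = nat \<lfloor>X \<omega> * real (Suc m)\<rfloor> + 1" for m \<omega>
  have [measurable]: "K m \<in> measurable Q (count_space UNIV)" for m
    unfolding K_def by measurable
  define Y where "Y m \<omega> = real (K m \<omega>) / real (Suc m)" for m \<omega>
  have [measurable]: "Y m \<in> borel_measurable Q" for m unfolding Y_def by measurable
  have Y_pos: "Y m \<omega> > 0" for m \<omega> by (simp add: Y_def K_def)
  have Y_bounds: "X \<omega> < Y m \<omega>" "Y m \<omega> \<le> X \<omega> + 1 / real (Suc m)" if "X \<omega> \<ge> 0" for m \<omega>
  proof -
    have "real (K m \<omega>) = real_of_int \<lfloor>X \<omega> * real (Suc m)\<rfloor> + 1"
      using that by (simp add: K_def)
    moreover have "X \<omega> * real (Suc m) < real_of_int \<lfloor>X \<omega> * real (Suc m)\<rfloor> + 1"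
      "real_of_int \<lfloor>X \<omega> * real (Suc m)\<rfloor> \<le> X \<omega> * real (Suc m)" by linarith+
    ultimately have "X \<omega> * real (Suc m) < real (K m \<omega>)" "real (K m \<omega>) \<le> X \<omega> * real (Suc m) + 1" by linarith+
    thus "X \<omega> < Y m \<omega>" "Y m \<omega> \<le> X \<omega> + 1 / real (Suc m)"
      by (simp_all add: Y_def field_simps del: of_nat_Suc)
  qed
  have Y_lim: "(\<lambda>m. Y m \<omega>) \<longlonglongrightarrow> X \<omega>" if "X \<omega> \<ge> 0" for \<omega>
  proof (rule tendsto_sandwich[where f = "\<lambda>_. X \<omega>"])
    show "eventually (\<lambda>m. X \<omega> \<le> Y m \<omega>) sequentially" using Y_bounds(1)[OF that] by (intro always_eventually) (auto intro: less_imp_le)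
    show "eventually (\<lambda>m. Y m \<omega> \<le> X \<omega> + 1 / real (Suc m)) sequentially" using Y_bounds(2)[OF that] by (intro always_eventually) auto
    show "(\<lambda>m. X \<omega> + 1 / real (Suc m)) \<longlonglongrightarrow> X \<omega>"
      using tendsto_add[OF tendsto_const[of "X \<omega>"] LIMSEQ_inverse_real_of_nat] by (simp add: inverse_eq_divide)
  qed simp
  have N_lim: "eventually (\<lambda>m. N (Y m \<omega>) \<omega> = N (X \<omega>) \<omega>) sequentially"
    if "X \<omega> \<ge> 0" "\<forall>t\<ge>0. continuous (at_right t) (\<lambda>s. real (N s \<omega>))" for \<omega>
  proof -
    have "((\<lambda>s. real (N s \<omega>)) \<longlongrightarrow> real (N (X \<omega>) \<omega>)) (at_right (X \<omega>))"
      using that by (auto simp: continuous_within)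
    moreover have "filterlim (\<lambda>m. Y m \<omega>) (at_right (X \<omega>)) sequentially"
      unfolding filterlim_at using Y_lim[OF that(1)] Y_bounds(1)[OF that(1)]
      by (auto intro!: always_eventually simp: less_imp_neq[symmetric])
    ultimately have "(\<lambda>m. real (N (Y m \<omega>) \<omega>)) \<longlonglongrightarrow> real (N (X \<omega>) \<omega>)"
      by (rule filterlim_compose)
    hence "eventually (\<lambda>m. dist (real (N (Y m \<omega>) \<omega>)) (real (N (X \<omega>) \<omega>)) < 1) sequentially"
      by (rule tendstoD) simp
    thus ?thesis by eventually_elim (simp add: dist_real_def)
  qed
  define A where "A m = {\<omega> \<in> space M. N (Y m \<omega>) \<omega> = n}" for m
  define B where "B j m = {\<omega> \<in> space Q. N (real (Suc j) / real (Suc m)) \<omega> = n}" for j m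
  have [measurable]: "B j m \<in> sets Q" for j m
  proof -
    have [measurable]: "N (real (Suc j) / real (Suc m)) \<in> measurable Q (count_space UNIV)" by (rule N_meas) simp
    show ?thesis unfolding B_def by measurable
  qed
  define E where "E j m = {\<omega> \<in> space Q. K m \<omega> = Suc j}" for j m
  have [measurable]: "E j m \<in> sets Q" for j m unfolding E_def by measurable
  have sum_E: "(\<Sum>j. indicator (E j m) \<omega> * F j) = F (K m \<omega> - 1)" if "\<omega> \<in> space Q" for F :: "nat \<Rightarrow> ennreal" and m \<omega>
  proof -
    have "(\<lambda>j. indicator (E j m) \<omega> * F j) = (\<lambda>j. if j = K m \<omega> - 1 then F j else 0)"
      using that by (auto simp: E_def fun_eq_iff K_def split: split_indicator)
    thus ?thesis using sums_single[of "K m \<omega> - 1" F] by (simp add: sums_iff)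
  qed
  have K1: "Suc (K m \<omega> - 1) = K m \<omega>" for m \<omega> by (simp add: K_def)
  have indA: "indicator (A m) \<omega> = (\<Sum>j. indicator (E j m) \<omega> * indicator (B j m) \<omega> :: ennreal)" if "\<omega> \<in> space Q" for m \<omega>
    unfolding sum_E[OF that] using that K1[of m \<omega>]
    by (auto simp: A_def B_def Y_def sp split: split_indicator)
  have A_meas [measurable]: "A m \<in> sets Q" for m
  proof -
    have "A m = (\<Union>j. E j m \<inter> B j m)"
    proof (intro equalityI subsetI)
      fix \<omega> assume "\<omega> \<in> A m"
      thus "\<omega> \<in> (\<Union>j. E j m \<inter> B j m)"
        using K1[of m \<omega>] by (intro UN_I[of "K m \<omega> - 1"]) (auto simp: A_def E_def B_def Y_def sp simp del: of_nat_Suc)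
    qed (auto simp: A_def E_def B_def Y_def sp)
    thus ?thesis by simp
  qed
  have A_prob: "measure Q (A m) = (\<integral>\<omega>. h (Y m \<omega>) \<partial>Q)" for m
  proof -
    have "emeasure Q (A m) = (\<integral>\<^sup>+\<omega>. indicator (A m) \<omega> \<partial>Q)" by simp
    also have "\<dots> = (\<integral>\<^sup>+\<omega>. (\<Sum>j. indicator (E j m) \<omega> * indicator (B j m) \<omega>) \<partial>Q)"
      by (intro nn_integral_cong indA)
    also have "\<dots> = (\<Sum>j. \<integral>\<^sup>+\<omega>. indicator (E j m) \<omega> * indicator (B j m) \<omega> \<partial>Q)"
      by (intro nn_integral_suminf) measurable
    also have "\<dots> = (\<Sum>j. \<integral>\<^sup>+\<omega>. indicator (E j m) \<omega> * ennreal (h (real (Suc j) / real (Suc m))) \<partial>Q)"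
    proof (rule arg_cong[where f = suminf], rule ext)
      fix j
      let ?s = "real (Suc j) / real (Suc m)"
      have s: "?s > 0" by simp
      define VX where "VX = {x. nat \<lfloor>(x :: real) * real (Suc m)\<rfloor> + 1 = Suc j}"
      have VX: "VX \<in> sets borel" 
      proof -
        have "{x \<in> space borel. nat \<lfloor>(x :: real) * real (Suc m)\<rfloor> + 1 = Suc j} \<in> sets borel" by measurable
        thus ?thesis by (simp add: VX_def)
      qed
      have "Q.prob ((\<lambda>x. (real (N ?s x), X x)) -` ({real n} \<times> VX) \<inter> space Q) =
         Q.prob ((\<lambda>\<omega>. real (N ?s \<omega>)) -` {real n} \<inter> space Q) * Q.prob (X -` VX \<inter> space Q)"
        by (rule Q.indep_varD[OF indep[OF s]]) (use VX in auto)
      also have "(\<lambda>x. (real (N ?s x), X x)) -` ({real n} \<times> VX) \<inter> space Q = E j m \<inter> B j m"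
        by (auto simp: E_def B_def VX_def K_def)
      also have "(\<lambda>\<omega>. real (N ?s \<omega>)) -` {real n} \<inter> space Q = {\<omega> \<in> space M. N ?s \<omega> = n}"
        by (auto simp: sp)
      also have "X -` VX \<inter> space Q = E j m" by (auto simp: E_def VX_def K_def)
      finally have P: "Q.prob (E j m \<inter> B j m) = h ?s * Q.prob (E j m)" unfolding N_dist[OF s] .
      have "(\<integral>\<^sup>+\<omega>. indicator (E j m) \<omega> * indicator (B j m) \<omega> \<partial>Q) = emeasure Q (E j m \<inter> B j m)"
        by (simp add: indicator_inter_arith[symmetric])
      also have "\<dots> = emeasure Q (E j m) * ennreal (h ?s)"
        using h(2)[of ?s] by (simp add: Q.emeasure_eq_measure P ennreal_mult' mult.commute)
      also have "\<dots> = (\<integral>\<^sup>+\<omega>. indicator (E j m) \<omega> * ennreal (h ?s) \<partial>Q)"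
        by (subst nn_integral_multc) auto
      finally show "(\<integral>\<^sup>+\<omega>. indicator (E j m) \<omega> * indicator (B j m) \<omega> \<partial>Q) = (\<integral>\<^sup>+\<omega>. indicator (E j m) \<omega> * ennreal (h ?s) \<partial>Q)" .
    qed
    also have "\<dots> = (\<integral>\<^sup>+\<omega>. (\<Sum>j. indicator (E j m) \<omega> * ennreal (h (real (Suc j) / real (Suc m)))) \<partial>Q)"
      by (intro nn_integral_suminf[symmetric]) measurable
    also have "\<dots> = (\<integral>\<^sup>+\<omega>. ennreal (h (Y m \<omega>)) \<partial>Q)"
      by (intro nn_integral_cong) (simp only: sum_E K1 Y_def)
    finally have "emeasure Q (A m) = (\<integral>\<^sup>+\<omega>. ennreal (h (Y m \<omega>)) \<partial>Q)" .
    moreover have [measurable]: "h \<in> borel_measurable borel" using h(1) by (rule borel_measurable_continuous_onI)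
    ultimately show ?thesis
      using Y_pos[THEN less_imp_le, THEN h(2)] by (subst integral_eq_nn_integral) (auto simp: measure_def)
  qed
  have [measurable]: "h \<in> borel_measurable borel" using h(1) by (rule borel_measurable_continuous_onI)
  define A' where "A' = {\<omega> \<in> space M. eventually (\<lambda>m. \<omega> \<in> A m) sequentially}"
  have A'_meas [measurable]: "A' \<in> sets Q"
  proof -
    have "A' = {\<omega> \<in> space Q. \<exists>k. \<forall>m\<ge>k. \<omega> \<in> A m}" by (auto simp: A'_def eventually_sequentially sp)
    thus ?thesis by simp
  qed
  define A0 where "A0 = {\<omega> \<in> space M. N (X \<omega>) \<omega> = n}"
  have ev: "AE \<omega> in M. \<omega> \<in> space M \<longrightarrow> eventually (\<lambda>m. \<omega> \<in> A m \<longleftrightarrow> \<omega> \<in> A0) sequentially"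
    using X(2) cont
  proof eventually_elim
    case (elim \<omega>)
    show ?case using N_lim[OF elim] by (auto simp: A_def A0_def elim!: eventually_mono)
  qed
  have AA': "AE \<omega> in M. \<omega> \<in> A0 \<longleftrightarrow> \<omega> \<in> A'"
    using ev
  proof eventually_elim
    case (elim \<omega>)
    show ?case
    proof (cases "\<omega> \<in> space M")
      case True
      with elim have "eventually (\<lambda>m. \<omega> \<in> A m \<longleftrightarrow> \<omega> \<in> A0) sequentially" by simp
      hence "eventually (\<lambda>m. \<omega> \<in> A m) sequentially \<longleftrightarrow> eventually (\<lambda>m. \<omega> \<in> A0) sequentially"
        by (intro eventually_cong) auto
      thus ?thesis using True by (auto simp: A'_def)
    qed (auto simp: A0_def A'_def)
  qed
  show A0_meas: "{\<omega> \<in> space M. N (X \<omega>) \<omega> = n} \<in> sets Q"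
  proof -
    have "AE \<omega> in M. \<not> (\<omega> \<in> A0 \<and> \<omega> \<notin> A')" using AA' by eventually_elim blast
    moreover have "AE \<omega> in M. \<not> (\<omega> \<in> A' \<and> \<omega> \<notin> A0)" using AA' by eventually_elim blast
    ultimately
    have "{\<omega> \<in> space Q. \<omega> \<in> A0 \<and> \<omega> \<notin> A'} \<in> sets Q" "{\<omega> \<in> space Q. \<omega> \<in> A' \<and> \<omega> \<notin> A0} \<in> sets Q"
      by (simp_all only: Q_def pred_def[symmetric] sets_completion_AE)
    moreover have "A0 = (A' - {\<omega> \<in> space Q. \<omega> \<in> A' \<and> \<omega> \<notin> A0}) \<union> {\<omega> \<in> space Q. \<omega> \<in> A0 \<and> \<omega> \<notin> A'}"
      by (auto simp: A0_def A'_def sp)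
    ultimately have "A0 \<in> sets Q" using A'_meas by (blast intro: ssubst[where P = "\<lambda>A. A \<in> sets Q"] sets.Un sets.Diff)
    thus ?thesis by (simp add: A0_def)
  qed
  hence [measurable]: "A0 \<in> sets Q" by (simp add: A0_def)
  have "(\<lambda>m. \<integral>\<omega>. indicator (A m) \<omega> \<partial>Q) \<longlonglongrightarrow> (\<integral>\<omega>. indicator A0 \<omega> \<partial>Q :: real)"
  proof (rule integral_dominated_convergence[where w = "\<lambda>_. 1"])
    have "AE \<omega> in Q. \<omega> \<in> space M \<longrightarrow> eventually (\<lambda>m. \<omega> \<in> A m \<longleftrightarrow> \<omega> \<in> A0) sequentially"
      unfolding Q_def by (rule AE_completion[OF ev])
    thus "AE \<omega> in Q. (\<lambda>m. indicator (A m) \<omega>) \<longlonglongrightarrow> (indicator A0 \<omega> :: real)"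
      using AE_space
    proof eventually_elim
      case (elim \<omega>)
      hence "eventually (\<lambda>m. \<omega> \<in> A m \<longleftrightarrow> \<omega> \<in> A0) sequentially" by (simp add: sp)
      thus ?case by (intro tendsto_eventually) (auto elim!: eventually_mono split: split_indicator)
    qed
  qed auto
  hence 1: "(\<lambda>m. measure Q (A m)) \<longlonglongrightarrow> measure Q A0" by simp
  have "(\<lambda>m. \<integral>\<omega>. h (Y m \<omega>) \<partial>Q) \<longlonglongrightarrow> (\<integral>\<omega>. h (X \<omega>) \<partial>Q)"
  proof (rule integral_dominated_convergence[where w = "\<lambda>_. 1"])
    have "AE \<omega> in Q. X \<omega> \<ge> 0" unfolding Q_def by (rule AE_completion[OF X(2)])
    thus "AE \<omega> in Q. (\<lambda>m. h (Y m \<omega>)) \<longlonglongrightarrow> h (X \<omega>)"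
    proof eventually_elim
      case (elim \<omega>)
      have "isCont h (X \<omega>)" using h(1) by (simp add: continuous_on_eq_continuous_at)
      thus ?case using Y_lim[OF elim] by (rule isCont_tendsto_compose)
    qed
    show "AE \<omega> in Q. norm (h (Y m \<omega>)) \<le> 1" for m
      using h(2,3)[OF Y_pos[THEN less_imp_le]] by (intro AE_I2) simp
  qed auto
  hence 2: "(\<lambda>m. measure Q (A m)) \<longlonglongrightarrow> (\<integral>\<omega>. h (X \<omega>) \<partial>Q)" by (simp add: A_prob)
  show "measure Q {\<omega> \<in> space M. N (X \<omega>) \<omega> = n} = (\<integral>\<omega>. h (X \<omega>) \<partial>Q)"
    using LIMSEQ_unique[OF 1 2] by (simp add: A0_def)
qed

text \<open>The generating function of the Poisson law, averaged over its random parameter.\<close>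

lemma (in prob_space) sums_poisson_mixture:
  assumes X: "X \<in> borel_measurable M" "AE \<omega> in M. X \<omega> \<ge> 0" and lam: "lam > 0" and u: "\<bar>u\<bar> < (1::real)"
  shows "(\<lambda>n. u ^ n * expectation (\<lambda>\<omega>. poisson_prob lam n (X \<omega>))) sums expectation (\<lambda>\<omega>. exp (- (lam * (1 - u)) * X \<omega>))"
proof -
  have [measurable]: "(\<lambda>x. poisson_prob lam n x) \<in> borel_measurable borel" for n
    unfolding poisson_prob_def by measurable
  note [measurable] = X(1)
  have b: "AE \<omega> in M. \<bar>u ^ n * poisson_prob lam n (X \<omega>)\<bar> \<le> \<bar>u\<bar> ^ n" for n
    using X(2) by eventually_elim
      (use poisson_prob_bounds[of lam _ n] lam in \<open>auto simp: abs_mult power_abs mult_left_le\<close>)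
  have int: "integrable M (\<lambda>\<omega>. u ^ n * poisson_prob lam n (X \<omega>))" for n
    using b[of n] by (intro integrable_const_bound[of _ "\<bar>u\<bar> ^ n"]) auto
  have pt: "(\<lambda>n. u ^ n * poisson_prob lam n x) sums exp (- (lam * (1 - u)) * x)" for x
  proof -
    have "(\<lambda>n. exp (- lam * x) * ((lam * u * x) ^ n /\<^sub>R fact n)) sums (exp (- lam * x) * exp (lam * u * x))"
      by (intro sums_mult exp_converges)
    also have "(\<lambda>n. exp (- lam * x) * ((lam * u * x) ^ n /\<^sub>R fact n)) = (\<lambda>n. u ^ n * poisson_prob lam n x)"
      by (auto simp: fun_eq_iff poisson_prob_def power_mult_distrib field_simps)
    also have "exp (- lam * x) * exp (lam * u * x) = exp (- (lam * (1 - u)) * x)"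
      by (simp add: exp_add[symmetric] algebra_simps)
    finally show ?thesis .
  qed
  have "(\<lambda>n. expectation (\<lambda>\<omega>. u ^ n * poisson_prob lam n (X \<omega>))) sums expectation (\<lambda>\<omega>. \<Sum>n. u ^ n * poisson_prob lam n (X \<omega>))"
  proof (rule sums_integral[OF int])
    have "AE \<omega> in M. \<forall>n. \<bar>u ^ n * poisson_prob lam n (X \<omega>)\<bar> \<le> \<bar>u\<bar> ^ n" using b by (simp add: AE_all_countable)
    thus "AE \<omega> in M. summable (\<lambda>n. norm (u ^ n * poisson_prob lam n (X \<omega>)))"
    proof eventually_elim
      case (elim \<omega>)
      show ?case by (rule summable_comparison_test'[of "\<lambda>n. \<bar>u\<bar> ^ n" 0])
        (use u elim in \<open>auto intro: summable_geometric\<close>)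
    qed
    show "summable (\<lambda>n. expectation (\<lambda>\<omega>. norm (u ^ n * poisson_prob lam n (X \<omega>))))"
    proof (rule summable_comparison_test'[of "\<lambda>n. \<bar>u\<bar> ^ n" 0])
      fix n :: nat
      have "expectation (\<lambda>\<omega>. norm (u ^ n * poisson_prob lam n (X \<omega>))) \<le> expectation (\<lambda>\<omega>. \<bar>u\<bar> ^ n)"
        using b[of n] by (intro integral_mono_AE integrable_norm int) auto
      thus "norm (expectation (\<lambda>\<omega>. norm (u ^ n * poisson_prob lam n (X \<omega>)))) \<le> \<bar>u\<bar> ^ n"
        by (simp add: prob_space)
    qed (use u in \<open>auto intro: summable_geometric\<close>)
  qed
  thus ?thesis using pt by (simp add: sums_iff)
qed

section \<open>The fractional Poisson process\<close>

text \<open>For real u in (-1, 1) the number \<lambda> (1 - u) is positive, so that the generating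
function is monotone in t and its transform is known; uniqueness identifies it with a gamma series.
Both sides are then power series in u with the same sum.\<close>

lemma count_prob_eq_gamma_series:
  fixes M :: "'a measure" and N :: "real \<Rightarrow> 'a \<Rightarrow> nat"
  assumes M: "prob_space M" and \<alpha>: "0 < \<alpha>" and \<rho>: "\<rho> > 0" and lam: "lam > 0"
    and H1: "tempered_stable_subordinator M (2 * \<alpha>) \<rho> H1"
    and H2: "tempered_stable_subordinator M \<alpha> \<rho> H2"
    and indep: "indep_processes M H1 H2"
    and N: "poisson_process M lam N"
    and indepN: "indep_processes (completion M) (\<lambda>t \<omega>. real (N t \<omega>)) (inverse_sum H1 H2)"
    and t: "t > 0"
  shows "count_prob M N (inverse_sum H1 H2) n t =
           gamma_series \<rho> \<alpha> (prob_coeff (\<rho> powr (2 * \<alpha>) + \<rho> powr \<alpha>) lam n) t"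
proof -
  interpret prob_space M by fact
  interpret C: prob_space "completion M" by (rule prob_space_completion)
  define L where "L = inverse_sum H1 H2"
  define S where "S x \<omega> = H1 x \<omega> + H2 x \<omega>" for x \<omega>
  define c where "c = \<rho> powr (2 * \<alpha>) + \<rho> powr \<alpha>"
  define \<psi> where "\<psi> s = (s + \<rho>) powr (2 * \<alpha>) + (s + \<rho>) powr \<alpha> - c" for s
  have c: "c \<ge> 0" by (simp add: c_def)
  have \<psi>_pos: "\<psi> s > 0" if "s > 0" for s
    using powr_less_mono2[of "2 * \<alpha>" \<rho> "s + \<rho>"] powr_less_mono2[of \<alpha> \<rho> "s + \<rho>"] that \<alpha> \<rho>
    by (simp add: \<psi>_def c_def)
  have S_meas: "S x \<in> borel_measurable M" if "x \<ge> 0" for x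
    using H1 H2 that unfolding S_def tempered_stable_subordinator_def levy_process_def
    by (intro borel_measurable_add) auto
  have S_mono: "AE \<omega> in M. mono_on {0..} (\<lambda>x. S x \<omega>)"
  proof -
    have "AE \<omega> in M. mono_on {0..} (\<lambda>x. H1 x \<omega>)" "AE \<omega> in M. mono_on {0..} (\<lambda>x. H2 x \<omega>)"
      using H1 H2 by (auto simp: tempered_stable_subordinator_def)
    thus ?thesis by eventually_elim (auto simp: S_def mono_on_def intro!: add_mono)
  qed
  have S0: "AE \<omega> in M. S 0 \<omega> = 0"
  proof -
    have "AE \<omega> in M. H1 0 \<omega> = 0" "AE \<omega> in M. H2 0 \<omega> = 0"
      using H1 H2 by (auto simp: tempered_stable_subordinator_def levy_process_def)
    thus ?thesis by eventually_elim (auto simp: S_def)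
  qed
  have lap: "expectation (\<lambda>\<omega>. exp (- s * S x \<omega>)) = exp (- x * \<psi> s)" "integrable M (\<lambda>\<omega>. exp (- s * S x \<omega>))"
    if "x \<ge> 0" "s > 0" for x s
    using laplace_sum_subordinators[OF H1 H2 indep that \<rho>] by (simp_all add: S_def \<psi>_def c_def algebra_simps)
  have unbdd: "AE \<omega> in M. \<exists>x>0. S x \<omega> \<ge> T" for T
    using lap(1)[of _ 1] lap(2)[of _ 1] by (intro AE_unbounded_if_laplace_decay[where \<psi> = "\<psi> 1"] S_meas \<psi>_pos) auto
  have iv: "C.indep_var borel (\<lambda>\<omega>. real (N s \<omega>)) borel (L x)" if "s \<ge> 0" "x \<ge> 0" for s x
    using C.indep_processes_indep_var[OF indepN that] by (simp add: L_def)
  have L_meas: "L x \<in> borel_measurable (completion M)" if "x > 0" for x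
    using C.indep_var_rv2[OF iv[of 0 x]] that by simp
  have L_eq: "L x \<omega> = Inf {y. y > 0 \<and> S y \<omega> \<ge> x}" if "x > 0" for x \<omega>
    using that by (simp add: L_def inverse_sum_def S_def)
  note fp = laplace_first_passage[OF S_meas S_mono S0 lap(1) _ \<psi>_pos _ unbdd L_meas L_eq]
  have L_nonneg: "AE \<omega> in M. L t \<omega> \<ge> 0" using fp(3)[of 1 1 t] t by simp
  have p: "count_prob M N L n t = (\<integral>\<omega>. poisson_prob lam n (L t \<omega>) \<partial>completion M)" for n
    unfolding count_prob_def
  proof (rule prob_at_independent_time(2)[where N = N and X = "L t" and h = "poisson_prob lam n"])
    fix s :: real assume s: "s > 0"
    have Ns: "N s \<in> measurable M (count_space UNIV)" using N s by (simp add: poisson_process_def)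
    thus "N s \<in> measurable (completion M) (count_space UNIV)" by (rule measurable_completion)
    have "measure (completion M) {\<omega> \<in> space M. N s \<omega> = n} = prob {\<omega> \<in> space M. N s \<omega> = n}"
      using Ns by (intro measure_completion) measurable
    also have "\<dots> = measure (distr M (count_space UNIV) (N s)) {n}"
      using Ns by (subst measure_distr) (auto intro!: arg_cong[where f = prob])
    also have "distr M (count_space UNIV) (N s) = measure_pmf (poisson_pmf (lam * s))"
      using N s by (simp add: poisson_process_def)
    also have "measure (measure_pmf (poisson_pmf (lam * s))) {n} = poisson_prob lam n s"
      using lam s by (simp add: measure_pmf_single poisson_prob_def)
    finally show "measure (completion M) {\<omega> \<in> space M. N s \<omega> = n} = poisson_prob lam n s" .
    show "C.indep_var borel (\<lambda>\<omega>. real (N s \<omega>)) borel (L t)" using iv s t by simp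
  next
    have "AE \<omega> in M. cadlag (\<lambda>t. real (N t \<omega>))" using N by (simp add: poisson_process_def levy_process_def)
    thus "AE \<omega> in M. \<forall>t\<ge>0. continuous (at_right t) (\<lambda>s. real (N s \<omega>))"
      by eventually_elim (simp add: cadlag_def)
    show "continuous_on UNIV (poisson_prob lam n)" unfolding poisson_prob_def by (intro continuous_intros) auto
  qed (use L_meas t L_nonneg lam poisson_prob_bounds in auto)
  define D where "D = 1 + c + 2 * lam"
  have D: "D > 0" using c lam by (simp add: D_def)
  have gf: "(\<integral>\<omega>. exp (- (lam * (1 - u)) * L t \<omega>) \<partial>completion M) = gamma_series \<rho> \<alpha> (gf_coeff c (lam * (u - 1))) t"
    if u: "\<bar>u\<bar> < 1" for u :: real
  proof -
    define \<theta> where "\<theta> = lam * (1 - u)"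
    have \<theta>: "\<theta> > 0" "\<theta> \<le> 2 * lam" using u lam by (auto simp: \<theta>_def)
    have w: "lam * (u - 1) = - \<theta>" by (simp add: \<theta>_def algebra_simps)
    have bound: "norm (gf_coeff c (- \<theta>) k) \<le> D ^ k" for k
      unfolding D_def using c \<theta> by (intro norm_gf_coeff_le) auto
    \<comment> \<open>From s0 on, x = (s + \<rho>)^(- \<alpha>) is at most 1 / (2 D), inside the disc of
      convergence of the coefficient series.\<close>
    define s0 where "s0 = (2 * D) powr (1 / \<alpha>)"
    have s0: "s0 > 0" using D by (simp add: s0_def)
    have "(\<integral>\<omega>. exp (- \<theta> * L t \<omega>) \<partial>completion M) = gamma_series \<rho> \<alpha> (gf_coeff c (- \<theta>)) t"
    proof (rule laplace_unique_antimono_continuous[where ?s0.0 = s0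
        and f = "\<lambda>t. \<integral>\<omega>. exp (- \<theta> * L t \<omega>) \<partial>completion M" and g = "gamma_series \<rho> \<alpha> (gf_coeff c (- \<theta>))"
        and F = "\<lambda>s. \<psi> s / (s * (\<theta> + \<psi> s))"])
      show "(\<integral>\<omega>. exp (- \<theta> * L t2 \<omega>) \<partial>completion M) \<le> (\<integral>\<omega>. exp (- \<theta> * L t1 \<omega>) \<partial>completion M)"
        if "0 < t1" "t1 \<le> t2" for t1 t2
        using fp(2)[of 1 \<theta> t1 t2] that \<theta> by simp
      show "continuous_on {0<..} (gamma_series \<rho> \<alpha> (gf_coeff c (- \<theta>)))"
        using has_vector_derivative_gamma_series[OF \<rho> \<alpha> D bound]
        by (intro continuous_at_imp_continuous_on ballI has_vector_derivative_continuous) auto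
      fix s assume s: "s \<ge> s0"
      hence sp: "s > 0" using s0 by simp
      show "has_bochner_integral lborel (\<lambda>t. indicator {0<..} t * (exp (- s * t) * (\<integral>\<omega>. exp (- \<theta> * L t \<omega>) \<partial>completion M))) (\<psi> s / (s * (\<theta> + \<psi> s)))"
        using fp(1)[of s \<theta>] sp \<theta> by simp
      define z where "z = (s + \<rho>) powr \<alpha>"
      define x where "x = (s + \<rho>) powr (- \<alpha>)"
      have z: "z > 0" using sp \<rho> by (simp add: z_def)
      have x: "x = 1 / z" using sp \<rho> by (simp add: x_def z_def powr_minus inverse_eq_divide)
      have "2 * D = s0 powr \<alpha>" using D \<alpha> by (simp add: s0_def powr_powr)
      also have "\<dots> \<le> z" unfolding z_def using s s0 \<rho> \<alpha> by (intro powr_mono2) auto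
      finally have Dx: "D * x < 1" using z D by (simp add: x field_simps)
      have "(s + \<rho>) powr (2 * \<alpha>) = z\<^sup>2" using sp \<rho> by (simp add: z_def power2_eq_square powr_add[symmetric])
      hence \<psi>z: "\<psi> s = z\<^sup>2 + z - c" by (simp add: \<psi>_def z_def)
      have e1: "1 + x - c * x\<^sup>2 = \<psi> s * x\<^sup>2" and e2: "1 + x - (c + - \<theta>) * x\<^sup>2 = (\<theta> + \<psi> s) * x\<^sup>2"
        using z by (simp_all add: x \<psi>z field_simps power2_eq_square)
      have nz: "(\<theta> + \<psi> s) * x\<^sup>2 \<noteq> 0" using \<theta> \<psi>_pos[OF sp] z by (simp add: x)
      have "(\<Sum>k. gf_coeff c (- \<theta>) k * x ^ k) = (1 + x - c * x\<^sup>2) / (1 + x - (c + - \<theta>) * x\<^sup>2)"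
      proof (rule suminf_gf_coeff[where r = "2 * lam"])
        show "1 + x - (c + - \<theta>) * x\<^sup>2 \<noteq> 0" unfolding e2 by (rule nz)
      qed (use c Dx z \<theta> in \<open>auto simp: x D_def\<close>)
      also have "\<dots> = \<psi> s / (\<theta> + \<psi> s)" unfolding e1 e2 using nz by simp
      finally have "(\<Sum>k. gf_coeff c (- \<theta>) k * x ^ k) / s = \<psi> s / (s * (\<theta> + \<psi> s))" by simp
      thus "has_bochner_integral lborel (\<lambda>t. indicator {0<..} t * (exp (- s * t) * gamma_series \<rho> \<alpha> (gf_coeff c (- \<theta>)) t)) (\<psi> s / (s * (\<theta> + \<psi> s)))"
        using has_bochner_integral_laplace_gamma_series[OF \<rho> \<alpha> D bound sp] Dx by (simp add: x_def)
    qed (fact t)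
    thus ?thesis unfolding w \<theta>_def .
  qed
  have "(\<lambda>n. (count_prob M N L n t - gamma_series \<rho> \<alpha> (prob_coeff c lam n) t) * u ^ n) sums 0"
    if u: "\<bar>u\<bar> < 1" for u :: real
  proof -
    have "(\<lambda>n. u ^ n * count_prob M N L n t) sums gamma_series \<rho> \<alpha> (gf_coeff c (lam * (u - 1))) t"
      unfolding p gf[OF u, symmetric]
      by (intro C.sums_poisson_mixture L_meas t AE_completion L_nonneg lam u)
    moreover have "(\<lambda>n. u ^ n * gamma_series \<rho> \<alpha> (prob_coeff c lam n) t) sums gamma_series \<rho> \<alpha> (gf_coeff c (lam * (u - 1))) t"
      using sums_gamma_series_prob_coeff[OF \<rho> \<alpha> c _ t, of lam u] lam u by simp
    ultimately show ?thesis using sums_diff by (fastforce simp: algebra_simps)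
  qed
  from powser_coeffs_eq_0[OF this, of n] show ?thesis by (simp add: L_def c_def)
qed

theorem theorem17:
  fixes M :: "'a measure"
    and H1 H2 :: "real \<Rightarrow> 'a \<Rightarrow> real"
    and N :: "real \<Rightarrow> 'a \<Rightarrow> nat"
    and L :: "real \<Rightarrow> 'a \<Rightarrow> real"
    and p :: "nat \<Rightarrow> real \<Rightarrow> real"
    and G :: "complex \<Rightarrow> real \<Rightarrow> complex"
    and \<alpha> \<rho> lam :: real
  assumes "prob_space M"
    and "0 < \<alpha>" and "\<alpha> \<le> 1/2" and "\<rho> > 0" and "lam > 0"
    and "tempered_stable_subordinator M (2 * \<alpha>) \<rho> H1"
    and "tempered_stable_subordinator M \<alpha> \<rho> H2"
    and "indep_processes M H1 H2"
    and "L = inverse_sum H1 H2"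
    and "poisson_process M lam N"
    and "indep_processes (completion M) (\<lambda>t \<omega>. real (N t \<omega>)) L"
    and "p = count_prob M N L"
    and "G = count_pgf M N L"
  shows "(\<forall>n. \<forall>t>0.
            caputo_differentiable (2 * \<alpha>) \<rho> (p n) t \<and>
            caputo_differentiable \<alpha> \<rho> (p n) t \<and>
            caputo_derivative (2 * \<alpha>) \<rho> (p n) t + caputo_derivative \<alpha> \<rho> (p n) t =
              - lam * (p n t - (if n = 0 then 0 else p (n - 1) t))) \<and>
         p 0 0 = 1 \<and> (\<forall>n\<ge>1. p n 0 = 0) \<and>
         (\<forall>u. norm u \<le> 1 \<longrightarrow>
            (\<forall>t>0.
               caputo_differentiable (2 * \<alpha>) \<rho> (G u) t \<and>
               caputo_differentiable \<alpha> \<rho> (G u) t \<and>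
               caputo_derivative (2 * \<alpha>) \<rho> (G u) t + caputo_derivative \<alpha> \<rho> (G u) t =
                 complex_of_real lam * (u - 1) * G u t) \<and>
            G u 0 = 1)"
proof -
  interpret prob_space M by fact
  note \<alpha> = assms(2) and \<alpha>' = assms(3) and \<rho> = assms(4) and lam = assms(5)
  define c where "c = \<rho> powr (2 * \<alpha>) + \<rho> powr \<alpha>"
  have c: "c \<ge> 0" by (simp add: c_def)
  define D where "D = 1 + c + 2 * lam"
  have D: "D > 0" using c lam by (simp add: D_def)
  have p: "p n t = gamma_series \<rho> \<alpha> (prob_coeff c lam n) t" if "t > 0" for n t
    unfolding assms(12) assms(9) c_def
    by (rule count_prob_eq_gamma_series[OF assms(1) \<alpha> \<rho> lam assms(6-8,10) _ that])
       (use assms(9,11) in simp)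
  have pc: "norm (prob_coeff c lam n k) \<le> D ^ k" for n k
    unfolding D_def using abs_prob_coeff_le[OF c, of lam n k] lam by simp
  have eq_p: "caputo_differentiable (2 * \<alpha>) \<rho> (p n) t \<and> caputo_differentiable \<alpha> \<rho> (p n) t \<and>
       caputo_derivative (2 * \<alpha>) \<rho> (p n) t + caputo_derivative \<alpha> \<rho> (p n) t =
              - lam * (p n t - (if n = 0 then 0 else p (n - 1) t))" if t: "t > 0" for n t
  proof -
    have "prob_coeff c lam n 1 = 0" by simp
    note cs = caputo_sum_gamma_series[OF \<rho> \<alpha> \<alpha>' D pc t p this]
    define A where "A n k = prob_coeff c lam n k" for n k
    have b: "A n (k + 2) + A n (k + 1) - (if k = 0 then 0 else (\<rho> powr (2 * \<alpha>) + \<rho> powr \<alpha>) *\<^sub>R A n k)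
        = - lam * A n k - (if n = 0 then 0 else - lam * A (n - 1) k)" for k
      unfolding c_def[symmetric] A_def by (simp add: numeral_2_eq_2 algebra_simps)
    have s: "(\<lambda>k. gamma_cdf \<rho> (\<alpha> * real k) t *\<^sub>R (- lam * prob_coeff c lam n k)) sums (- lam * p n t)" for n
      unfolding p[OF t] by (rule sums_gamma_series_cmult[OF \<rho> \<alpha> D pc t])
    have s': "(\<lambda>k. gamma_cdf \<rho> (\<alpha> * real k) t *\<^sub>R (if n = 0 then 0 else - lam * prob_coeff c lam (n - 1) k))
        sums (if n = 0 then 0 else - lam * p (n - 1) t)"
      using s[of "n - 1"] by auto
    have "gamma_series \<rho> \<alpha> (\<lambda>k. - lam * A n k - (if n = 0 then 0 else - lam * A (n - 1) k)) t =
        - lam * (p n t - (if n = 0 then 0 else p (n - 1) t))"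
      using sums_diff[OF s[of n] s']
      by (auto simp: gamma_series_def A_def sums_iff algebra_simps)
    thus ?thesis using cs unfolding A_def[symmetric] b by simp
  qed
  have "AE \<omega> in M. N 0 \<omega> = 0" using assms(10) by (simp add: poisson_process_def levy_process_def)
  moreover have [measurable]: "N 0 \<in> measurable M (count_space UNIV)" using assms(10) by (simp add: poisson_process_def)
  ultimately have "prob {\<omega> \<in> space M. N 0 \<omega> = n} = (if n = 0 then 1 else 0)" for n
    by (cases "n = 0") (auto simp: prob_space intro!: prob_eq_0_AE prob_Collect_eq_1[THEN iffD2] elim!: eventually_mono)
  hence p0: "p n 0 = (if n = 0 then 1 else 0)" for n
    by (simp add: assms(12,9) count_prob_def inverse_sum_def)
  have G: "G u t = gamma_series \<rho> \<alpha> (gf_coeff c (of_real lam * (u - 1))) t" if "t > 0" "norm u \<le> 1" for u t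
    using sums_gamma_series_prob_coeff[OF \<rho> \<alpha> c _ that, of lam] lam p[OF that(1)]
    by (simp add: assms(13) count_pgf_def assms(12)[symmetric] sums_iff)
  have eq_G: "caputo_differentiable (2 * \<alpha>) \<rho> (G u) t \<and> caputo_differentiable \<alpha> \<rho> (G u) t \<and>
      caputo_derivative (2 * \<alpha>) \<rho> (G u) t + caputo_derivative \<alpha> \<rho> (G u) t = complex_of_real lam * (u - 1) * G u t"
    if u: "norm u \<le> 1" and t: "t > 0" for u t
  proof -
    define w where "w = complex_of_real lam * (u - 1)"
    have "norm w \<le> lam * (norm u + norm (1::complex))"
      unfolding w_def norm_mult using lam norm_triangle_ineq4[of u 1] by (auto intro!: mult_left_mono)
    also have "\<dots> \<le> 2 * lam" using u lam by simp
    finally have w: "norm w \<le> 2 * lam" .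
    have gc: "norm (gf_coeff c w k) \<le> D ^ k" for k
      unfolding D_def by (rule norm_gf_coeff_le[OF c w])
    have "gf_coeff c w 1 = 0" by simp
    note cs = caputo_sum_gamma_series[OF \<rho> \<alpha> \<alpha>' D gc t G[OF _ u, folded w_def] this]
    have b: "gf_coeff c w (k + 2) + gf_coeff c w (k + 1) - (if k = 0 then 0 else (\<rho> powr (2 * \<alpha>) + \<rho> powr \<alpha>) *\<^sub>R gf_coeff c w k)
        = w * gf_coeff c w k" for k
      unfolding c_def[symmetric] by (simp add: numeral_2_eq_2 scaleR_conv_of_real algebra_simps)
    have "gamma_series \<rho> \<alpha> (\<lambda>k. w * gf_coeff c w k) t = w * G u t"
      using sums_gamma_series_cmult[OF \<rho> \<alpha> D gc t, of w] G[OF t u]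
      by (simp add: gamma_series_def sums_iff w_def)
    thus ?thesis using cs unfolding b by (simp add: w_def)
  qed
  have G0: "G u 0 = 1" for u
  proof -
    have "G u 0 = (\<Sum>n. if n = 0 then 1 else 0)"
      unfolding assms(13) count_pgf_def assms(12)[symmetric] p0 by (intro suminf_cong) auto
    also have "\<dots> = 1" using sums_single[of 0 "\<lambda>_. 1::complex"] by (simp add: sums_iff)
    finally show ?thesis .
  qed
  show ?thesis using eq_p eq_G G0 p0 by auto
qed

end
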